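(* Let $1<p<\infty$ and let $f\in H^p$ with $f(0)\neq 0$. Write $f=JF$ with $J$ inner and $F$ outer, and let $\hat J=\overline{J(0)}\,J$. Let $g_p^*$ be the metric projection of $1$ onto $[f]_p$, that is, the unique solution of the minimization problem $\inf_{g\in[f]_p}\|1-g\|_p$. Then $$g_p^*=1-(1-\hat J)^{2/p}.$$ Moreover, $g_p^*$ has no inner factor other than $J$ (that is, $g_p^*=J\,G$ with $G$ outer), and $$\operatorname{dist}_{H^p}(1,[f]_p)=\left(1-|J(0)|^2\right)^{1/p}.$$
   Context: $\mathbb{D}$ is the open unit disk and $\mathbb{T}$ the unit circle with normalized Lebesgue measure $m$. $H^p$ is the Hardy space of analytic functions on $\mathbb{D}$ with norm $\|f\|_p^p=\sup_{0<r<1}\frac1{2\pi}\int_0^{2\pi}|f(re^{i\theta})|^p\,d\theta$; functions in $H^p$ are identified with their boundary values in $L^p(\mathbb{T},m)$. A function in $H^\infty$ is inner if its boundary values have modulus $1$ a.e. on $\mathbb{T}$. Every nonzero $f\in H^p$ factors as $f=JF$ with $J$ inner and $F$ outer, uniquely up to unimodular constants. For $f\in H^p$, $[f]_p$ is the closure in $H^p$ of $\operatorname{span}\{z^kf:k=0,1,2,\dots\}$. $\operatorname{dist}_{H^p}(1,M)=\inf_{g\in M}\|1-g\|_p$. The power $(1-\hat J)^{2/p}$ is taken with the principal branch (when $J$ is non-constant, $|\hat J|\le|J(0)|<1$ in $\mathbb{D}$, so $1-\hat J$ takes values in the right half-plane; when $J$ is constant, $1-\hat J=0$ and its power is $0$).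 *)

theory Defs
  imports "HOL-Complex_Analysis.Complex_Analysis"
begin

text \<open>Functions on the open unit disk are represented by total functions on the complex plane;
  only their values on \<open>ball 0 1\<close> matter, so equality in a Hardy space is
  equality on \<open>ball 0 1\<close>.\<close>

definition circle_mean :: "real \<Rightarrow> (complex \<Rightarrow> complex) \<Rightarrow> real \<Rightarrow> real" where
  "circle_mean p f r =
     (1 / (2 * pi)) * (LINT t:{0..2*pi}|lborel. norm (f (of_real r * cis t)) powr p)"

definition hardy_space :: "real \<Rightarrow> (complex \<Rightarrow> complex) set" where
  "hardy_space p =
     {f. f holomorphic_on ball 0 1 \<and> bdd_above (circle_mean p f ` {0<..<1})}"

text \<open>The supremum is taken in the reals, so the norm is meaningful only on \<open>hardy_space p\<close>.\<close>

definition hardy_norm :: "real \<Rightarrow> (complex \<Rightarrow> complex) \<Rightarrow> real" where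
  "hardy_norm p f = (SUP r\<in>{0<..<1}. circle_mean p f r) powr (1 / p)"

text \<open>Boundary values are radial limits.\<close>

definition has_boundary_value :: "(complex \<Rightarrow> complex) \<Rightarrow> real \<Rightarrow> complex \<Rightarrow> bool" where
  "has_boundary_value f t w \<longleftrightarrow> ((\<lambda>r. f (of_real r * cis t)) \<longlongrightarrow> w) (at_left (1::real))"

definition inner_function :: "(complex \<Rightarrow> complex) \<Rightarrow> bool" where
  "inner_function J \<longleftrightarrow>
     J holomorphic_on ball 0 1 \<and> bounded (J ` ball 0 1) \<and>
     (AE t\<in>{0..2*pi} in lborel. \<exists>w. has_boundary_value J t w \<and> norm w = 1)"

text \<open>Outer functions of the class \<open>H\<^sup>p\<close>. Integrability of \<open>ln \<psi>\<close> classically forces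
  \<open>\<psi> > 0\<close> almost everywhere; positivity is required explicitly because \<open>ln 0 = 0\<close> here.\<close>

definition outer_function :: "real \<Rightarrow> (complex \<Rightarrow> complex) \<Rightarrow> bool" where
  "outer_function p F \<longleftrightarrow>
     (\<exists>(c::complex) (\<psi>::real \<Rightarrow> real). norm c = 1 \<and> (\<forall>t. \<psi> t > 0) \<and>
        set_integrable lborel {0..2*pi} (\<lambda>t. ln (\<psi> t)) \<and>
        set_integrable lborel {0..2*pi} (\<lambda>t. \<psi> t powr p) \<and>
        (\<forall>z\<in>ball 0 1. F z = c * exp (of_real (1 / (2 * pi)) *
           (LINT t:{0..2*pi}|lborel. (cis t + z) / (cis t - z) * of_real (ln (\<psi> t))))))"

definition shift_span :: "(complex \<Rightarrow> complex) \<Rightarrow> (complex \<Rightarrow> complex) set" where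
  "shift_span f = {(\<lambda>z. \<Sum>k<n. c k * (z ^ k * f z)) |(n::nat) c. True}"

definition hardy_closure ::
    "real \<Rightarrow> (complex \<Rightarrow> complex) set \<Rightarrow> (complex \<Rightarrow> complex) set" where
  "hardy_closure p S =
     {g \<in> hardy_space p. \<forall>e>0. \<exists>h\<in>S. hardy_norm p (\<lambda>z. g z - h z) < e}"

definition shift_invariant_hull ::
    "real \<Rightarrow> (complex \<Rightarrow> complex) \<Rightarrow> (complex \<Rightarrow> complex) set" where
  "shift_invariant_hull p f = hardy_closure p (shift_span f)"

definition hardy_dist ::
    "real \<Rightarrow> (complex \<Rightarrow> complex) \<Rightarrow> (complex \<Rightarrow> complex) set \<Rightarrow> real" where
  "hardy_dist p u M = (INF g\<in>M. hardy_norm p (\<lambda>z. u z - g z))"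

definition is_best_approx ::
    "real \<Rightarrow> (complex \<Rightarrow> complex) \<Rightarrow> (complex \<Rightarrow> complex) set \<Rightarrow> (complex \<Rightarrow> complex) \<Rightarrow> bool" where
  "is_best_approx p u M g \<longleftrightarrow>
     g \<in> M \<and> hardy_norm p (\<lambda>z. u z - g z) = hardy_dist p u M"

text \<open>Uniqueness of the minimizer is understood in \<open>H\<^sup>p\<close>, that is, on the disk.\<close>

definition is_metric_projection ::
    "real \<Rightarrow> (complex \<Rightarrow> complex) \<Rightarrow> (complex \<Rightarrow> complex) set \<Rightarrow> (complex \<Rightarrow> complex) \<Rightarrow> bool" where
  "is_metric_projection p u M g \<longleftrightarrow>
     is_best_approx p u M g \<and>
     (\<forall>h. is_best_approx p u M h \<longrightarrow> (\<forall>z\<in>ball 0 1. h z = g z))"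

end

theory Submission
  imports Defs "HOL-Real_Asymp.Real_Asymp"
begin

text \<open>
  Put \<open>v = 1 - cnj (J 0) * J\<close>, \<open>a = v powr (2 / p)\<close> and \<open>g = 1 - a\<close>. Then
  \<open>\<bar>a\<bar>\<^sup>p = \<bar>v\<bar>\<^sup>2\<close>, and as \<open>\<bar>J\<bar> = 1\<close> almost everywhere on the circle, the mean of
  \<open>\<bar>v\<bar>\<^sup>2\<close> there is \<open>1 - \<bar>J 0\<bar>\<^sup>2\<close>; this is the \<open>p\<close>-th power of the distance.

  Why \<open>g\<close> is optimal. The functional that norms \<open>a\<close> is integration against
  \<open>k = \<bar>a\<bar>\<^sup>p / a = cnj v * v powr (1 - 2 / p)\<close>. On the circle \<open>J * cnj v = J - J 0\<close>, so for
  \<open>h\<close> in \<open>H\<^sup>p\<close> the mean of \<open>J * h * k\<close> is that of the analytic function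
  \<open>(J - J 0) * h * v powr (1 - 2 / p)\<close>, which vanishes at \<open>0\<close>. Hence \<open>k\<close> annihilates
  \<open>[f]\<^sub>p\<close>, whose elements are limits of products \<open>J * h\<close> (\<open>inner_conj_mean\<close>,
  \<open>closure_orthogonal\<close>). The supporting line inequality
  \<open>\<bar>a + b\<bar>\<^sup>p \<ge> \<bar>a\<bar>\<^sup>p + p * Re (b * k)\<close>, applied to \<open>b = g - x\<close>, gives
  \<open>\<parallel>1 - x\<parallel> \<ge> \<parallel>1 - g\<parallel>\<close> for every \<open>x\<close> in \<open>[f]\<^sub>p\<close>; a version of it with a remainder that
  controls \<open>\<bar>b\<bar>\<^sup>p\<close> (\<open>uniform_convexity\<close>) gives uniqueness (\<open>convexity_duality\<close>).

  Why \<open>g\<close> belongs to \<open>[f]\<^sub>p\<close>. The quotient \<open>(1 - (1 - w) powr s) / w\<close> has no zero in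
  the unit disk when \<open>0 < s < 2\<close>, so \<open>g = J * exp L\<close> with \<open>L\<close> bounded and analytic
  (\<open>extremal_factorization\<close>). In particular \<open>exp L\<close> is outer (\<open>exp_bounded_outer\<close>), and it
  remains to approximate it by multiples \<open>q * F\<close> with \<open>q\<close> a polynomial
  (\<open>outer_approx_poly\<close>), which is the cyclicity of outer functions. For this, entire functions
  \<open>Q\<close> are chosen with \<open>Re Q\<close> close to \<open>- ln \<bar>F\<bar>\<close> on the circle. Then
  \<open>exp Q * F\<close>, suitably rotated, has \<open>p\<close>-mean at most slightly above \<open>1\<close> and value close to
  \<open>1\<close> at the origin, and uniform convexity at the constant function \<open>1\<close> makes it close to
  \<open>1\<close> in \<open>H\<^sup>p\<close> (\<open>outer_function_almost_invertible\<close>).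

  General functions in \<open>H\<^sup>p\<close> are never evaluated on the circle itself. All estimates are for
  means over circles of radius \<open>r < 1\<close>, and only \<open>J\<close> and functions of \<open>J\<close> are followed
  along radii up to the boundary.
\<close>

section \<open>Means over the unit circle\<close>

text \<open>A probability measure on the whole line, so that means over circles are plain integrals to which
  dominated convergence and Fubini's theorem apply.\<close>

definition circ :: "real measure" where
  "circ = density lborel (\<lambda>t. ennreal (indicator {0..2*pi} t / (2*pi)))"

lemma sets_circ [simp, measurable_cong]: "sets circ = sets borel"
  by (simp add: circ_def)

lemma space_circ [simp]: "space circ = UNIV"
  by (simp add: circ_def)

lemma AE_circ: "(AE t in circ. P t) \<longleftrightarrow> (AE t\<in>{0..2*pi} in lborel. P t)"
  unfolding circ_def by (subst AE_density) (auto simp: indicator_def)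

lemma integrable_circ_iff:
  fixes f :: "real \<Rightarrow> 'a::{banach, second_countable_topology}"
  assumes "f \<in> borel_measurable borel"
  shows "integrable circ f \<longleftrightarrow> set_integrable lborel {0..2*pi} f"
proof -
  have "integrable circ f \<longleftrightarrow> integrable lborel (\<lambda>t. (indicator {0..2*pi} t / (2*pi)) *\<^sub>R f t)"
    unfolding circ_def using assms by (intro integrable_density) auto
  also have "(\<lambda>t. (indicator {0..2*pi} t / (2*pi)) *\<^sub>R f t)
      = (\<lambda>t. (1 / (2*pi)) *\<^sub>R (indicator {0..2*pi} t *\<^sub>R f t))"
    by (auto simp: fun_eq_iff indicator_def)
  also have "integrable lborel \<dots> \<longleftrightarrow> set_integrable lborel {0..2*pi} f"
    unfolding set_integrable_def
  proof
    assume "integrable lborel (\<lambda>t. (1/(2*pi)) *\<^sub>R (indicator {0..2*pi} t *\<^sub>R f t))"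
    then have "integrable lborel (\<lambda>t. (2*pi) *\<^sub>R ((1/(2*pi)) *\<^sub>R (indicator {0..2*pi} t *\<^sub>R f t)))"
      by (rule integrable_scaleR_right)
    moreover have "(\<lambda>t. (2*pi) *\<^sub>R ((1/(2*pi)) *\<^sub>R (indicator {0..2*pi} t *\<^sub>R f t)))
        = (\<lambda>t. indicator {0..2*pi} t *\<^sub>R f t)"
      by (simp add: fun_eq_iff)
    ultimately show "integrable lborel (\<lambda>t. indicator {0..2*pi} t *\<^sub>R f t)" by (simp only:)
  qed (rule integrable_scaleR_right)
  finally show ?thesis .
qed

lemma integral_circ:
  fixes f :: "real \<Rightarrow> 'a::{banach, second_countable_topology}"
  assumes "f \<in> borel_measurable borel"
  shows "(LINT t|circ. f t) = (1 / (2*pi)) *\<^sub>R (LINT t:{0..2*pi}|lborel. f t)"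
proof -
  have "(LINT t|circ. f t) = (LINT t|lborel. (indicator {0..2*pi} t / (2*pi)) *\<^sub>R f t)"
    unfolding circ_def using assms by (intro integral_density) auto
  also have "(\<lambda>t. (indicator {0..2*pi} t / (2*pi)) *\<^sub>R f t)
      = (\<lambda>t. (1 / (2*pi)) *\<^sub>R (indicator {0..2*pi} t *\<^sub>R f t))"
    by (auto simp: fun_eq_iff indicator_def)
  also have "(LINT t|lborel. (1 / (2*pi)) *\<^sub>R (indicator {0..2*pi} t *\<^sub>R f t))
      = (1 / (2*pi)) *\<^sub>R (LINT t:{0..2*pi}|lborel. f t)"
    unfolding set_lebesgue_integral_def by (rule integral_scaleR_right)
  finally show ?thesis .
qed

lemma emeasure_circ: "emeasure circ UNIV = 1"
proof -
  have "emeasure circ UNIV = (\<integral>\<^sup>+t. ennreal (1/(2*pi)) * indicator {0..2*pi} t \<partial>lborel)"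
    unfolding circ_def by (subst emeasure_density)
      (auto intro!: nn_integral_cong simp: indicator_def)
  also have "\<dots> = ennreal (1/(2*pi)) * ennreal (2*pi)"
    by (subst nn_integral_cmult_indicator) auto
  also have "\<dots> = 1" by (simp flip: ennreal_mult)
  finally show ?thesis .
qed

interpretation circ: finite_measure circ
  by standard (simp add: emeasure_circ)

lemma measure_circ [simp]: "measure circ UNIV = 1"
  by (simp add: measure_def emeasure_circ)

lemma integral_circ_const [simp]: "(LINT t|circ. c) = (c::'a::{banach, second_countable_topology})"
  by simp

lemma continuous_on_circle:
  assumes "continuous_on (cball 0 r) f" "0 \<le> r"
  shows "continuous_on UNIV (\<lambda>t. f (of_real r * cis t))"
  by (rule continuous_on_compose2[OF assms(1)])
     (use assms(2) in \<open>auto intro!: continuous_intros simp: norm_mult\<close>)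

lemma integrable_circ_continuous:
  fixes f :: "real \<Rightarrow> 'a::{banach, second_countable_topology}"
  assumes "continuous_on UNIV f"
  shows "integrable circ f"
proof -
  have m: "f \<in> borel_measurable borel" using assms by (rule borel_measurable_continuous_onI)
  have "set_integrable lborel {0..2*pi} f"
    unfolding set_integrable_def
    by (rule borel_integrable_compact) (auto intro: continuous_on_subset[OF assms])
  with integrable_circ_iff[OF m] show ?thesis by simp
qed


section \<open>The formulas of Cauchy, Herglotz and Schwarz\<close>

lemma cauchy_mean:
  assumes f: "f holomorphic_on cball 0 r" and r: "0 < r" and w: "norm w < r"
  shows "(LINT t|circ. f (of_real r * cis t) * (of_real r * cis t) / (of_real r * cis t - w)) = f w"
proof -
  let ?g = "\<lambda>t. f (of_real r * cis t) * (of_real r * cis t) / (of_real r * cis t - w)"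
  have nz: "of_real r * cis t - w \<noteq> 0" for t
  proof
    assume "of_real r * cis t - w = 0"
    then have "w = of_real r * cis t" by simp
    then have "norm w = r" using r by (simp add: norm_mult)
    with w show False by simp
  qed
  have cont: "continuous_on UNIV ?g"
    using r nz by (intro continuous_intros continuous_on_circle holomorphic_on_imp_continuous_on f) auto
  have "((\<lambda>u. f u/(u-w)) has_contour_integral (2 * of_real pi * \<i> * f w)) (circlepath 0 r)"
    using Cauchy_integral_circlepath_simple[OF f, of w] w by simp
  then have "((\<lambda>t. f (0 + r * cis t) / (0 + r * cis t - w) * r * \<i> * cis t)
      has_integral (2 * of_real pi * \<i> * f w)) {0..2*pi}"
    unfolding circlepath_def by (subst (asm) has_contour_integral_part_circlepath_iff) auto
  then have "((\<lambda>t. (1/(2 * of_real pi * \<i>)) * (f (0 + r * cis t) / (0 + r * cis t - w) * r * \<i> * cis t))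
      has_integral (1/(2 * of_real pi * \<i>)) * (2 * of_real pi * \<i> * f w)) {0..2*pi}"
    by (rule has_integral_mult_right)
  then have hi: "((\<lambda>t. (1/(2*pi)) *\<^sub>R ?g t) has_integral f w) {0..2*pi}"
    by (rule back_subst[where P="\<lambda>g. (g has_integral _) _", OF has_integral_eq_rhs])
       (auto simp: fun_eq_iff scaleR_conv_of_real field_simps)
  have si: "set_integrable lborel {0..2*pi} ?g"
    using integrable_circ_continuous[OF cont] integrable_circ_iff cont
    by (blast intro: borel_measurable_continuous_onI)
  have "(LINT t|circ. ?g t) = (1 / (2*pi)) *\<^sub>R integral {0..2*pi} ?g"
    by (simp add: integral_circ borel_measurable_continuous_onI[OF cont] set_borel_integral_eq_integral[OF si])
  also have "\<dots> = integral {0..2*pi} (\<lambda>t. (1/(2*pi)) *\<^sub>R ?g t)"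
    by simp
  also have "\<dots> = f w" using hi by (rule integral_unique)
  finally show ?thesis .
qed

lemma mean_value:
  assumes f: "f holomorphic_on cball 0 r" and r: "0 < r"
  shows "(LINT t|circ. f (of_real r * cis t)) = f 0"
  using cauchy_mean[OF assms, of 0] r by simp

text \<open>The analytic completion of the Poisson integral of \<open>u\<close>; it is real at the origin.\<close>

definition herglotz :: "(real \<Rightarrow> real) \<Rightarrow> complex \<Rightarrow> complex" where
  "herglotz u z = (LINT t|circ. (cis t + z) / (cis t - z) * of_real (u t))"

lemma cis_minus_nonzero: "norm z < 1 \<Longrightarrow> cis t - z \<noteq> 0"
  by (metis eq_iff_diff_eq_0 norm_cis less_irrefl)

lemma herglotz_kernel_continuous:
  assumes "norm z < 1"
  shows "continuous_on UNIV (\<lambda>t. (cis t + z) / (cis t - z))"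
  using cis_minus_nonzero[OF assms] by (intro continuous_intros) auto

lemma herglotz_kernel_bound:
  assumes "norm z < 1"
  shows "norm ((cis t + z) / (cis t - z)) \<le> 2 / (1 - norm z)"
proof -
  have "norm (cis t + z) \<le> 2" using norm_triangle_ineq[of "cis t" z] assms by simp
  moreover have "1 - norm z \<le> norm (cis t - z)" using norm_triangle_ineq2[of "cis t" z] by simp
  ultimately show ?thesis using assms by (simp add: norm_divide) (intro frac_le, auto)
qed

lemma herglotz_integrable:
  assumes "norm z < 1" "integrable circ u"
  shows "integrable circ (\<lambda>t. (cis t + z) / (cis t - z) * complex_of_real (u t))"
proof (rule Bochner_Integration.integrable_bound)
  show "integrable circ (\<lambda>t. 2 / (1 - norm z) * u t)" using assms by simp
  show "(\<lambda>t. (cis t + z) / (cis t - z) * complex_of_real (u t)) \<in> borel_measurable circ"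
    using borel_measurable_continuous_onI[OF herglotz_kernel_continuous[OF assms(1)]] assms(2)
    by measurable
  show "AE t in circ. norm ((cis t + z) / (cis t - z) * complex_of_real (u t)) \<le> norm (2 / (1 - norm z) * u t)"
  proof (rule AE_I2)
    fix t
    have "norm ((cis t + z) / (cis t - z)) * \<bar>u t\<bar> \<le> 2 / (1 - norm z) * \<bar>u t\<bar>"
      by (intro mult_right_mono herglotz_kernel_bound assms) auto
    then show "norm ((cis t + z) / (cis t - z) * complex_of_real (u t)) \<le> norm (2 / (1 - norm z) * u t)"
      using assms(1) by (simp only: norm_mult norm_of_real real_norm_def abs_mult) simp
  qed
qed

lemma herglotz_add:
  assumes "norm z < 1" "integrable circ u" "integrable circ v"
  shows "herglotz (\<lambda>t. u t + v t) z = herglotz u z + herglotz v z"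
  using herglotz_integrable[OF assms(1,2)] herglotz_integrable[OF assms(1,3)]
  by (simp add: herglotz_def distrib_left)

text \<open>On the circle the Herglotz kernel \<open>(\<zeta> + z) / (\<zeta> - z)\<close> is twice the Cauchy kernel minus
  \<open>1\<close>, so its mean against \<open>f\<close> is \<open>2 * f - f 0\<close>. Against \<open>cnj f\<close> its mean is \<open>cnj (f 0)\<close>:
  after conjugation the kernel becomes \<open>(1 + cnj z * \<zeta>) / (1 - cnj z * \<zeta>)\<close>, analytic on the closed
  disk, and the mean value property applies. Half the sum of the two is the formula.\<close>

lemma schwarz_formula:
  assumes f: "f holomorphic_on cball 0 r" and r: "0 < r" and z: "norm z < 1"
  shows "f (of_real r * z) = \<i> * Im (f 0) + herglotz (\<lambda>t. Re (f (of_real r * cis t))) z"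
proof -
  define K where "K = (\<lambda>t. (cis t + z) / (cis t - z))"
  define g where "g = (\<lambda>t. f (of_real r * cis t))"
  have cf: "continuous_on UNIV g"
    unfolding g_def using f r by (intro continuous_on_circle holomorphic_on_imp_continuous_on) auto
  have cK: "continuous_on UNIV K" unfolding K_def by (rule herglotz_kernel_continuous[OF z])
  have rz: "norm (of_real r * z) < r" using r z by (simp add: norm_mult)
  \<comment> \<open>The mean of \<open>f\<close> against the kernel, by the Cauchy formula.\<close>
  have "(LINT t|circ. g t * K t) = (LINT t|circ. 2 * (g t * (of_real r * cis t) / (of_real r * cis t - of_real r * z)) - g t)"
  proof (rule arg_cong[where f="integral\<^sup>L circ"], rule ext)
    fix t
    have "K t = 2 * (cis t / (cis t - z)) - 1" 
      using cis_minus_nonzero[OF z, of t] by (simp add: K_def field_simps)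
    moreover have "of_real r * cis t / (of_real r * cis t - of_real r * z) = cis t / (cis t - z)"
      using r by (simp flip: right_diff_distrib)
    ultimately show "g t * K t = 2 * (g t * (of_real r * cis t) / (of_real r * cis t - of_real r * z)) - g t"
      by (metis (no_types, lifting) mult.left_commute mult.right_neutral right_diff_distrib times_divide_eq_right)
  qed
  also have "\<dots> = 2 * (LINT t|circ. g t * (of_real r * cis t) / (of_real r * cis t - of_real r * z)) - (LINT t|circ. g t)"
  proof -
    have nz: "of_real r * cis t - of_real r * z \<noteq> 0" for t
      using cis_minus_nonzero[OF z, of t] r by (simp flip: right_diff_distrib)
    have "integrable circ (\<lambda>t. g t * (of_real r * cis t) / (of_real r * cis t - of_real r * z))"
      by (intro integrable_circ_continuous continuous_intros cf) (use nz in auto)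
    moreover have "integrable circ g" by (intro integrable_circ_continuous cf)
    ultimately show ?thesis by (simp del: times_divide_eq_right)
  qed
  also have "\<dots> = 2 * f (of_real r * z) - f 0"
    unfolding g_def cauchy_mean[OF f r rz] mean_value[OF f r] ..
  finally have A: "(LINT t|circ. g t * K t) = 2 * f (of_real r * z) - f 0" .
  \<comment> \<open>The conjugate of the mean of \<open>cnj f\<close> against the kernel, extended analytically from the
    circle of radius \<open>r\<close> to the disk that it bounds.\<close>
  define h where "h = (\<lambda>x. f x * ((of_real r + cnj z * x) / (of_real r - cnj z * x)))"
  have nz: "of_real r - cnj z * x \<noteq> 0" if "norm x \<le> r" for x
  proof
    assume "of_real r - cnj z * x = 0"
    then have "of_real r = cnj z * x" by simp
    then have "norm (complex_of_real r) = norm z * norm x" by (metis norm_mult complex_mod_cnj)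
    moreover have "norm z * norm x \<le> norm z * r" using that by (simp add: mult_left_mono)
    moreover have "norm z * r < 1 * r" using z r by (intro mult_strict_right_mono)
    ultimately show False using r by simp
  qed
  have hol: "h holomorphic_on cball 0 r"
    unfolding h_def using nz by (intro holomorphic_intros f) auto
  have "(LINT t|circ. cnj (g t) * K t) = (LINT t|circ. cnj (h (of_real r * cis t)))"
  proof (rule arg_cong[where f="integral\<^sup>L circ"], rule ext)
    fix t
    have c: "cis t * cnj (cis t) = 1" by (simp add: cis_cnj cis_mult)
    have n1: "cis t - z \<noteq> 0" using cis_minus_nonzero[OF z] .
    have "(of_real r + cnj z * (of_real r * cis t)) / (of_real r - cnj z * (of_real r * cis t))
      = (1 + cnj z * cis t) / (1 - cnj z * cis t)"
    proof -
      have "of_real r + cnj z * (of_real r * cis t) = of_real r * (1 + cnj z * cis t)"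
        "of_real r - cnj z * (of_real r * cis t) = of_real r * (1 - cnj z * cis t)"
        by (simp_all add: algebra_simps)
      then show ?thesis using r by simp
    qed
    also have "\<dots> = (cis t * (cnj (cis t) + cnj z)) / (cis t * (cnj (cis t) - cnj z))"
      using c by (simp add: algebra_simps)
    also have "\<dots> = cnj (K t)"
      by (simp add: K_def)
    finally show "cnj (g t) * K t = cnj (h (of_real r * cis t))"
      by (simp add: h_def g_def del: complex_cnj_divide times_divide_eq_right)
  qed
  also have "\<dots> = cnj (LINT t|circ. h (of_real r * cis t))"
    by (simp add: integral_cnj)
  also have "\<dots> = cnj (f 0)"
    using mean_value[OF hol r] r by (simp add: h_def)
  finally have B: "(LINT t|circ. cnj (g t) * K t) = cnj (f 0)" .
  have "herglotz (\<lambda>t. Re (g t)) z = (LINT t|circ. (g t * K t + cnj (g t) * K t) / 2)"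
    unfolding herglotz_def K_def[symmetric]
  proof (rule arg_cong[where f="integral\<^sup>L circ"], rule ext)
    fix t
    have "complex_of_real (Re (g t)) = (g t + cnj (g t)) / 2" by (simp add: complex_add_cnj)
    then show "(cis t + z) / (cis t - z) * complex_of_real (Re (g t)) = (g t * K t + cnj (g t) * K t) / 2"
      by (simp add: K_def algebra_simps add_divide_distrib)
  qed
  also have "\<dots> = ((2 * f (of_real r * z) - f 0) + cnj (f 0)) / 2"
    using integrable_circ_continuous[of "\<lambda>t. g t * K t"] integrable_circ_continuous[of "\<lambda>t. cnj (g t) * K t"] cf cK A B
    by (simp add: continuous_intros)
  finally have "herglotz (\<lambda>t. Re (g t)) z = ((2 * f (of_real r * z) - f 0) + cnj (f 0)) / 2" .
  then show ?thesis
    unfolding g_def by (auto simp: complex_eq_iff)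
qed

section \<open>Uniform convexity of the p-th power of the modulus\<close>

lemma powr_tangent_strict:
  fixes y p :: real
  assumes p: "1 < p" and y: "0 \<le> y" "y \<noteq> 1"
  shows "1 + p * (y - 1) < y powr p"
proof (cases "y = 0")
  case True
  then show ?thesis using p by simp
next
  case False
  then have y0: "y > 0" using y by simp
  have D: "((\<lambda>x. x powr p) has_real_derivative p * x powr (p - 1)) (at x)" if "x > 0" for x :: real
    using that by (auto intro!: derivative_eq_intros)
  show ?thesis
  proof (cases "y < 1")
    case True
    obtain x where x: "y < x" "x < 1" "1 powr p - y powr p = (1 - y) * (p * x powr (p - 1))"
      using MVT2[OF True, of "\<lambda>x. x powr p" "\<lambda>x. p * x powr (p - 1)"] D y0 by auto
    have "x powr (p - 1) < 1" using x y0 p powr_less_mono2[of "p - 1" x 1] by simp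
    then have "(1 - y) * (p * x powr (p - 1)) < (1 - y) * (p * 1)"
      using True p by (intro mult_strict_left_mono) auto
    then show ?thesis using x by (simp add: algebra_simps)
  next
    case False
    then have y1: "1 < y" using y by simp
    obtain x where x: "1 < x" "x < y" "y powr p - 1 powr p = (y - 1) * (p * x powr (p - 1))"
      using MVT2[OF y1, of "\<lambda>x. x powr p" "\<lambda>x. p * x powr (p - 1)"] D by auto
    have "1 < x powr (p - 1)" using x p by simp
    then have "(y - 1) * (p * 1) < (y - 1) * (p * x powr (p - 1))"
      using y1 p by (intro mult_strict_left_mono) auto
    then show ?thesis using x by (simp add: algebra_simps)
  qed
qed

text \<open>Bernoulli's inequality at \<open>\<bar>1 + b\<bar>\<close>, combined with \<open>1 + Re b \<le> \<bar>1 + b\<bar>\<close>. It can only be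
  an equality if \<open>\<bar>1 + b\<bar> = 1\<close>, and then \<open>Re b = 0\<close> forces \<open>b = 0\<close>.\<close>

lemma norm_powr_tangent:
  fixes b :: complex
  assumes p: "1 < p"
  shows "1 + p * Re b \<le> norm (1 + b) powr p"
    and "b \<noteq> 0 \<Longrightarrow> 1 + p * Re b < norm (1 + b) powr p"
proof -
  have re: "1 + Re b \<le> norm (1 + b)" using complex_Re_le_cmod[of "1 + b"] by simp
  show strict: "1 + p * Re b < norm (1 + b) powr p" if b: "b \<noteq> 0"
  proof (cases "norm (1 + b) = 1")
    case True
    have "(1 + Re b)\<^sup>2 + (Im b)\<^sup>2 = 1"
      using True by (simp add: cmod_def)
    then have "Re b < 0"
      using b True re by (cases "Re b = 0") (auto simp: complex_eq_iff power2_eq_square)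
    then show ?thesis using True p by (simp add: mult_pos_neg)
  next
    case False
    have "1 + p * Re b \<le> 1 + p * (norm (1 + b) - 1)"
      using re p by (intro add_left_mono mult_left_mono) auto
    also have "\<dots> < norm (1 + b) powr p"
      by (rule powr_tangent_strict) (use p False in auto)
    finally show ?thesis .
  qed
  show "1 + p * Re b \<le> norm (1 + b) powr p"
    using strict by (cases "b = 0") (auto intro: less_imp_le)
qed

text \<open>The gap in the supporting line inequality dominates \<open>\<bar>b\<bar>\<^sup>p\<close> up to an arbitrarily small
  constant: for large \<open>b\<close> both grow at the same rate, on a compact annulus around \<open>0\<close> the gap has a
  positive minimum, and near \<open>0\<close> the constant \<open>d\<close> takes over.\<close>

lemma uniform_convexity_unit:
  fixes p d :: real
  assumes p: "1 < p" and d: "0 < d"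
  shows "\<exists>C\<ge>1. \<forall>b::complex. norm b powr p \<le> d + C * (norm (1 + b) powr p - 1 - p * Re b)"
proof -
  define R where "R = (\<lambda>b::complex. norm (1 + b) powr p - 1 - p * Re b)"
  have R0: "0 \<le> R b" for b using norm_powr_tangent(1)[OF p, of b] by (simp add: R_def)
  have "eventually (\<lambda>x::real. x powr p / 2 \<le> (x - 1) powr p - 1 - p * x) at_top"
    using p by real_asymp
  then obtain K0 where K0: "\<And>x. x \<ge> K0 \<Longrightarrow> x powr p / 2 \<le> (x - 1) powr p - 1 - p * x"
    by (auto simp: eventually_at_top_linorder)
  define K where "K = max K0 1"
  have large: "norm b powr p \<le> 2 * R b" if "norm b \<ge> K" for b
  proof -
    have "norm b powr p / 2 \<le> (norm b - 1) powr p - 1 - p * norm b"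
      using that by (intro K0) (auto simp: K_def)
    moreover have "(norm b - 1) powr p \<le> norm (1 + b) powr p"
      using that norm_triangle_ineq2[of b "-1"] p
      by (intro powr_mono2) (auto simp: K_def add.commute)
    moreover have "p * Re b \<le> p * norm b"
      using p by (intro mult_left_mono complex_Re_le_cmod) auto
    ultimately have "norm b powr p / 2 \<le> R b" unfolding R_def by linarith
    then show ?thesis by simp
  qed
  define e where "e = d powr (1 / p)"
  have e: "0 < e" "e powr p = d" using d p by (auto simp: e_def powr_powr)
  define A where "A = cball (0::complex) K - ball 0 e"
  have cA: "compact A" unfolding A_def by (intro compact_diff) auto
  have Rc: "continuous_on A R"
    unfolding R_def using p
    by (intro continuous_intros continuous_on_powr') auto
  have "\<exists>m>0. \<forall>b\<in>A. m \<le> R b"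
  proof (cases "A = {}")
    case False
    then obtain b0 where b0: "b0 \<in> A" "\<And>b. b \<in> A \<Longrightarrow> R b0 \<le> R b"
      using continuous_attains_inf[OF cA False Rc] by blast
    have "b0 \<noteq> 0" using b0(1) e by (auto simp: A_def)
    then have "R b0 > 0" using norm_powr_tangent(2)[OF p, of b0] by (simp add: R_def)
    with b0 show ?thesis by blast
  qed (auto intro: exI[of _ 1])
  then obtain m where m: "m > 0" "\<And>b. b \<in> A \<Longrightarrow> m \<le> R b" by blast
  define C where "C = 2 + K powr p / m"
  have C: "C \<ge> 2" using m(1) by (simp add: C_def)
  have "norm b powr p \<le> d + C * R b" for b
  proof -
    consider "norm b < e" | "norm b \<ge> K" | "b \<in> A" by (force simp: A_def)
    then show ?thesis
    proof cases
      case 1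
      then have "norm b powr p \<le> e powr p" using p by (intro powr_mono2) auto
      moreover have "0 \<le> C * R b" using C R0[of b] by simp
      ultimately show ?thesis using e by simp
    next
      case 2
      have "2 * R b \<le> C * R b" using C R0[of b] by (intro mult_right_mono) auto
      with large[OF 2] d show ?thesis by simp
    next
      case 3
      then have "norm b powr p \<le> K powr p" using p by (intro powr_mono2) (auto simp: A_def)
      also have "\<dots> = K powr p / m * m" using m(1) by simp
      also have "\<dots> \<le> K powr p / m * R b" using m 3 by (intro mult_left_mono) auto
      also have "\<dots> \<le> C * R b" using R0[of b] by (intro mult_right_mono) (auto simp: C_def)
      finally show ?thesis using d by simp
    qed
  qed
  then show ?thesis unfolding R_def using C by (intro exI[of _ C]) auto
qed

text \<open>If \<open>k * a = \<bar>a\<bar>\<^sup>p\<close>, then \<open>p * Re (b * k)\<close> is the derivative of \<open>\<bar>_\<bar>\<^sup>p\<close> at \<open>a\<close> in direction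
  \<open>b\<close>, so the left-hand side is the gap between \<open>\<bar>_\<bar>\<^sup>p\<close> and its tangent at \<open>a\<close>; homogeneity reduces it to the tangent at \<open>1\<close>.\<close>

lemma supporting_line_gap_scale:
  fixes a b k :: complex
  assumes k: "k * a = of_real (norm a powr p)" and a: "a \<noteq> 0"
  shows "norm (a + b) powr p - norm a powr p - p * Re (b * k)
    = norm a powr p * (norm (1 + b / a) powr p - 1 - p * Re (b / a))"
proof -
  define N where "N = norm a powr p"
  have "b * k = (k * a) * (b / a)" using a by simp
  then have "b * k = of_real N * (b / a)" unfolding k N_def .
  then have re: "Re (b * k) = N * Re (b / a)"
    by (metis Re_complex_of_real Im_complex_of_real times_complex.simps(1) mult_zero_left diff_zero)
  have "a + b = a * (1 + b / a)" using a by (simp add: field_simps)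
  then have "norm (a + b) powr p = N * norm (1 + b / a) powr p"
    by (simp add: N_def norm_mult powr_mult)
  then show ?thesis unfolding re N_def[symmetric] by (simp add: algebra_simps)
qed

lemma powr_supporting_line:
  fixes a b k :: complex
  assumes p: "1 < p" and k: "k * a = of_real (norm a powr p)" and k0: "a = 0 \<Longrightarrow> k = 0"
  shows "0 \<le> norm (a + b) powr p - norm a powr p - p * Re (b * k)"
proof (cases "a = 0")
  case False
  have "0 \<le> norm (1 + b / a) powr p - 1 - p * Re (b / a)"
    using norm_powr_tangent(1)[OF p, of "b / a"] by simp
  then show ?thesis unfolding supporting_line_gap_scale[OF k False] by simp
qed (use k0 in simp)

lemma uniform_convexity:
  fixes p d :: real
  assumes p: "1 < p" and d: "0 < d"
  obtains C where "C \<ge> 1"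
    "\<And>a b k::complex. k * a = of_real (norm a powr p) \<Longrightarrow> (a = 0 \<Longrightarrow> k = 0) \<Longrightarrow>
       norm b powr p \<le> d * norm a powr p + C * (norm (a + b) powr p - norm a powr p - p * Re (b * k))"
proof -
  obtain C where C: "C \<ge> 1"
    "\<And>b::complex. norm b powr p \<le> d + C * (norm (1 + b) powr p - 1 - p * Re b)"
    using uniform_convexity_unit[OF p d] by blast
  show ?thesis
  proof (rule that[OF C(1)])
    fix a b k :: complex
    assume k: "k * a = of_real (norm a powr p)" and k0: "a = 0 \<Longrightarrow> k = 0"
    show "norm b powr p \<le> d * norm a powr p + C * (norm (a + b) powr p - norm a powr p - p * Re (b * k))"
    proof (cases "a = 0")
      case True
      then have "norm b powr p \<le> C * norm b powr p" using C(1) mult_right_mono[of 1 C "norm b powr p"] by simp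
      then show ?thesis using True k0 by simp
    next
      case False
      have "norm b powr p = norm a powr p * norm (b / a) powr p"
        using False by (simp add: norm_divide powr_divide)
      also have "\<dots> \<le> norm a powr p * (d + C * (norm (1 + b / a) powr p - 1 - p * Re (b / a)))"
        by (intro mult_left_mono C(2)) simp
      also have "\<dots> = d * norm a powr p + C * (norm (a + b) powr p - norm a powr p - p * Re (b * k))"
        unfolding supporting_line_gap_scale[OF k False] by (simp add: algebra_simps)
      finally show ?thesis .
    qed
  qed
qed

text \<open>A substitute for Jensen's inequality: after integration over a probability measure, small
  \<open>p\<close>-th means force small means.\<close>

lemma le_powr_plus:
  fixes p e :: real
  assumes p: "1 < p" and e: "0 < e"
  obtains C where "C \<ge> 0" "\<And>x. x \<ge> 0 \<Longrightarrow> x \<le> e + C * x powr p"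
proof (rule that[of "e powr (1 - p)"])
  fix x :: real assume x: "x \<ge> 0"
  show "x \<le> e + e powr (1 - p) * x powr p"
  proof (cases "x \<le> e")
    case False
    have "x = x powr (1 - p) * x powr p" using False e by (simp flip: powr_add)
    also have "\<dots> \<le> e powr (1 - p) * x powr p"
      using False p e by (intro mult_right_mono powr_mono2') auto
    finally show ?thesis using e by simp
  next
    case True
    then show ?thesis using p e x by (simp add: add_increasing2)
  qed
qed simp

text \<open>A substitute for Hoelder's inequality with one factor in \<open>[0, 1]\<close>: above a threshold for
  \<open>x\<close> the power wins, below it the term \<open>C * s\<close> does.\<close>

lemma mult_le_powr_plus:
  fixes p e :: real
  assumes p: "1 < p" and e: "0 < e"
  obtains C where "C \<ge> 0" "\<And>x s. x \<ge> 0 \<Longrightarrow> 0 \<le> s \<Longrightarrow> s \<le> 1 \<Longrightarrow> x * s \<le> e * x powr p + C * s"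
proof -
  define C where "C = (1 / e) powr (1 / (p - 1))"
  show ?thesis
  proof (rule that[of C])
    show "C \<ge> 0" by (simp add: C_def)
    fix x s :: real assume x: "x \<ge> 0" and s: "0 \<le> s" "s \<le> 1"
    show "x * s \<le> e * x powr p + C * s"
    proof (cases "x \<le> C")
      case True
      then have "x * s \<le> C * s" using s by (intro mult_right_mono) auto
      moreover have "0 \<le> e * x powr p" using e by simp
      ultimately show ?thesis by linarith
    next
      case False
      have C0: "C > 0" using e by (simp add: C_def)
      have "1 / e = C powr (p - 1)" using e p by (simp add: C_def powr_powr)
      also have "\<dots> \<le> x powr (p - 1)" using False C0 p by (intro powr_mono2) auto
      finally have "1 \<le> e * x powr (p - 1)" using e by (simp add: field_simps)
      then have "x * 1 \<le> x * (e * x powr (p - 1))" using x by (intro mult_left_mono)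
      also have "\<dots> = e * x powr p" using False C0 x
        by (simp add: powr_diff)
      finally have "x \<le> e * x powr p" by simp
      moreover have "x * s \<le> x * 1" using s x by (intro mult_left_mono)
      moreover have "0 \<le> C * s" using C0 s by simp
      ultimately show ?thesis by linarith
    qed
  qed
qed

section \<open>Inner functions\<close>

text \<open>One fixed sequence of radii increasing to \<open>1\<close>; limits at the boundary are taken along it so that
  the dominated convergence theorem for sequences applies.\<close>

definition radius :: "nat \<Rightarrow> real" where "radius n = 1 - 1 / (real n + 2)"

lemma radius_bounds: "0 < radius n" "radius n < 1"
  by (simp_all add: radius_def field_simps)

lemma radius_tendsto: "radius \<longlonglongrightarrow> 1"
  unfolding radius_def by real_asymp

lemma radius_at_left: "filterlim radius (at_left 1) sequentially"
  unfolding filterlim_at using radius_tendsto radius_bounds by (auto simp: less_imp_neq)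

lemma has_boundary_value_radius:
  "has_boundary_value f t w \<Longrightarrow> (\<lambda>n. f (of_real (radius n) * cis t)) \<longlonglongrightarrow> w"
  unfolding has_boundary_value_def using filterlim_compose[OF _ radius_at_left] by blast

lemma circle_in_ball: "0 \<le> r \<Longrightarrow> r < 1 \<Longrightarrow> of_real r * cis t \<in> ball 0 1"
  by (simp add: norm_mult)

lemma circle_continuous:
  assumes "continuous_on (ball 0 1) f" "0 \<le> r" "r < 1"
  shows "continuous_on UNIV (\<lambda>t. f (of_real r * cis t))"
  by (rule continuous_on_circle) (use assms in \<open>auto intro: continuous_on_subset\<close>)

lemma circle_mean_eq:
  assumes f: "continuous_on (ball 0 1) f" and r: "0 \<le> r" "r < 1"
  shows "circle_mean p f r = (LINT t|circ. norm (f (of_real r * cis t)) powr p)"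
proof -
  have "(\<lambda>t. norm (f (of_real r * cis t)) powr p) \<in> borel_measurable borel"
    using borel_measurable_continuous_onI[OF circle_continuous[OF f r]] by measurable
  from integral_circ[OF this] show ?thesis by (simp add: circle_mean_def)
qed

lemma mean_value_disk:
  assumes "f holomorphic_on ball 0 1" "0 < r" "r < 1"
  shows "(LINT t|circ. f (of_real r * cis t)) = f 0"
  by (rule mean_value) (use assms in \<open>auto intro: holomorphic_on_subset\<close>)

lemma inner_mean_power:
  assumes "inner_function J"
  shows "(\<lambda>n. LINT t|circ. norm (J (of_real (radius n) * cis t)) ^ k) \<longlonglongrightarrow> 1"
proof -
  have J: "J holomorphic_on ball 0 1" using assms by (simp add: inner_function_def)
  obtain B where B: "\<And>z. z \<in> ball 0 1 \<Longrightarrow> norm (J z) \<le> B"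
    using assms unfolding inner_function_def bounded_iff by blast
  have cJ: "continuous_on UNIV (\<lambda>t. J (of_real (radius n) * cis t))" for n
    using J radius_bounds[of n] by (intro circle_continuous holomorphic_on_imp_continuous_on) auto
  have "(\<lambda>n. LINT t|circ. norm (J (of_real (radius n) * cis t)) ^ k) \<longlonglongrightarrow> (LINT t|circ. 1)"
  proof (rule integral_dominated_convergence[where w="\<lambda>_. B ^ k"])
    show "AE t in circ. (\<lambda>n. norm (J (of_real (radius n) * cis t)) ^ k) \<longlonglongrightarrow> 1"
      unfolding AE_circ using conjunct2[OF conjunct2[OF assms[unfolded inner_function_def]]]
    proof eventually_elim
      case (elim t)
      show ?case
      proof
        assume "t \<in> {0..2*pi}"
        then obtain w where w: "has_boundary_value J t w" "norm w = 1" using elim by blast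
        show "(\<lambda>n. norm (J (of_real (radius n) * cis t)) ^ k) \<longlonglongrightarrow> 1"
          using tendsto_power[OF tendsto_norm[OF has_boundary_value_radius[OF w(1)]], of k] w(2) by simp
      qed
    qed
    show "AE t in circ. norm (norm (J (of_real (radius n) * cis t)) ^ k) \<le> B ^ k" for n
      using B circle_in_ball radius_bounds[of n]
      by (auto simp: power_mono less_imp_le)
    show "(\<lambda>t. norm (J (of_real (radius n) * cis t)) ^ k) \<in> borel_measurable circ" for n
      using borel_measurable_continuous_onI[OF cJ[of n]] by measurable
  qed auto
  then show ?thesis by simp
qed

text \<open>Cauchy's formula for \<open>J ^ k\<close> bounds \<open>\<bar>J z\<bar> ^ k\<close> by \<open>1 / (1 - \<bar>z\<bar>)\<close>, because the boundary
  modulus of \<open>J ^ k\<close> is \<open>1\<close>. The bound is the same for all \<open>k\<close>, so \<open>\<bar>J z\<bar>\<close> cannot exceed \<open>1\<close>.\<close>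

lemma inner_norm_le_1:
  assumes "inner_function J" and z: "z \<in> ball 0 1"
  shows "norm (J z) \<le> 1"
proof -
  have J: "J holomorphic_on ball 0 1" using assms by (simp add: inner_function_def)
  have z1: "norm z < 1" using z by simp
  have bound: "norm (J z) ^ k \<le> 1 / (1 - norm z)" for k
  proof (rule LIMSEQ_le_const)
    let ?m = "\<lambda>n. LINT t|circ. norm (J (of_real (radius n) * cis t)) ^ k"
    show "(\<lambda>n. ?m n * (radius n / (radius n - norm z))) \<longlonglongrightarrow> 1 / (1 - norm z)"
      using z1 by (auto intro!: tendsto_eq_intros inner_mean_power assms radius_tendsto)
    have "eventually (\<lambda>n. norm z < radius n) sequentially"
      by (rule order_tendstoD(1)[OF radius_tendsto z1])
    then obtain N where N: "\<And>n. n \<ge> N \<Longrightarrow> norm z < radius n" by (auto simp: eventually_sequentially)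
    show "\<exists>N. \<forall>n\<ge>N. norm (J z) ^ k \<le> ?m n * (radius n / (radius n - norm z))"
    proof (intro exI[of _ N] allI impI)
      fix n assume "n \<ge> N"
      then have r: "norm z < radius n" "0 < radius n" "radius n < 1" using N radius_bounds by auto
      define r where "r = radius n"
      note r = r[folded r_def]
      have hol: "(\<lambda>x. J x ^ k) holomorphic_on cball 0 r"
        using r by (intro holomorphic_intros holomorphic_on_subset[OF J]) auto
      have cJ: "continuous_on UNIV (\<lambda>t. J (of_real r * cis t))"
        using J r by (intro circle_continuous holomorphic_on_imp_continuous_on) auto
      have "norm (J z ^ k) = norm (LINT t|circ. J (of_real r * cis t) ^ k * (of_real r * cis t) / (of_real r * cis t - z))"
        using cauchy_mean[OF hol r(2,1)] by simp
      also have "\<dots> \<le> (LINT t|circ. norm (J (of_real r * cis t)) ^ k * (r / (r - norm z)))"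
      proof (rule Bochner_Integration.integral_norm_bound_integral)
        have nz: "r - norm z \<le> norm (of_real r * cis t - z)" for t
          using norm_triangle_ineq2[of "of_real r * cis t" z] r by (simp add: norm_mult)
        then have nz': "of_real r * cis t - z \<noteq> 0" for t
          using r by (metis diff_gt_0_iff_gt norm_zero not_le)
        show "integrable circ (\<lambda>t. J (of_real r * cis t) ^ k * (of_real r * cis t) / (of_real r * cis t - z))"
          by (intro integrable_circ_continuous continuous_intros cJ) (use nz' in auto)
        show "integrable circ (\<lambda>t. norm (J (of_real r * cis t)) ^ k * (r / (r - norm z)))"
          by (intro integrable_circ_continuous continuous_intros cJ)
        fix t
        show "norm (J (of_real r * cis t) ^ k * (of_real r * cis t) / (of_real r * cis t - z))
            \<le> norm (J (of_real r * cis t)) ^ k * (r / (r - norm z))"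
        proof -
          have "r / norm (of_real r * cis t - z) \<le> r / (r - norm z)"
            using nz[of t] r by (intro divide_left_mono mult_pos_pos) auto
          then have "norm (J (of_real r * cis t)) ^ k * (r / norm (of_real r * cis t - z))
              \<le> norm (J (of_real r * cis t)) ^ k * (r / (r - norm z))"
            by (intro mult_left_mono) auto
          then show ?thesis using r by (simp add: norm_mult norm_divide norm_power)
        qed
      qed
      also have "\<dots> = ?m n * (radius n / (radius n - norm z))"
        unfolding r_def by (simp only: integral_mult_left_zero)
      finally show "norm (J z) ^ k \<le> ?m n * (radius n / (radius n - norm z))"
        by (simp add: norm_power)
    qed
  qed
  show ?thesis
  proof (rule ccontr)
    assume "\<not> norm (J z) \<le> 1"
    then obtain k where "1 / (1 - norm z) < norm (J z) ^ k"
      using real_arch_pow[of "norm (J z)"] by auto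
    with bound[of k] show False by simp
  qed
qed

lemma inner_constant:
  assumes "inner_function J" "norm (J 0) = 1" "z \<in> ball 0 1"
  shows "J z = J 0"
proof -
  have J: "J holomorphic_on ball 0 1" using assms by (simp add: inner_function_def)
  have "J constant_on ball 0 1"
    by (rule maximum_modulus_principle[OF J, of "ball 0 1" 0])
       (use inner_norm_le_1[OF assms(1)] assms(2) in auto)
  then show ?thesis using assms(3) unfolding constant_on_def by force
qed

section \<open>Poisson means of exponentials\<close>

interpretation circ2: pair_sigma_finite circ circ
  by (intro pair_sigma_finite.intro circ.sigma_finite_measure_axioms)

lemma cis_measurable [measurable]: "cis \<in> borel_measurable borel"
  by (rule borel_measurable_continuous_onI) (intro continuous_intros)

lemma poisson_kernel_nonneg:
  assumes "norm z < 1"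
  shows "0 \<le> Re ((cis t + z) / (cis t - z))"
proof -
  have "Re ((cis t + z) / (cis t - z)) = Re ((cis t + z) * cnj (cis t - z)) / (norm (cis t - z))\<^sup>2"
    by (simp only: complex_div_cnj[of "cis t + z"] Re_divide_of_real)
  also have "Re ((cis t + z) * cnj (cis t - z)) = (norm (cis t))\<^sup>2 - (norm z)\<^sup>2"
    unfolding cmod_power2 by (simp add: algebra_simps power2_eq_square)
  also have "\<dots> \<ge> 0" using assms by (simp add: abs_square_le_1 power_le_one)
  then have "((norm (cis t))\<^sup>2 - (norm z)\<^sup>2) / (norm (cis t - z))\<^sup>2 \<ge> 0" by simp
  finally show ?thesis .
qed

lemma herglotz_one: "norm z < 1 \<Longrightarrow> herglotz (\<lambda>_. 1) z = 1"
  using schwarz_formula[of "\<lambda>_. 1" 1 z] by simp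

lemma Re_herglotz:
  assumes "norm z < 1" "integrable circ u"
  shows "Re (herglotz u z) = (LINT t|circ. Re ((cis t + z) / (cis t - z)) * u t)"
    and "integrable circ (\<lambda>t. Re ((cis t + z) / (cis t - z)) * u t)"
proof -
  have *: "Re ((cis t + z) / (cis t - z) * complex_of_real (u t)) = Re ((cis t + z) / (cis t - z)) * u t" for t
    by (simp only: times_complex.simps complex.sel Re_complex_of_real Im_complex_of_real mult_zero_right diff_zero)
  note i = herglotz_integrable[OF assms]
  show "Re (herglotz u z) = (LINT t|circ. Re ((cis t + z) / (cis t - z)) * u t)"
    unfolding herglotz_def using integral_Re[OF i] by (simp only: *)
  show "integrable circ (\<lambda>t. Re ((cis t + z) / (cis t - z)) * u t)"
    using integrable_Re[OF i] by (simp only: *)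
qed

lemma poisson_mean_circle:
  assumes r: "0 < r" "r < 1"
  shows "(LINT s|circ. Re ((cis t + of_real r * cis s) / (cis t - of_real r * cis s))) = 1"
    and "integrable circ (\<lambda>s. Re ((cis t + of_real r * cis s) / (cis t - of_real r * cis s)))"
proof -
  define f where "f = (\<lambda>x. (cis t + x) / (cis t - x))"
  have nz: "cis t - x \<noteq> 0" if "norm x \<le> r" for x
    using that r by (intro cis_minus_nonzero) auto
  have hol: "f holomorphic_on cball 0 r"
    unfolding f_def using nz by (intro holomorphic_intros) auto
  have i: "integrable circ (\<lambda>s. f (of_real r * cis s))"
    using r by (intro integrable_circ_continuous continuous_on_circle holomorphic_on_imp_continuous_on hol) auto
  show "(LINT s|circ. Re ((cis t + of_real r * cis s) / (cis t - of_real r * cis s))) = 1"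
    using mean_value[OF hol r(1)] integral_Re[OF i] by (simp add: f_def)
  show "integrable circ (\<lambda>s. Re ((cis t + of_real r * cis s) / (cis t - of_real r * cis s)))"
    using integrable_Re[OF i] by (simp add: f_def)
qed

text \<open>Jensen's inequality for the Poisson kernel as a probability density: integrate the tangent line
  inequality of \<open>exp\<close> at the mean.\<close>

lemma exp_Re_herglotz_le:
  assumes z: "norm z < 1" and u: "integrable circ u" and e: "integrable circ (\<lambda>t. exp (p * u t))"
  shows "exp (p * Re (herglotz u z)) \<le> (LINT t|circ. Re ((cis t + z) / (cis t - z)) * exp (p * u t))"
proof -
  define P where "P = (\<lambda>t. Re ((cis t + z) / (cis t - z)))"
  define m where "m = Re (herglotz u z)"
  have P0: "P t \<ge> 0" for t unfolding P_def by (rule poisson_kernel_nonneg[OF z])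
  have P1: "(LINT t|circ. P t) = 1" "integrable circ P"
    using Re_herglotz[OF z, of "\<lambda>_. 1"] herglotz_one[OF z] by (simp_all add: P_def)
  have Pu: "(LINT t|circ. P t * u t) = m" "integrable circ (\<lambda>t. P t * u t)"
    using Re_herglotz[OF z u] by (simp_all add: P_def m_def)
  have Pe: "integrable circ (\<lambda>t. P t * exp (p * u t))"
    unfolding P_def by (rule Re_herglotz(2)[OF z e])
  have "(LINT t|circ. exp (p * m) * ((1 - p * m) * P t + p * (P t * u t)))
      = exp (p * m) * ((1 - p * m) * (LINT t|circ. P t) + p * (LINT t|circ. P t * u t))"
    using P1(2) Pu(2) by simp
  then have "exp (p * m) = (LINT t|circ. exp (p * m) * ((1 - p * m) * P t + p * (P t * u t)))"
    unfolding P1(1) Pu(1) by simp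
  also have "\<dots> \<le> (LINT t|circ. P t * exp (p * u t))"
  proof (rule integral_mono[OF _ Pe])
    show "integrable circ (\<lambda>t. exp (p * m) * ((1 - p * m) * P t + p * (P t * u t)))"
      using P1 Pu by simp
    fix t
    have "1 + (p * u t - p * m) \<le> exp (p * u t - p * m)" by (rule exp_ge_add_one_self)
    then have "exp (p * m) * (1 + (p * u t - p * m)) \<le> exp (p * m) * exp (p * u t - p * m)"
      by (intro mult_left_mono) auto
    also have "\<dots> = exp (p * u t)" by (simp flip: exp_add)
    finally have "P t * (exp (p * m) * (1 + (p * u t - p * m))) \<le> P t * exp (p * u t)"
      by (intro mult_left_mono P0)
    then show "exp (p * m) * ((1 - p * m) * P t + p * (P t * u t)) \<le> P t * exp (p * u t)"
      by (simp add: algebra_simps)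
  qed
  finally show ?thesis by (simp add: m_def P_def)
qed

text \<open>Integrate the pointwise bound over the circle of radius \<open>r\<close> and interchange the integrals: for
  fixed \<open>t\<close> the Poisson kernel is harmonic in \<open>z\<close>, so its mean over that circle is its value
  \<open>1\<close> at the origin.\<close>

lemma mean_exp_herglotz_le:
  assumes r: "0 < r" "r < 1" and u: "integrable circ u" and e: "integrable circ (\<lambda>t. exp (p * u t))"
    and c: "continuous_on (ball 0 1) (herglotz u)"
  shows "(LINT s|circ. norm (exp (herglotz u (of_real r * cis s))) powr p) \<le> (LINT t|circ. exp (p * u t))"
proof -
  define P where "P = (\<lambda>t s. Re ((cis t + of_real r * cis s) / (cis t - of_real r * cis s)))"
  define E where "E = (\<lambda>t. exp (p * u t))"
  have z: "norm (of_real r * cis s) < 1" for s using r by (simp add: norm_mult)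
  have [measurable]: "E \<in> borel_measurable circ" using e unfolding E_def by auto
  have prod: "integrable (circ \<Otimes>\<^sub>M circ) (case_prod (\<lambda>t s. P t s * E t))"
  proof (rule circ2.Fubini_integrable)
    show "case_prod (\<lambda>t s. P t s * E t) \<in> borel_measurable (circ \<Otimes>\<^sub>M circ)"
      unfolding P_def by measurable
    have "(LINT s|circ. norm (P t s * E t)) = E t" for t
    proof -
      have "(LINT s|circ. norm (P t s * E t)) = (LINT s|circ. P t s * E t)"
        using poisson_kernel_nonneg[OF z] by (simp add: P_def E_def abs_mult)
      also have "\<dots> = E t" using poisson_mean_circle[OF r, of t] by (simp add: P_def)
      finally show ?thesis .
    qed
    then show "integrable circ (\<lambda>x. LINT y|circ. norm (case (x, y) of (t, s) \<Rightarrow> P t s * E t))"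
      using e by (simp add: E_def)
    show "AE x in circ. integrable circ (\<lambda>y. case (x, y) of (t, s) \<Rightarrow> P t s * E t)"
      using poisson_mean_circle(2)[OF r] by (simp add: P_def)
  qed
  have "(LINT s|circ. norm (exp (herglotz u (of_real r * cis s))) powr p) \<le> (LINT s|circ. LINT t|circ. P t s * E t)"
  proof (rule integral_mono)
    have "continuous_on UNIV (\<lambda>s. herglotz u (of_real r * cis s))"
      using r by (intro continuous_on_circle continuous_on_subset[OF c]) auto
    then show "integrable circ (\<lambda>s. norm (exp (herglotz u (of_real r * cis s))) powr p)"
      by (intro integrable_circ_continuous continuous_intros) auto
    show "integrable circ (\<lambda>s. LINT t|circ. P t s * E t)"
      using circ2.integrable_snd[OF prod] by simp
    fix s
    show "norm (exp (herglotz u (of_real r * cis s))) powr p \<le> (LINT t|circ. P t s * E t)"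
      using exp_Re_herglotz_le[OF z u e, of s] by (simp add: P_def E_def norm_exp_eq_Re powr_def mult.commute)
  qed
  also have "\<dots> = (LINT t|circ. LINT s|circ. P t s * E t)"
    by (rule circ2.Fubini_integral[OF prod])
  also have "\<dots> = (LINT t|circ. E t)"
    using poisson_mean_circle[OF r] by (simp add: P_def)
  finally show ?thesis by (simp add: E_def)
qed

section \<open>Approximation on the circle by real parts of entire functions\<close>

lemma Re_cnj_mult: "Re (a * cnj b) = Re (cnj a * b)"
  by simp

text \<open>On the unit circle \<open>cnj z = 1 / z\<close>, so a real polynomial in \<open>Re z\<close> and \<open>Im z\<close> is a Laurent
  polynomial there.\<close>

lemma polynomial_on_circle_laurent:
  fixes g :: "complex \<Rightarrow> real"
  assumes "real_polynomial_function g"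
  shows "\<exists>n P. \<forall>z. norm z = 1 \<longrightarrow> z ^ n * of_real (g z) = poly P z"
  using assms
proof (induction rule: real_polynomial_function.induct)
  case (linear g)
  have "g z = g (of_real (Re z) + of_real (Im z) * \<i>)" for z by (metis complex_eq mult.commute)
  also have "\<dots>z = Re z * g 1 + Im z * g \<i>" for z
  proof -
    have "g (of_real (Re z) + of_real (Im z) * \<i>) = g (Re z *\<^sub>R 1 + Im z *\<^sub>R \<i>)" by (simp add: scaleR_conv_of_real)
    also have "\<dots> = Re z * g 1 + Im z * g \<i>"
      using linear by (simp add: linear_add linear_scale bounded_linear.linear)
    finally show ?thesis .
  qed
  finally have g: "g z = Re z * g 1 + Im z * g \<i>" for z .
  define a where "a = complex_of_real (g 1)"
  define b where "b = complex_of_real (g \<i>)"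
  show ?case
  proof (intro exI allI impI)
    fix z :: complex assume "norm z = 1"
    then have zz: "z * cnj z = 1" by (simp add: complex_norm_square[symmetric])
    have re: "2 * complex_of_real (Re z) = z + cnj z" by (simp add: complex_add_cnj)
    have im: "2 * complex_of_real (Im z) = - \<i> * (z - cnj z)" by (simp add: complex_diff_cnj)
    have "2 * (z ^ 1 * of_real (g z)) = z * (2 * of_real (Re z)) * a + z * (2 * of_real (Im z)) * b"
      by (simp add: g[of z] a_def b_def algebra_simps)
    also have "\<dots> = (z * z + z * cnj z) * a - \<i> * (z * z - z * cnj z) * b"
      unfolding re im by (simp add: algebra_simps)
    also have "\<dots> = 2 * poly [: (a + \<i> * b) / 2, 0, (a - \<i> * b) / 2 :] z"
      unfolding zz by (simp add: algebra_simps add_divide_distrib diff_divide_distrib)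
    finally show "z ^ 1 * of_real (g z) = poly [: (a + \<i> * b) / 2, 0, (a - \<i> * b) / 2 :] z"
      by (simp only: mult_cancel_left) simp
  qed
next
  case (const c)
  show ?case by (intro exI[of _ 0] exI[of _ "[:complex_of_real c:]"]) simp
next
  case (add f g)
  then obtain n P m Q where *: "\<forall>z. norm z = 1 \<longrightarrow> z ^ n * of_real (f z) = poly P z"
    "\<forall>z. norm z = 1 \<longrightarrow> z ^ m * of_real (g z) = poly Q z" by blast
  have "\<forall>z. norm z = 1 \<longrightarrow> z ^ (n + m) * of_real (f z + g z) = poly (monom 1 m * P + monom 1 n * Q) z"
    by (simp add: poly_monom power_add algebra_simps flip: *[rule_format])
  then show ?case by blast
next
  case (mult f g)
  then obtain n P m Q where *: "\<forall>z. norm z = 1 \<longrightarrow> z ^ n * of_real (f z) = poly P z"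
    "\<forall>z. norm z = 1 \<longrightarrow> z ^ m * of_real (g z) = poly Q z" by blast
  have "\<forall>z. norm z = 1 \<longrightarrow> z ^ (n + m) * of_real (f z * g z) = poly (P * Q) z"
    by (simp add: power_add algebra_simps flip: *[rule_format])
  then show ?case by blast
qed

text \<open>Stone-Weierstrass gives a Laurent polynomial that is real on the circle. Its terms with negative
  exponents may be reflected, because \<open>a * z powi (- m)\<close> and \<open>cnj a * z ^ m\<close> have the same real part
  there.\<close>

lemma circle_approx_Re_entire:
  fixes g :: "complex \<Rightarrow> real"
  assumes g: "continuous_on (sphere 0 1) g" and e: "0 < e"
  shows "\<exists>Q. Q holomorphic_on UNIV \<and> (\<forall>z\<in>sphere 0 1. \<bar>g z - Re (Q z)\<bar> < e)"
proof -
  obtain q where q: "real_polynomial_function q" "\<And>z. z \<in> sphere 0 1 \<Longrightarrow> \<bar>g z - q z\<bar> < e"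
    using Stone_Weierstrass_real_polynomial_function[OF _ g e] by auto
  obtain n P where P: "\<And>z. norm z = 1 \<Longrightarrow> z ^ n * of_real (q z) = poly P z"
    using polynomial_on_circle_laurent[OF q(1)] by blast
  define Q where "Q = (\<lambda>z. \<Sum>j\<le>degree P. if j < n then cnj (coeff P j) * z ^ (n - j) else coeff P j * z ^ (j - n))"
  have "Re (Q z) = q z" if z: "norm z = 1" for z
  proof -
    have zz: "cnj z * z = 1" using z by (simp add: complex_norm_square[symmetric] mult.commute)
    have zn: "cnj z ^ k * z ^ k = 1" for k by (simp add: zz flip: power_mult_distrib)
    have "complex_of_real (q z) = cnj z ^ n * (z ^ n * of_real (q z))"
      using zn[of n] by (simp flip: mult.assoc)
    also have "\<dots> = (\<Sum>j\<le>degree P. coeff P j * (cnj z ^ n * z ^ j))"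
      unfolding P[OF z] by (simp add: poly_altdef sum_distrib_left mult_ac)
    finally have "q z = Re (\<Sum>j\<le>degree P. coeff P j * (cnj z ^ n * z ^ j))"
      by (metis Re_complex_of_real)
    also have "\<dots> = Re (Q z)"
      unfolding Q_def Re_sum
    proof (rule sum.cong[OF refl])
      fix j
      show "Re (coeff P j * (cnj z ^ n * z ^ j)) =
        Re (if j < n then cnj (coeff P j) * z ^ (n - j) else coeff P j * z ^ (j - n))"
      proof (cases "j < n")
        case True
        then have "cnj z ^ n * z ^ j = cnj z ^ (n - j) * (cnj z ^ j * z ^ j)"
          by (simp flip: mult.assoc power_add)
        then have "cnj z ^ n * z ^ j = cnj (z ^ (n - j))" by (simp add: zn)
        then show ?thesis using True Re_cnj_mult[of "coeff P j" "z ^ (n - j)"] by simp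
      next
        case False
        then have "cnj z ^ n * z ^ j = (cnj z ^ n * z ^ n) * z ^ (j - n)"
          by (simp add: mult.assoc flip: power_add)
        then show ?thesis using False by (simp add: zn)
      qed
    qed
    finally show ?thesis by simp
  qed
  moreover have "Q holomorphic_on UNIV"
    unfolding Q_def
  proof (intro holomorphic_on_sum)
    fix j
    show "(\<lambda>z. if j < n then cnj (coeff P j) * z ^ (n - j) else coeff P j * z ^ (j - n)) holomorphic_on UNIV"
      by (cases "j < n") (auto intro!: holomorphic_intros)
  qed
  ultimately show ?thesis using q(2) by (intro exI[of _ Q]) auto
qed

text \<open>A measurable function is an almost everywhere limit of continuous functions of the angle. These
  need not take equal values at the two ends of \<open>{0..2*pi}\<close>; a cutoff near the point \<open>1\<close> of the
  circle makes them continuous there, and it tends to \<open>1\<close> elsewhere.\<close>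

lemma bounded_measurable_ae_limit:
  fixes w :: "real \<Rightarrow> real"
  assumes w: "w \<in> borel_measurable borel" and N: "\<And>t. \<bar>w t\<bar> \<le> N"
  obtains Q where "\<And>n. Q n holomorphic_on UNIV" "\<And>n t. \<bar>Re (Q n (cis t))\<bar> \<le> N + 1"
    "AE t in circ. (\<lambda>n::nat. Re (Q n (cis t))) \<longlonglongrightarrow> w t"
proof -
  have N0: "N \<ge> 0" using N[of 0] by linarith
  have "w \<in> borel_measurable lebesgue" using w by (intro measurable_completion) simp
  then have "w measurable_on UNIV" by (intro lebesgue_measurable_imp_measurable_on) auto
  then obtain Z g where Z: "negligible Z" and g: "\<And>n::nat. continuous_on UNIV (g n)"
    and lim: "\<And>t. t \<notin> Z \<Longrightarrow> (\<lambda>n. g n t) \<longlonglongrightarrow> w t"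
    unfolding measurable_on_def by auto
  define h where "h = (\<lambda>n t. max (-N) (min N (g n t)))"
  have hN: "\<bar>h n t\<bar> \<le> N" for n t using N0 by (auto simp: h_def)
  have hc: "continuous_on UNIV (h n)" for n unfolding h_def by (intro continuous_intros g)
  have hlim: "(\<lambda>n. h n t) \<longlonglongrightarrow> w t" if "t \<notin> Z" for t
  proof -
    have "(\<lambda>n. h n t) \<longlonglongrightarrow> max (-N) (min N (w t))"
      unfolding h_def by (intro tendsto_intros lim that)
    also have "max (-N) (min N (w t)) = w t" using N[of t] by auto
    finally show ?thesis .
  qed
  \<comment> \<open>The second factor vanishes at \<open>z = 1\<close>, where \<open>Arg2pi\<close> jumps.\<close>
  define G where "G = (\<lambda>n z. h n (Arg2pi z) * min 1 (real n * norm (z - 1)))"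
  have GN: "\<bar>G n z\<bar> \<le> N" for n z
  proof -
    have "\<bar>G n z\<bar> = \<bar>h n (Arg2pi z)\<bar> * \<bar>min 1 (real n * norm (z - 1))\<bar>" by (simp add: G_def abs_mult)
    also have "\<dots> \<le> N * 1" by (intro mult_mono hN) (auto simp: N0)
    finally show ?thesis by simp
  qed
  have Gc: "continuous_on (sphere 0 1) (G n)" for n
  proof (rule continuous_at_imp_continuous_on, rule ballI)
    fix z :: complex assume z: "z \<in> sphere 0 1"
    show "isCont (G n) z"
    proof (cases "z = 1")
      case True
      have "(\<lambda>x. N * (real n * norm (x - 1))) \<midarrow>1\<rightarrow> 0" by (auto intro!: tendsto_eq_intros)
      moreover have "\<bar>G n x\<bar> \<le> N * (real n * norm (x - 1))" for x
      proof -
        have "\<bar>G n x\<bar> = \<bar>h n (Arg2pi x)\<bar> * \<bar>min 1 (real n * norm (x - 1))\<bar>" by (simp add: G_def abs_mult)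
        also have "\<dots> \<le> N * (real n * norm (x - 1))" by (intro mult_mono hN) (auto simp: N0)
        finally show ?thesis .
      qed
      ultimately have "G n \<midarrow>1\<rightarrow> 0"
        by (intro Lim_null_comparison[of "G n" "\<lambda>x. N * (real n * norm (x - 1))"]) auto
      then show ?thesis using True by (simp add: isCont_def G_def)
    next
      case False
      have "z \<notin> \<real>\<^sub>\<ge>\<^sub>0"
        using z False by (auto simp: complex_nonneg_Reals_iff complex_eq_iff cmod_def power2_eq_1_iff)
      then have "isCont Arg2pi z" by (rule continuous_at_Arg2pi)
      moreover have "isCont (h n) (Arg2pi z)" using hc[of n] by (simp add: continuous_on_eq_continuous_at)
      ultimately have "isCont (\<lambda>z. h n (Arg2pi z)) z" by (rule isCont_o2)
      then show ?thesis unfolding G_def by (intro continuous_intros) auto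
    qed
  qed
  have "\<exists>Q. Q holomorphic_on UNIV \<and> (\<forall>z\<in>sphere 0 1. \<bar>G n z - Re (Q z)\<bar> < 1 / (real n + 1))" for n
    by (rule circle_approx_Re_entire[OF Gc]) auto
  then obtain Q where Q: "\<And>n. Q n holomorphic_on UNIV"
    "\<And>n z. z \<in> sphere 0 1 \<Longrightarrow> \<bar>G n z - Re (Q n z)\<bar> < 1 / (real n + 1)"
    by metis
  show ?thesis
  proof (rule that[of Q, OF Q(1)])
    fix n t
    have "1 / (real n + 1) \<le> 1" by simp
    moreover have "\<bar>G n (cis t) - Re (Q n (cis t))\<bar> < 1 / (real n + 1)" by (rule Q(2)) simp
    ultimately show "\<bar>Re (Q n (cis t))\<bar> \<le> N + 1"
      using GN[of n "cis t"] by linarith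
  next
    have "AE t in lebesgue. t \<notin> Z"
      using Z by (intro AE_not_in) (simp add: negligible_iff_null_sets)
    then have "AE t in lborel. t \<notin> Z" by (simp add: AE_completion_iff)
    then have "AE t in lborel. t \<notin> Z \<and> t \<noteq> 0 \<and> t \<noteq> 2 * pi"
      using AE_lborel_singleton[of 0] AE_lborel_singleton[of "2 * pi"] by eventually_elim auto
    then show "AE t in circ. (\<lambda>n::nat. Re (Q n (cis t))) \<longlonglongrightarrow> w t"
      unfolding AE_circ
    proof eventually_elim
      case (elim t)
      show ?case
      proof
        assume t: "t \<in> {0..2*pi}"
        with elim have t': "0 < t" "t < 2*pi" by auto
        have arg: "Arg2pi (cis t) = t" using t' by (intro Arg2pi_unique[of 1]) (auto simp: cis_conv_exp)
        have "cis t \<noteq> 1"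
          using arg t' by (metis Arg2pi_of_real of_real_1 less_irrefl not_one_less_zero)
        then have "0 < norm (cis t - 1)" by simp
        then obtain n0 where n0: "1 < real n0 * norm (cis t - 1)"
          using reals_Archimedean3 by blast
        have "eventually (\<lambda>n. G n (cis t) = h n t) sequentially"
        proof (rule eventually_sequentiallyI)
          fix n assume "n0 \<le> n"
          then have "real n0 * norm (cis t - 1) \<le> real n * norm (cis t - 1)"
            by (intro mult_right_mono) auto
          with n0 show "G n (cis t) = h n t" by (simp add: G_def arg)
        qed
        then have "(\<lambda>n. G n (cis t)) \<longlonglongrightarrow> w t"
          using hlim[of t] elim by (simp add: filterlim_cong)
        moreover have "(\<lambda>n. G n (cis t) - Re (Q n (cis t))) \<longlonglongrightarrow> 0"
        proof (rule Lim_null_comparison)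
          show "eventually (\<lambda>n. norm (G n (cis t) - Re (Q n (cis t))) \<le> 1 / (real n + 1)) sequentially"
            using Q(2)[of "cis t"] by (auto simp: less_imp_le)
          show "(\<lambda>n. 1 / (real n + 1)) \<longlonglongrightarrow> 0" by real_asymp
        qed
        ultimately have "(\<lambda>n. G n (cis t) - (G n (cis t) - Re (Q n (cis t)))) \<longlonglongrightarrow> w t - 0"
          by (rule tendsto_diff)
        then show "(\<lambda>n. Re (Q n (cis t))) \<longlonglongrightarrow> w t" by simp
      qed
    qed
  qed
qed

text \<open>For \<open>u = ln \<bar>F\<bar>\<close> with \<open>F\<close> outer this says that \<open>exp Q\<close> almost inverts \<open>F\<close> in modulus.
  First \<open>- u\<close> is truncated at height \<open>n\<close>, which keeps \<open>exp (p * (u + w))\<close> below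
  \<open>1 + exp (p * u)\<close>; then the bounded truncation \<open>w\<close> is replaced by some \<open>Re Q\<close>, at the cost of a
  constant factor in the dominating function.\<close>

lemma exp_mean_approx:
  fixes u :: "real \<Rightarrow> real"
  assumes u: "integrable circ u" and ub: "u \<in> borel_measurable borel"
    and p: "0 < p" and eu: "integrable circ (\<lambda>t. exp (p * u t))" and e: "0 < e"
  shows "\<exists>Q. Q holomorphic_on UNIV \<and> integrable circ (\<lambda>t. exp (p * (u t + Re (Q (cis t))))) \<and>
     (LINT t|circ. exp (p * (u t + Re (Q (cis t))))) < 1 + e \<and>
     (LINT t|circ. \<bar>u t + Re (Q (cis t))\<bar>) < e"
proof -
  define w where "w = (\<lambda>n t. max (- real n) (min (real n) (- u t)))"
  have wm [measurable]: "w n \<in> borel_measurable borel" for n unfolding w_def using ub by measurable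
  note [measurable] = ub
  have wN: "\<bar>w n t\<bar> \<le> real n" for n t by (auto simp: w_def)
  have wlim: "(\<lambda>n. u t + w n t) \<longlonglongrightarrow> 0" for t
  proof (rule tendsto_eventually)
    obtain n0 :: nat where "\<bar>u t\<bar> \<le> n0" using real_arch_simple by blast
    then show "eventually (\<lambda>n. u t + w n t = 0) sequentially"
      by (intro eventually_sequentiallyI[of n0]) (auto simp: w_def)
  qed
  have 1: "(\<lambda>n. LINT t|circ. exp (p * (u t + w n t))) \<longlonglongrightarrow> (LINT t|circ. exp (p * 0))"
  proof (rule integral_dominated_convergence[where w="\<lambda>t. 1 + exp (p * u t)"])
    show "AE t in circ. (\<lambda>n. exp (p * (u t + w n t))) \<longlonglongrightarrow> exp (p * 0)"
      by (intro AE_I2 tendsto_intros wlim)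
    show "AE t in circ. norm (exp (p * (u t + w n t))) \<le> 1 + exp (p * u t)" for n
    proof (rule AE_I2)
      fix t
      have "u t + w n t \<le> max 0 (u t)" by (auto simp: w_def)
      then have "exp (p * (u t + w n t)) \<le> exp (p * max 0 (u t))" using p by simp
      also have "\<dots> \<le> 1 + exp (p * u t)" by (auto simp: max_def)
      finally show "norm (exp (p * (u t + w n t))) \<le> 1 + exp (p * u t)" by simp
    qed
  qed (use eu in auto)
  have 2: "(\<lambda>n. LINT t|circ. \<bar>u t + w n t\<bar>) \<longlonglongrightarrow> (LINT t|circ. \<bar>0\<bar>)"
  proof (rule integral_dominated_convergence[where w="\<lambda>t. \<bar>u t\<bar>"])
    show "AE t in circ. (\<lambda>n. \<bar>u t + w n t\<bar>) \<longlonglongrightarrow> \<bar>0\<bar>"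
      by (intro AE_I2 tendsto_rabs wlim)
    show "AE t in circ. norm \<bar>u t + w n t\<bar> \<le> \<bar>u t\<bar>" for n
      by (rule AE_I2) (auto simp: w_def)
  qed (use u in auto)
  have "eventually (\<lambda>n. (LINT t|circ. exp (p * (u t + w n t))) < 1 + e \<and> (LINT t|circ. \<bar>u t + w n t\<bar>) < e) sequentially"
    using order_tendstoD(2)[OF 1, of "1 + e"] order_tendstoD(2)[OF 2, of e] e
    by (auto intro: eventually_conj)
  then obtain N where N: "(LINT t|circ. exp (p * (u t + w N t))) < 1 + e" "(LINT t|circ. \<bar>u t + w N t\<bar>) < e"
    by (auto simp: eventually_sequentially)
  obtain Q where Q: "\<And>n. Q n holomorphic_on UNIV" "\<And>n t. \<bar>Re (Q n (cis t))\<bar> \<le> real N + 1"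
    "AE t in circ. (\<lambda>n::nat. Re (Q n (cis t))) \<longlonglongrightarrow> w N t"
    using bounded_measurable_ae_limit[OF wm wN, of N] by blast
  have "continuous_on UNIV (\<lambda>t. Q n (cis t))" for n
    using holomorphic_on_imp_continuous_on[OF Q(1)[of n]]
    by (rule continuous_on_compose2) (auto intro!: continuous_intros)
  then have Qm [measurable]: "(\<lambda>t. Q n (cis t)) \<in> borel_measurable borel" for n
    by (rule borel_measurable_continuous_onI)
  have dom: "exp (p * (u t + Re (Q n (cis t)))) \<le> exp (p * (real N + 1)) * exp (p * u t)" for n t
  proof -
    have "p * (u t + Re (Q n (cis t))) \<le> p * (real N + 1) + p * u t"
      using Q(2)[of n t] p by (simp flip: distrib_left)
    then show ?thesis by (simp flip: exp_add)
  qed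
  have int: "integrable circ (\<lambda>t. exp (p * (u t + Re (Q n (cis t)))))" for n
    by (rule Bochner_Integration.integrable_bound[of _ "\<lambda>t. exp (p * (real N + 1)) * exp (p * u t)"])
       (use eu dom in auto)
  have 3: "(\<lambda>n. LINT t|circ. exp (p * (u t + Re (Q n (cis t))))) \<longlonglongrightarrow> (LINT t|circ. exp (p * (u t + w N t)))"
  proof (rule integral_dominated_convergence[where w="\<lambda>t. exp (p * (real N + 1)) * exp (p * u t)"])
    show "AE t in circ. (\<lambda>n. exp (p * (u t + Re (Q n (cis t))))) \<longlonglongrightarrow> exp (p * (u t + w N t))"
      using Q(3) by eventually_elim (intro tendsto_intros)
  qed (use eu dom in auto)
  have 4: "(\<lambda>n. LINT t|circ. \<bar>u t + Re (Q n (cis t))\<bar>) \<longlonglongrightarrow> (LINT t|circ. \<bar>u t + w N t\<bar>)"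
  proof (rule integral_dominated_convergence[where w="\<lambda>t. \<bar>u t\<bar> + (real N + 1)"])
    show "AE t in circ. (\<lambda>n. \<bar>u t + Re (Q n (cis t))\<bar>) \<longlonglongrightarrow> \<bar>u t + w N t\<bar>"
      using Q(3) by eventually_elim (intro tendsto_intros)
    show "AE t in circ. norm \<bar>u t + Re (Q n (cis t))\<bar> \<le> \<bar>u t\<bar> + (real N + 1)" for n
    proof (rule AE_I2)
      fix t show "norm \<bar>u t + Re (Q n (cis t))\<bar> \<le> \<bar>u t\<bar> + (real N + 1)"
        using Q(2)[of n t] by auto
    qed
  qed (use u in auto)
  have "eventually (\<lambda>n. (LINT t|circ. exp (p * (u t + Re (Q n (cis t))))) < 1 + e \<and>
      (LINT t|circ. \<bar>u t + Re (Q n (cis t))\<bar>) < e) sequentially"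
    using order_tendstoD(2)[OF 3 N(1)] order_tendstoD(2)[OF 4 N(2)] by (rule eventually_conj)
  then obtain n where "(LINT t|circ. exp (p * (u t + Re (Q n (cis t))))) < 1 + e"
      "(LINT t|circ. \<bar>u t + Re (Q n (cis t))\<bar>) < e"
    by (auto simp: eventually_sequentially)
  with Q(1) int show ?thesis by blast
qed

section \<open>Outer functions\<close>

text \<open>Replacing \<open>ln \<psi>\<close> by its product with the indicator of \<open>{0..2*pi}\<close> makes it measurable on the
  whole line, as integrals over \<open>circ\<close> need.\<close>

lemma outer_function_dataE:
  assumes F: "outer_function p F"
  obtains c u where "norm c = 1" "u \<in> borel_measurable borel" "integrable circ u"
    "integrable circ (\<lambda>t. exp (p * u t))" "\<And>z. z \<in> ball 0 1 \<Longrightarrow> F z = c * exp (herglotz u z)"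
proof -
  obtain c \<psi> where c: "norm c = 1" and pos: "\<And>t. \<psi> t > 0"
    and i1: "set_integrable lborel {0..2*pi} (\<lambda>t. ln (\<psi> t))"
    and i2: "set_integrable lborel {0..2*pi} (\<lambda>t. \<psi> t powr p)"
    and Fz: "\<And>z. z \<in> ball 0 1 \<Longrightarrow> F z = c * exp (of_real (1 / (2 * pi)) *
           (LINT t:{0..2*pi}|lborel. (cis t + z) / (cis t - z) * of_real (ln (\<psi> t))))"
    using F unfolding outer_function_def by blast
  define u where "u = (\<lambda>t. indicator {0..2*pi} t *\<^sub>R ln (\<psi> t))"
  have um [measurable]: "u \<in> borel_measurable borel"
    using i1 unfolding set_integrable_def u_def by (auto dest: borel_measurable_integrable)
  have u_eq: "u t = ln (\<psi> t)" if "t \<in> {0..2*pi}" for t using that by (simp add: u_def)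
  have "integrable circ u"
    unfolding integrable_circ_iff[OF um] using i1
    by (rule iffD1[OF set_integrable_cong, rotated -1]) (auto simp: u_eq)
  moreover have "integrable circ (\<lambda>t. exp (p * u t))"
  proof -
    have m: "(\<lambda>t. exp (p * u t)) \<in> borel_measurable borel" by measurable
    have "set_integrable lborel {0..2*pi} (\<lambda>t. exp (p * u t))"
      using i2 by (rule iffD1[OF set_integrable_cong, rotated -1])
        (use pos in \<open>auto simp: u_eq powr_def less_imp_neq[symmetric]\<close>)
    then show ?thesis using integrable_circ_iff[OF m] by simp
  qed
  moreover have "F z = c * exp (herglotz u z)" if z: "z \<in> ball 0 1" for z
  proof -
    have m: "(\<lambda>t. (cis t + z) / (cis t - z) * complex_of_real (u t)) \<in> borel_measurable borel"
      using borel_measurable_continuous_onI[OF herglotz_kernel_continuous[of z]] z by measurable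
    have "herglotz u z = of_real (1 / (2 * pi)) * (LINT t:{0..2*pi}|lborel. (cis t + z) / (cis t - z) * of_real (u t))"
      unfolding herglotz_def integral_circ[OF m] by (simp add: scaleR_conv_of_real)
    also have "(LINT t:{0..2*pi}|lborel. (cis t + z) / (cis t - z) * of_real (u t))
        = (LINT t:{0..2*pi}|lborel. (cis t + z) / (cis t - z) * of_real (ln (\<psi> t)))"
      using u_eq by (intro set_lebesgue_integral_cong) auto
    finally show ?thesis using Fz[OF z] by simp
  qed
  ultimately show ?thesis using that c um by blast
qed

lemma outer_functionI:
  assumes c: "norm c = 1" and um [measurable]: "u \<in> borel_measurable borel" and u: "integrable circ u"
    and e: "integrable circ (\<lambda>t. exp (p * u t))"
    and F: "\<And>z. z \<in> ball 0 1 \<Longrightarrow> F z = c * exp (herglotz u z)"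
  shows "outer_function p F"
  unfolding outer_function_def
proof (intro exI[of _ c] exI[of _ "\<lambda>t. exp (u t)"] conjI allI ballI c)
  show "set_integrable lborel {0..2*pi} (\<lambda>t. ln (exp (u t)))"
    using u integrable_circ_iff[OF um] by simp
  have "(\<lambda>t. exp (p * u t)) \<in> borel_measurable borel" by measurable
  from integrable_circ_iff[OF this] e
  show "set_integrable lborel {0..2*pi} (\<lambda>t. exp (u t) powr p)"
    by (simp add: powr_def)
  fix z :: complex assume z: "z \<in> ball 0 1"
  have m: "(\<lambda>t. (cis t + z) / (cis t - z) * complex_of_real (u t)) \<in> borel_measurable borel"
    using borel_measurable_continuous_onI[OF herglotz_kernel_continuous[of z]] z by measurable
  have "herglotz u z = of_real (1 / (2 * pi)) * (LINT t:{0..2*pi}|lborel. (cis t + z) / (cis t - z) * of_real (u t))"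
    unfolding herglotz_def integral_circ[OF m] by (simp add: scaleR_conv_of_real)
  then show "F z = c * exp (of_real (1 / (2 * pi)) *
           (LINT t:{0..2*pi}|lborel. (cis t + z) / (cis t - z) * of_real (ln (exp (u t)))))"
    using F[OF z] by simp
qed simp

lemma herglotz_Re_entire:
  assumes "Q holomorphic_on UNIV" "norm z < 1"
  shows "herglotz (\<lambda>t. Re (Q (cis t))) z = Q z - \<i> * Im (Q 0)"
  using schwarz_formula[OF holomorphic_on_subset[OF assms(1)], of 1 z] assms(2) by simp

lemma entire_circle_continuous:
  fixes Q :: "complex \<Rightarrow> complex"
  assumes "Q holomorphic_on UNIV"
  shows "continuous_on UNIV (\<lambda>t. Q (cis t))"
  using holomorphic_on_imp_continuous_on[OF assms]
  by (rule continuous_on_compose2) (auto intro!: continuous_intros)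

lemma herglotz_norm_le:
  assumes z: "norm z < 1" and v: "integrable circ v"
  shows "norm (herglotz v z) \<le> 2 / (1 - norm z) * (LINT t|circ. \<bar>v t\<bar>)"
proof -
  have "norm (herglotz v z) \<le> (LINT t|circ. 2 / (1 - norm z) * \<bar>v t\<bar>)"
    unfolding herglotz_def
  proof (rule Bochner_Integration.integral_norm_bound_integral[OF herglotz_integrable[OF z v]])
    show "integrable circ (\<lambda>t. 2 / (1 - norm z) * \<bar>v t\<bar>)" using v by simp
    show "norm ((cis t + z) / (cis t - z) * complex_of_real (v t)) \<le> 2 / (1 - norm z) * \<bar>v t\<bar>" for t
      using mult_right_mono[OF herglotz_kernel_bound[OF z, of t], of "\<bar>v t\<bar>"] by (simp only: norm_mult norm_of_real)
  qed
  then show ?thesis by simp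
qed

text \<open>For \<open>u = Re Q\<close> with \<open>Q\<close> entire the transform is \<open>Q\<close> up to a constant. Such functions are dense
  in mean, and the transform turns convergence in mean into locally uniform convergence on the disk.\<close>

lemma herglotz_holomorphic:
  assumes u: "integrable circ u" and um: "u \<in> borel_measurable borel"
    and p: "0 < p" and eu: "integrable circ (\<lambda>t. exp (p * u t))"
  shows "herglotz u holomorphic_on ball 0 1"
proof -
  have "\<exists>Q. Q holomorphic_on UNIV \<and> (LINT t|circ. \<bar>u t + Re (Q (cis t))\<bar>) < 1 / (real n + 1)" for n
    using exp_mean_approx[OF u um p eu, of "1 / (real n + 1)"] by auto
  then obtain Q where Q: "\<And>n. Q n holomorphic_on UNIV"
    "\<And>n. (LINT t|circ. \<bar>u t + Re (Q n (cis t))\<bar>) < 1 / (real n + 1)" by metis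
  define f where "f = (\<lambda>n z. \<i> * Im (Q n 0) - Q n z)"
  have diff: "herglotz u z - f n z = herglotz (\<lambda>t. u t + Re (Q n (cis t))) z"
    and int: "integrable circ (\<lambda>t. u t + Re (Q n (cis t)))" if "norm z < 1" for n z
  proof -
    have i: "integrable circ (\<lambda>t. Re (Q n (cis t)))"
      by (intro integrable_circ_continuous continuous_intros entire_circle_continuous Q)
    show "herglotz u z - f n z = herglotz (\<lambda>t. u t + Re (Q n (cis t))) z"
      unfolding herglotz_add[OF that u i] herglotz_Re_entire[OF Q(1) that] f_def by simp
    show "integrable circ (\<lambda>t. u t + Re (Q n (cis t)))" using u i by simp
  qed
  show ?thesis
  proof (rule holomorphic_uniform_sequence[OF open_ball, of f])
    show "f n holomorphic_on ball 0 1" for n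
      unfolding f_def by (intro holomorphic_intros holomorphic_on_subset[OF Q(1)]) auto
    fix x :: complex assume x: "x \<in> ball 0 1"
    define d where "d = (1 - norm x) / 2"
    have d: "0 < d" using x by (simp add: d_def)
    have sub: "norm z \<le> 1 - d" if "z \<in> cball x d" for z
    proof -
      have "norm (z - x) \<le> d" using that by (simp add: dist_norm norm_minus_commute)
      then show ?thesis using norm_triangle_ineq[of "z - x" x] unfolding d_def by (simp add: field_simps)
    qed
    have "uniform_limit (cball x d) f (herglotz u) sequentially"
    proof (rule uniform_limitI)
      fix e :: real assume e: "e > 0"
      have "(\<lambda>n. 2 / d * (1 / (real n + 1))) \<longlonglongrightarrow> 0" by real_asymp
      from order_tendstoD(2)[OF this e]
      show "\<forall>\<^sub>F n in sequentially. \<forall>z\<in>cball x d. dist (f n z) (herglotz u z) < e"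
      proof eventually_elim
        case (elim n)
        show ?case
        proof
          fix z assume "z \<in> cball x d"
          then have z: "norm z \<le> 1 - d" by (rule sub)
          then have z1: "norm z < 1" using d by simp
          have "dist (f n z) (herglotz u z) = norm (herglotz (\<lambda>t. u t + Re (Q n (cis t))) z)"
            by (simp add: dist_norm norm_minus_commute flip: diff[OF z1])
          also have "\<dots> \<le> 2 / (1 - norm z) * (LINT t|circ. \<bar>u t + Re (Q n (cis t))\<bar>)"
            by (rule herglotz_norm_le[OF z1 int[OF z1]])
          also have "\<dots> \<le> 2 / d * (1 / (real n + 1))"
            using z d Q(2)[of n] by (intro mult_mono divide_left_mono mult_pos_pos) auto
          also have "\<dots> < e" by (rule elim)
          finally show "dist (f n z) (herglotz u z) < e" .
        qed
      qed
    qed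
    then show "\<exists>d>0. cball x d \<subseteq> ball 0 1 \<and> uniform_limit (cball x d) f (herglotz u) sequentially"
      using d sub by (intro exI[of _ d]) fastforce
  qed
qed

lemma outer_function_hardy:
  assumes p: "0 < p" and F: "outer_function p F"
  shows "F holomorphic_on ball 0 1"
    and "\<exists>K. \<forall>r\<in>{0<..<1}. (LINT t|circ. norm (F (of_real r * cis t)) powr p) \<le> K"
proof -
  obtain c u where cu: "norm c = 1" "u \<in> borel_measurable borel" "integrable circ u"
    "integrable circ (\<lambda>t. exp (p * u t))" "\<And>z. z \<in> ball 0 1 \<Longrightarrow> F z = c * exp (herglotz u z)"
    using outer_function_dataE[OF F] by blast
  have h: "herglotz u holomorphic_on ball 0 1"
    using herglotz_holomorphic cu p by blast
  have "(\<lambda>z. c * exp (herglotz u z)) holomorphic_on ball 0 1"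
    by (intro holomorphic_intros h)
  then show "F holomorphic_on ball 0 1"
    by (rule holomorphic_transform) (simp add: cu(5))
  have "(LINT t|circ. norm (F (of_real r * cis t)) powr p) \<le> (LINT t|circ. exp (p * u t))"
    if r: "r \<in> {0<..<1}" for r
    using mean_exp_herglotz_le[OF _ _ cu(3,4) holomorphic_on_imp_continuous_on[OF h], of r] r cu(1,5) circle_in_ball[of r]
    by (simp add: norm_mult)
  then show "\<exists>K. \<forall>r\<in>{0<..<1}. (LINT t|circ. norm (F (of_real r * cis t)) powr p) \<le> K" by blast
qed

text \<open>Take for \<open>\<phi>\<close> an exponential such that \<open>v = \<phi> * F\<close> is the outer function of modulus
  \<open>exp (u + Re Q)\<close>, which is close to \<open>1\<close> in mean. The \<open>p\<close>-means of \<open>v\<close> exceed \<open>1\<close> at most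
  slightly, and \<open>Re (v 0)\<close>, the mean of \<open>Re v\<close>, is hardly below \<open>1\<close>. So the mean gap in the
  supporting line inequality at \<open>1\<close> is small, and this gap controls \<open>\<bar>v - 1\<bar>\<^sup>p\<close>. The bound is
  uniform in \<open>r\<close>.\<close>

lemma outer_function_almost_invertible:
  assumes p: "1 < p" and F: "outer_function p F" and e: "0 < e"
  obtains \<phi> where "\<phi> holomorphic_on UNIV"
    "\<And>r. 0 < r \<Longrightarrow> r < 1 \<Longrightarrow>
       (LINT t|circ. norm (\<phi> (of_real r * cis t) * F (of_real r * cis t) - 1) powr p) \<le> e"
proof -
  obtain c u where c: "norm c = 1" and um: "u \<in> borel_measurable borel" and u: "integrable circ u"
    and eu: "integrable circ (\<lambda>t. exp (p * u t))"
    and Fz: "\<And>z. z \<in> ball 0 1 \<Longrightarrow> F z = c * exp (herglotz u z)"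
    using outer_function_dataE[OF F] by blast
  obtain C where C: "C \<ge> 1" and conv: "\<And>a b k::complex. k * a = of_real (norm a powr p) \<Longrightarrow> (a = 0 \<Longrightarrow> k = 0) \<Longrightarrow>
       norm b powr p \<le> e / 2 * norm a powr p + C * (norm (a + b) powr p - norm a powr p - p * Re (b * k))"
    using uniform_convexity[OF p, of "e / 2"] e by auto
  define d where "d = e / (2 * C * (1 + p))"
  have d: "0 < d" "C * (d + p * d) = e / 2"
  proof -
    show "0 < d" unfolding d_def using e C p by (intro divide_pos_pos mult_pos_pos) auto
    have "2 * C * (1 + p) * d = e" using C p by (simp add: d_def)
    then show "C * (d + p * d) = e / 2" by (simp add: algebra_simps)
  qed
  obtain Q where Q: "Q holomorphic_on UNIV"
    and Qe: "integrable circ (\<lambda>t. exp (p * (u t + Re (Q (cis t)))))"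
    and Q1: "(LINT t|circ. exp (p * (u t + Re (Q (cis t))))) < 1 + d"
    and Q2: "(LINT t|circ. \<bar>u t + Re (Q (cis t))\<bar>) < d"
    using exp_mean_approx[OF u um _ eu d(1)] p by auto
  define w where "w = (\<lambda>t. u t + Re (Q (cis t)))"
  have Qc: "continuous_on UNIV (\<lambda>t. Re (Q (cis t)))"
    by (intro continuous_intros entire_circle_continuous Q)
  have w: "integrable circ w" unfolding w_def
    using u integrable_circ_continuous[OF Qc] by simp
  have wm: "w \<in> borel_measurable borel" unfolding w_def
    using um borel_measurable_continuous_onI[OF Qc] by measurable
  have ew: "integrable circ (\<lambda>t. exp (p * w t))" using Qe by (simp add: w_def)
  define v where "v = (\<lambda>z. exp (herglotz w z))"
  have hw: "herglotz w holomorphic_on ball 0 1"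
    using herglotz_holomorphic[OF w wm _ ew] p by simp
  have hv: "v holomorphic_on ball 0 1" unfolding v_def by (intro holomorphic_intros hw)
  \<comment> \<open>The factor \<open>inverse c\<close> and the imaginary constant rotate \<open>v\<close> so that \<open>v 0 > 0\<close>.\<close>
  define \<phi> where "\<phi> = (\<lambda>z. inverse c * exp (Q z - \<i> * Im (Q 0)))"
  have v_eq: "\<phi> z * F z = v z" if z: "z \<in> ball 0 1" for z
  proof -
    have "herglotz w z = herglotz u z + (Q z - \<i> * Im (Q 0))"
      unfolding w_def using herglotz_add[OF _ u integrable_circ_continuous[OF Qc], of z]
        herglotz_Re_entire[OF Q, of z] z by simp
    moreover have "c \<noteq> 0" using c by auto
    ultimately show ?thesis using Fz[OF z] by (simp add: \<phi>_def v_def exp_add)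
  qed
  have v0: "1 - d \<le> Re (v 0)"
  proof -
    have "herglotz w 0 = of_real (LINT t|circ. w t)" by (simp add: herglotz_def)
    then have "Re (v 0) = exp (LINT t|circ. w t)" by (simp add: v_def Re_exp)
    moreover have "\<bar>LINT t|circ. w t\<bar> \<le> (LINT t|circ. \<bar>w t\<bar>)" by (rule integral_abs_bound)
    moreover have "1 + (LINT t|circ. w t) \<le> exp (LINT t|circ. w t)" by (rule exp_ge_add_one_self)
    ultimately show ?thesis using Q2 unfolding w_def by linarith
  qed
  show ?thesis
  proof (rule that[of \<phi>])
    show "\<phi> holomorphic_on UNIV" unfolding \<phi>_def by (intro holomorphic_intros Q)
    fix r :: real assume r: "0 < r" "r < 1"
    define V where "V = (\<lambda>t. v (of_real r * cis t))"
    have Vc: "continuous_on UNIV V"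
      unfolding V_def using r by (intro circle_continuous holomorphic_on_imp_continuous_on hv) auto
    have int: "integrable circ V" "integrable circ (\<lambda>t. norm (V t) powr p)" "integrable circ (\<lambda>t. norm (V t - 1) powr p)"
      using p by (auto intro!: integrable_circ_continuous continuous_intros continuous_on_powr' Vc)
    have "(LINT t|circ. norm (\<phi> (of_real r * cis t) * F (of_real r * cis t) - 1) powr p) = (LINT t|circ. norm (V t - 1) powr p)"
      using v_eq circle_in_ball[of r] r by (simp add: V_def)
    also have "\<dots> \<le> (LINT t|circ. e / 2 + C * (norm (V t) powr p - 1 - p * (Re (V t) - 1)))"
    proof (rule integral_mono[OF int(3)])
      show "integrable circ (\<lambda>t. e / 2 + C * (norm (V t) powr p - 1 - p * (Re (V t) - 1)))"
        using int by simp
      show "norm (V t - 1) powr p \<le> e / 2 + C * (norm (V t) powr p - 1 - p * (Re (V t) - 1))" for t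
        using conv[of 1 1 "V t - 1"] by simp
    qed
    also have "\<dots> = e / 2 + C * ((LINT t|circ. norm (V t) powr p) - 1 - p * (Re (LINT t|circ. V t) - 1))"
      using int by (simp add: integral_Re)
    also have "(LINT t|circ. V t) = v 0"
      unfolding V_def by (rule mean_value_disk[OF hv r])
    also have "e / 2 + C * ((LINT t|circ. norm (V t) powr p) - 1 - p * (Re (v 0) - 1)) \<le> e / 2 + C * (d + p * d)"
    proof -
      have "(LINT t|circ. norm (V t) powr p) \<le> 1 + d"
        using mean_exp_herglotz_le[OF r w ew holomorphic_on_imp_continuous_on[OF hw]] Q1
        by (simp add: V_def v_def w_def)
      moreover have "p * (- d) \<le> p * (Re (v 0) - 1)" using v0 p by (intro mult_left_mono) auto
      ultimately have "(LINT t|circ. norm (V t) powr p) - 1 - p * (Re (v 0) - 1) \<le> d + p * d" by simp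
      then show ?thesis using C by (intro add_left_mono mult_left_mono) auto
    qed
    also have "\<dots> = e" using d by simp
    finally show "(LINT t|circ. norm (\<phi> (of_real r * cis t) * F (of_real r * cis t) - 1) powr p) \<le> e" .
  qed
qed

section \<open>Approximation by polynomials\<close>

lemma holomorphic_approx_poly:
  assumes H: "H holomorphic_on ball 0 R" and R: "1 < R" and e: "0 < e"
  obtains P where "\<And>z. z \<in> cball 0 1 \<Longrightarrow> norm (H z - poly P z) < e"
proof -
  define a where "a = (\<lambda>n. (deriv ^^ n) H 0 / fact n)"
  have sums: "(\<lambda>n. a n * z ^ n) sums H z" if "z \<in> ball 0 R" for z
    using holomorphic_power_series[OF H that] by (simp add: a_def)
  have "norm (complex_of_real ((1 + R) / 2)) \<le> conv_radius a"
    by (rule conv_radius_geI, rule sums_summable, rule sums) (use R in \<open>simp add: norm_divide field_simps flip: of_real_add\<close>)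
  moreover have "ereal 1 < norm (complex_of_real ((1 + R) / 2))" using R by (simp add: norm_divide flip: of_real_add)
  ultimately have "ereal 1 < conv_radius a" by (rule less_le_trans[rotated])
  from powser_uniform_limit[OF this, of 0] 
  have "uniform_limit (cball 0 1) (\<lambda>n x. \<Sum>i<n. a i * x ^ i) (\<lambda>x. suminf (\<lambda>i. a i * x ^ i)) sequentially" by simp
  from uniform_limitD[OF this e]
  obtain n where n: "\<And>z. z \<in> cball 0 1 \<Longrightarrow> dist (\<Sum>i<n. a i * z ^ i) (suminf (\<lambda>i. a i * z ^ i)) < e"
    unfolding eventually_sequentially by blast
  show ?thesis
  proof (rule that[of "\<Sum>i<n. monom (a i) i"])
    fix z :: complex assume z: "z \<in> cball 0 1"
    then have "suminf (\<lambda>i. a i * z ^ i) = H z" using sums[of z] R by (auto simp: sums_iff)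
    with n[OF z] show "norm (H z - poly (\<Sum>i<n. monom (a i) i) z) < e"
      by (simp add: dist_norm norm_minus_commute poly_sum poly_monom)
  qed
qed

lemma norm_add_powr_le:
  fixes x y :: complex
  assumes "0 < p"
  shows "norm (x + y) powr p \<le> 2 powr p * (norm x powr p + norm y powr p)"
proof -
  have "norm (x + y) \<le> 2 * max (norm x) (norm y)"
    using norm_triangle_ineq[of x y] by linarith
  then have "norm (x + y) powr p \<le> (2 * max (norm x) (norm y)) powr p"
    using assms by (intro powr_mono2) auto
  also have "\<dots> = 2 powr p * max (norm x) (norm y) powr p" by (simp add: powr_mult)
  also have "\<dots> \<le> 2 powr p * (norm x powr p + norm y powr p)"
    by (intro mult_left_mono) (auto simp: max_def)
  finally show ?thesis .
qed

lemma radial_continuous_extension: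
  assumes h: "continuous_on (ball 0 1) h" and w: "has_boundary_value h t w"
  shows "continuous_on {0..1::real} (\<lambda>x. if x < 1 then h (of_real x * cis t) else w)"
proof (rule continuous_on_IccI)
  let ?g = "\<lambda>x::real. if x < 1 then h (of_real x * cis t) else w"
  have lim: "?g \<midarrow>x\<rightarrow> ?g x" if "\<bar>x\<bar> < 1" for x
  proof -
    have "of_real x * cis t \<in> ball 0 1" using that by (simp add: norm_mult)
    then have "isCont h (of_real x * cis t)"
      using h continuous_on_eq_continuous_at[OF open_ball] by blast
    then have "isCont (\<lambda>x. h (of_real x * cis t)) x"
      by (rule isCont_o2[where f="\<lambda>x. of_real x * cis t", rotated]) (auto intro!: continuous_intros)
    then have "(\<lambda>x. h (of_real x * cis t)) \<midarrow>x\<rightarrow> h (of_real x * cis t)" by (simp add: isCont_def)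
    then have "?g \<midarrow>x\<rightarrow> h (of_real x * cis t)"
    proof (rule Lim_transform_eventually)
      have "eventually (\<lambda>y. y < 1) (at x)" using that by (intro order_tendstoD(2)[OF tendsto_ident_at]) auto
      then show "eventually (\<lambda>y. h (of_real y * cis t) = ?g y) (at x)" by eventually_elim simp
    qed
    then show ?thesis using that by (simp add: abs_less_iff)
  qed
  show "?g \<midarrow>x\<rightarrow> ?g x" if "0 < x" "x < 1" for x
    by (rule lim) (use that in simp)
  show "(?g \<longlongrightarrow> ?g 0) (at_right 0)"
    using lim[of 0] by (simp add: filterlim_at_split)
  show "(?g \<longlongrightarrow> ?g 1) (at_left 1)"
  proof -
    have "((\<lambda>x. h (of_real x * cis t)) \<longlongrightarrow> w) (at_left 1)" using w by (simp add: has_boundary_value_def)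
    then have "(?g \<longlongrightarrow> w) (at_left 1)"
    proof (rule Lim_transform_eventually)
      show "eventually (\<lambda>y. h (of_real y * cis t) = ?g y) (at_left 1)"
        unfolding eventually_at_filter by (auto intro: always_eventually)
    qed
    then show ?thesis by simp
  qed
qed auto

text \<open>Dilations \<open>h (\<rho> z)\<close> converge to \<open>h\<close> in \<open>H\<^sup>p\<close>. If this failed for some \<open>e\<close>, there would be
  dilation factors tending to \<open>1\<close> and radii \<open>R n\<close> violating it. On each radius along which \<open>h\<close> has a
  limit it is uniformly continuous up to the end point, whatever the behaviour of \<open>R n\<close>, so the
  integrands tend to \<open>0\<close> almost everywhere and dominated convergence gives a contradiction.\<close>

lemma bounded_radial_dilation:
  assumes p: "0 < p" and h: "h holomorphic_on ball 0 1" and B: "\<And>z. z \<in> ball 0 1 \<Longrightarrow> norm (h z) \<le> B"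
    and ae: "AE t in circ. \<exists>w. has_boundary_value h t w" and e: "0 < e"
  shows "\<exists>\<rho>. 0 < \<rho> \<and> \<rho> < 1 \<and> (\<forall>r\<in>{0<..<1}.
      (LINT t|circ. norm (h (of_real r * cis t) - h (of_real \<rho> * (of_real r * cis t))) powr p) \<le> e)"
proof (rule ccontr)
  let ?I = "\<lambda>\<rho> r t. norm (h (of_real r * cis t) - h (of_real \<rho> * (of_real r * cis t))) powr p"
  assume "\<not> ?thesis"
  then have "\<forall>n. \<exists>r\<in>{0<..<1}. e < (LINT t|circ. ?I (radius n) r t)"
    using radius_bounds by (meson not_le)
  then have "\<exists>R. \<forall>n. R n \<in> {0<..<1} \<and> e < (LINT t|circ. ?I (radius n) (R n) t)"
    by (intro choice) blast
  then obtain R where R: "\<And>n. 0 < R n" "\<And>n. R n < 1" "\<And>n. e < (LINT t|circ. ?I (radius n) (R n) t)"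
    by auto
  have hc: "continuous_on (ball 0 1) h" using h by (rule holomorphic_on_imp_continuous_on)
  have prod1: "0 \<le> radius n * R n" "radius n * R n < 1" for n
    using R[of n] radius_bounds[of n] mult_strict_mono[of "radius n" 1 "R n" 1] by auto
  have "(\<lambda>n. LINT t|circ. ?I (radius n) (R n) t) \<longlonglongrightarrow> (LINT t|circ. 0)"
  proof (rule integral_dominated_convergence[where w="\<lambda>_. (B + B) powr p"])
    have m1: "(\<lambda>t. h (of_real (R n) * cis t)) \<in> borel_measurable borel" for n
      using R by (intro borel_measurable_continuous_onI circle_continuous hc) (auto simp: less_imp_le)
    have m2: "(\<lambda>t. h (of_real (radius n) * (of_real (R n) * cis t))) \<in> borel_measurable borel" for n
      using borel_measurable_continuous_onI[OF circle_continuous[OF hc prod1]] by (simp add: mult.assoc)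
    show "(\<lambda>t. ?I (radius n) (R n) t) \<in> borel_measurable circ" for n
      using m1[of n] m2[of n] by measurable
    show "AE t in circ. norm (?I (radius n) (R n) t) \<le> (B + B) powr p" for n
    proof (rule AE_I2)
      fix t
      have "norm (h (of_real (R n) * cis t) - h (of_real (radius n) * (of_real (R n) * cis t))) \<le> B + B"
        using B[OF circle_in_ball[of "R n" t]] B[OF circle_in_ball[OF prod1[of n], of t]] R[of n]
        by (intro norm_triangle_le_diff add_mono) (auto simp: mult.assoc)
      then show "norm (?I (radius n) (R n) t) \<le> (B + B) powr p" using p by (simp add: powr_mono2)
    qed
    show "AE t in circ. (\<lambda>n. ?I (radius n) (R n) t) \<longlonglongrightarrow> 0"
      using ae
    proof eventually_elim
      case (elim t)
      then obtain w where w: "has_boundary_value h t w" by blast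
      define g where "g = (\<lambda>x::real. if x < 1 then h (of_real x * cis t) else w)"
      have "uniformly_continuous_on {0..1} g"
        unfolding g_def by (intro compact_uniformly_continuous radial_continuous_extension[OF hc w]) auto
      moreover have "(\<lambda>n. dist (R n) (radius n * R n)) \<longlonglongrightarrow> 0"
      proof (rule Lim_null_comparison)
        show "(\<lambda>n. 1 - radius n) \<longlonglongrightarrow> 0" using radius_tendsto by (auto intro!: tendsto_eq_intros)
        show "\<forall>\<^sub>F n in sequentially. norm (dist (R n) (radius n * R n)) \<le> 1 - radius n"
        proof (rule always_eventually, rule allI)
          fix n
          have "R n - radius n * R n = (1 - radius n) * R n" by (simp add: algebra_simps)
          moreover have "(1 - radius n) * R n \<le> (1 - radius n) * 1" "0 \<le> (1 - radius n) * R n"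
            using R[of n] radius_bounds[of n] by (auto intro!: mult_left_mono)
          ultimately show "norm (dist (R n) (radius n * R n)) \<le> 1 - radius n" by (simp add: dist_real_def)
        qed
      qed
      ultimately have "(\<lambda>n. dist (g (R n)) (g (radius n * R n))) \<longlonglongrightarrow> 0"
        unfolding uniformly_continuous_on_sequentially using R prod1
        by (auto simp: less_imp_le)
      then have "(\<lambda>n. norm (h (of_real (R n) * cis t) - h (of_real (radius n) * (of_real (R n) * cis t)))) \<longlonglongrightarrow> 0"
        using R prod1 by (simp add: g_def dist_norm mult.assoc)
      from tendsto_powr'[OF this tendsto_const[of p]] p
      show "(\<lambda>n. ?I (radius n) (R n) t) \<longlonglongrightarrow> 0" by simp
    qed
  qed auto
  then have "(\<lambda>n. LINT t|circ. ?I (radius n) (R n) t) \<longlonglongrightarrow> 0" by simp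
  then have "e \<le> 0" by (rule LIMSEQ_le_const) (use R(3) in \<open>auto intro: less_imp_le\<close>)
  with e show False by simp
qed

text \<open>A dilation is analytic on a neighbourhood of the closed disk, hence uniformly close to a Taylor
  polynomial.\<close>

lemma bounded_radial_approx_poly:
  assumes p: "0 < p" and h: "h holomorphic_on ball 0 1" and B: "\<And>z. z \<in> ball 0 1 \<Longrightarrow> norm (h z) \<le> B"
    and ae: "AE t in circ. \<exists>w. has_boundary_value h t w" and e: "0 < e"
  obtains P where "\<And>r. 0 < r \<Longrightarrow> r < 1 \<Longrightarrow>
      (LINT t|circ. norm (h (of_real r * cis t) - poly P (of_real r * cis t)) powr p) \<le> e"
proof -
  define d where "d = e / (2 powr p * 2)"
  have d: "0 < d" using e by (simp add: d_def)
  obtain \<rho> where \<rho>: "0 < \<rho>" "\<rho> < 1" and dil: "\<And>r. 0 < r \<Longrightarrow> r < 1 \<Longrightarrow>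
      (LINT t|circ. norm (h (of_real r * cis t) - h (of_real \<rho> * (of_real r * cis t))) powr p) \<le> d"
    using bounded_radial_dilation[OF p h B ae d] by auto
  have dom: "of_real \<rho> * z \<in> ball 0 1" if "z \<in> ball 0 (1 / \<rho>)" for z :: complex
    using that \<rho> by (simp add: norm_mult field_simps)
  have hol: "(\<lambda>z. h (of_real \<rho> * z)) holomorphic_on ball 0 (1 / \<rho>)"
    by (rule holomorphic_on_compose_gen[OF _ h, unfolded o_def]) (use dom in \<open>auto intro!: holomorphic_intros\<close>)
  obtain P where P: "\<And>z. z \<in> cball 0 1 \<Longrightarrow> norm (h (of_real \<rho> * z) - poly P z) < d powr (1 / p)"
    by (rule holomorphic_approx_poly[OF hol, of "d powr (1 / p)"]) (use \<rho> d in auto)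
  show ?thesis
  proof (rule that[of P])
    fix r :: real assume r: "0 < r" "r < 1"
    define Z where "Z = (\<lambda>t. of_real r * cis t)"
    have Z: "Z t \<in> ball 0 1" for t unfolding Z_def using r by (intro circle_in_ball) auto
    have c1: "continuous_on UNIV (\<lambda>t. h (Z t))" unfolding Z_def
      using r by (intro circle_continuous holomorphic_on_imp_continuous_on h) auto
    have c2: "continuous_on UNIV (\<lambda>t. h (of_real \<rho> * Z t))"
      by (rule continuous_on_compose2[OF holomorphic_on_imp_continuous_on[OF hol]])
         (use Z \<rho> in \<open>auto simp: Z_def norm_mult field_simps intro!: continuous_intros\<close>, 
          use r \<rho> in \<open>smt (verit) mult_less_cancel_left1 mult_less_cancel_right1\<close>)
    have c3: "continuous_on UNIV (\<lambda>t. poly P (Z t))"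
      unfolding Z_def by (intro continuous_intros)
    have i: "integrable circ (\<lambda>t. norm (h (Z t) - poly P (Z t)) powr p)"
      "integrable circ (\<lambda>t. norm (h (Z t) - h (of_real \<rho> * Z t)) powr p)"
      using p by (auto intro!: integrable_circ_continuous continuous_intros continuous_on_powr' c1 c2 c3)
    have "(LINT t|circ. norm (h (Z t) - poly P (Z t)) powr p)
        \<le> (LINT t|circ. 2 powr p * (norm (h (Z t) - h (of_real \<rho> * Z t)) powr p + d))"
    proof (rule integral_mono[OF i(1)])
      show "integrable circ (\<lambda>t. 2 powr p * (norm (h (Z t) - h (of_real \<rho> * Z t)) powr p + d))"
        using i(2) by simp
      fix t
      have "norm (h (Z t) - poly P (Z t)) powr p
          \<le> 2 powr p * (norm (h (Z t) - h (of_real \<rho> * Z t)) powr p + norm (h (of_real \<rho> * Z t) - poly P (Z t)) powr p)"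
        using norm_add_powr_le[OF p, of "h (Z t) - h (of_real \<rho> * Z t)" "h (of_real \<rho> * Z t) - poly P (Z t)"] by simp
      also have "norm (h (of_real \<rho> * Z t) - poly P (Z t)) powr p \<le> (d powr (1 / p)) powr p"
        using P[of "Z t"] Z[of t] p by (intro powr_mono2) auto
      also have "\<dots> = d" using d p by (simp add: powr_powr)
      finally show "norm (h (Z t) - poly P (Z t)) powr p \<le> 2 powr p * (norm (h (Z t) - h (of_real \<rho> * Z t)) powr p + d)"
        by simp
    qed
    also have "\<dots> = 2 powr p * ((LINT t|circ. norm (h (Z t) - h (of_real \<rho> * Z t)) powr p) + d)"
      using i(2) by simp
    also have "\<dots> \<le> 2 powr p * (d + d)"
      using dil[OF r] by (intro mult_left_mono add_mono) (auto simp: Z_def)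
    also have "\<dots> = e" by (simp add: d_def)
    finally show "(LINT t|circ. norm (h (of_real r * cis t) - poly P (of_real r * cis t)) powr p) \<le> e"
      by (simp add: Z_def)
  qed
qed

section \<open>Exponentials of bounded functions are outer\<close>

text \<open>A bounded analytic function is determined, up to an imaginary constant, by the boundary values of its real
  part, through the Schwarz formula on radii tending to \<open>1\<close>. The unimodular constant of the outer function is
  \<open>exp (\<i> * Im (L 0))\<close>.\<close>

lemma exp_bounded_outer:
  assumes L: "L holomorphic_on ball 0 1" and B: "\<And>z. z \<in> ball 0 1 \<Longrightarrow> norm (L z) \<le> B"
    and ae: "AE t in circ. \<exists>w. has_boundary_value L t w"
  shows "outer_function p (\<lambda>z. exp (L z))"
proof -
  define l where "l = (\<lambda>n t. L (of_real (radius n) * cis t))"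
  have lc: "continuous_on UNIV (l n)" for n
    unfolding l_def using radius_bounds[of n] 
    by (intro circle_continuous holomorphic_on_imp_continuous_on L) auto
  have [measurable]: "l n \<in> borel_measurable borel" for n
    by (rule borel_measurable_continuous_onI[OF lc])
  have lB: "norm (l n t) \<le> B" for n t
    unfolding l_def using radius_bounds[of n] by (intro B circle_in_ball) auto
  \<comment> \<open>Where the limit does not exist the value of \<open>lim\<close> is arbitrary, but the function is measurable
    and such points form a null set.\<close>
  define u where "u = (\<lambda>t. Re (lim (\<lambda>n. l n t)))"
  have um [measurable]: "u \<in> borel_measurable borel" unfolding u_def by measurable
  have lim: "AE t in circ. (\<lambda>n. Re (l n t)) \<longlonglongrightarrow> u t"
    using ae
  proof eventually_elim
    case (elim t)
    then obtain w where "has_boundary_value L t w" by blast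
    then have "(\<lambda>n. l n t) \<longlonglongrightarrow> w" unfolding l_def by (rule has_boundary_value_radius)
    then show ?case using tendsto_Re[of "\<lambda>n. l n t" w] by (simp add: u_def limI)
  qed
  have uB: "AE t in circ. \<bar>u t\<bar> \<le> B"
    using lim
  proof eventually_elim
    case (elim t)
    then have "(\<lambda>n. \<bar>Re (l n t)\<bar>) \<longlonglongrightarrow> \<bar>u t\<bar>" by (rule tendsto_rabs)
    then show ?case
      by (rule LIMSEQ_le_const2) (use lB abs_Re_le_cmod order_trans in blast)
  qed
  have u: "integrable circ u"
    by (rule circ.integrable_const_bound[where B=B]) (use uB in auto)
  have e: "integrable circ (\<lambda>t. exp (p * u t))"
  proof (rule circ.integrable_const_bound[where B="exp (\<bar>p\<bar> * B)"])
    show "AE t in circ. norm (exp (p * u t)) \<le> exp (\<bar>p\<bar> * B)"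
      using uB
    proof eventually_elim
      case (elim t)
      have "p * u t \<le> \<bar>p * u t\<bar>" by simp
      also have "\<dots> \<le> \<bar>p\<bar> * B" unfolding abs_mult using elim by (intro mult_left_mono) auto
      finally show ?case by simp
    qed
  qed auto
  have "L z = \<i> * Im (L 0) + herglotz u z" if z: "z \<in> ball 0 1" for z
  proof (rule LIMSEQ_unique)
    have z1: "norm z < 1" using z by simp
    have "(\<lambda>n. of_real (radius n) * z) \<longlonglongrightarrow> of_real 1 * z"
      by (intro tendsto_intros radius_tendsto)
    moreover have "isCont L z"
      using holomorphic_on_imp_continuous_on[OF L] z continuous_on_eq_continuous_at[OF open_ball] by blast
    ultimately show "(\<lambda>n. L (of_real (radius n) * z)) \<longlonglongrightarrow> L z"
      using isCont_tendsto_compose[of z L] by simp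
    have eq: "L (of_real (radius n) * z) = \<i> * Im (L 0) + herglotz (\<lambda>t. Re (l n t)) z" for n
      unfolding l_def using radius_bounds[of n]
      by (intro schwarz_formula z1 holomorphic_on_subset[OF L]) auto
    have "(\<lambda>n. herglotz (\<lambda>t. Re (l n t)) z) \<longlonglongrightarrow> herglotz u z"
      unfolding herglotz_def
    proof (rule integral_dominated_convergence[where w="\<lambda>_. 2 / (1 - norm z) * B"])
      have K: "(\<lambda>t. (cis t + z) / (cis t - z)) \<in> borel_measurable borel"
        by (rule borel_measurable_continuous_onI[OF herglotz_kernel_continuous[OF z1]])
      show "(\<lambda>t. (cis t + z) / (cis t - z) * complex_of_real (u t)) \<in> borel_measurable circ"
        using K by measurable
      show "(\<lambda>t. (cis t + z) / (cis t - z) * complex_of_real (Re (l n t))) \<in> borel_measurable circ" for n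
        using K by measurable
      show "AE t in circ. (\<lambda>n. (cis t + z) / (cis t - z) * complex_of_real (Re (l n t)))
          \<longlonglongrightarrow> (cis t + z) / (cis t - z) * complex_of_real (u t)"
        using lim
      proof eventually_elim
        case (elim t)
        then show ?case by (rule tendsto_mult[OF tendsto_const tendsto_of_real])
      qed
      show "AE t in circ. norm ((cis t + z) / (cis t - z) * complex_of_real (Re (l n t))) \<le> 2 / (1 - norm z) * B" for n
      proof (rule AE_I2)
        fix t
        have "norm ((cis t + z) / (cis t - z)) * \<bar>Re (l n t)\<bar> \<le> 2 / (1 - norm z) * B"
          using herglotz_kernel_bound[OF z1, of t] order_trans[OF abs_Re_le_cmod lB, of n t] z1
          by (intro mult_mono) auto
        then show "norm ((cis t + z) / (cis t - z) * complex_of_real (Re (l n t))) \<le> 2 / (1 - norm z) * B"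
          by (simp only: norm_mult norm_of_real)
      qed
    qed simp
    then show "(\<lambda>n. L (of_real (radius n) * z)) \<longlonglongrightarrow> \<i> * Im (L 0) + herglotz u z"
      unfolding eq by (intro tendsto_intros)
  qed
  note Lz = this
  have *: "exp (L z) = exp (\<i> * Im (L 0)) * exp (herglotz u z)" if "z \<in> ball 0 1" for z
    unfolding exp_add[symmetric] by (rule arg_cong[where f=exp], rule Lz[OF that])
  show ?thesis
    by (rule outer_functionI[OF _ um u e *]) simp_all
qed

section \<open>Factorization of the extremal function\<close>

lemma one_minus_notin_nonpos:
  fixes w :: complex
  assumes "norm w < 1" shows "1 - w \<notin> \<real>\<^sub>\<le>\<^sub>0"
  using assms complex_Re_le_cmod[of w] by (auto simp: complex_nonpos_Reals_iff)

text \<open>The quotient \<open>(1 - (1 - w) powr s) / w\<close>, with the value \<open>s\<close> at \<open>0\<close>, has no zero: \<open>1 - w\<close> lies in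
  the right half-plane, so the argument of \<open>(1 - w) powr s\<close> is less than \<open>s * pi / 2 < pi\<close> in modulus,
  and the power is \<open>1\<close> only if \<open>w = 0\<close>. So the quotient has a logarithm on the disk.\<close>

lemma power_quotient_log:
  fixes s :: real
  assumes s: "0 < s" "s < 2"
  obtains l where "l holomorphic_on ball 0 1"
    "\<And>w. w \<in> ball 0 1 \<Longrightarrow> 1 - (1 - w) powr of_real s = w * exp (l w)"
proof -
  define f where "f = (\<lambda>w::complex. 1 - exp (of_real s * Ln (1 - w)))"
  have np: "1 - w \<notin> \<real>\<^sub>\<le>\<^sub>0" if "w \<in> ball 0 1" for w :: complex
    using that by (intro one_minus_notin_nonpos) auto
  have f_eq: "f w = 1 - (1 - w) powr of_real s" if "w \<in> ball 0 1" for w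
    using np[OF that] by (auto simp: f_def powr_def)
  have holf: "f holomorphic_on ball 0 1"
    unfolding f_def using np by (intro holomorphic_intros) auto
  have f0: "f 0 = 0" by (simp add: f_def)
  have df: "deriv f 0 = of_real s"
    by (rule DERIV_imp_deriv) (auto simp: f_def intro!: derivative_eq_intros)
  define \<Psi> where "\<Psi> = (\<lambda>w. if w = 0 then deriv f 0 else (f w - f 0) / (w - 0))"
  have hol: "\<Psi> holomorphic_on ball 0 1"
    unfolding \<Psi>_def by (rule pole_lemma_open[OF holf open_ball])
  have nz: "\<Psi> w \<noteq> 0" if w: "w \<in> ball 0 1" for w
  proof (cases "w = 0")
    case True
    then show ?thesis using s by (simp add: \<Psi>_def df)
  next
    case False
    have "f w \<noteq> 0"
    proof
      assume "f w = 0"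
      then have "exp (of_real s * Ln (1 - w)) = 1" by (simp add: f_def)
      then have re: "Re (of_real s * Ln (1 - w)) = 0" and "\<exists>n::int. Im (of_real s * Ln (1 - w)) = of_int (2 * n) * pi"
        by (auto simp: exp_eq_1)
      then obtain n :: int where n: "s * Im (Ln (1 - w)) = of_int (2 * n) * pi" by auto
      have "Re (1 - w) > 0" using w complex_Re_le_cmod[of w] by auto
      then have "\<bar>Im (Ln (1 - w))\<bar> < pi / 2" by (intro Re_Ln_pos_lt_imp) auto
      then have "s * \<bar>Im (Ln (1 - w))\<bar> < 2 * (pi / 2)" using s by (intro mult_strict_mono) auto
      then have "\<bar>of_int (2 * n) * pi\<bar> < pi" unfolding n[symmetric] abs_mult using s by simp
      then have "\<bar>real_of_int (2 * n)\<bar> < 1" by (simp add: abs_mult)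
      then have "n = 0" by linarith
      with n s have "Im (Ln (1 - w)) = 0" by simp
      moreover have "Re (Ln (1 - w)) = 0" using re s by simp
      ultimately have "Ln (1 - w) = 0" by (simp add: complex_eq_iff)
      then have "1 - w = 1" using np[OF w] by (metis exp_Ln exp_zero nonpos_Reals_zero_I)
      with False show False by simp
    qed
    then show ?thesis using False by (simp add: \<Psi>_def f0)
  qed
  obtain l where l: "l holomorphic_on ball 0 1" "\<And>w. w \<in> ball 0 1 \<Longrightarrow> exp (l w) = \<Psi> w"
    using holomorphic_logarithm_exists[OF convex_ball open_ball hol nz, of 0] by auto
  show ?thesis
  proof (rule that[OF l(1)])
    fix w :: complex assume w: "w \<in> ball 0 1"
    then have "1 - (1 - w) powr of_real s = f w" using f_eq by simp
    also have "\<dots> = w * exp (l w)" unfolding l(2)[OF w] by (simp add: \<Psi>_def f0)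
    finally show "1 - (1 - w) powr of_real s = w * exp (l w)" .
  qed
qed

text \<open>If \<open>\<bar>J 0\<bar> < 1\<close>, then \<open>cnj (J 0) * J\<close> stays in a compact subset of the open disk, so composing it
  with the logarithm of the quotient gives a bounded function, and radial limits carry over. If
  \<open>\<bar>J 0\<bar> = 1\<close>, then \<open>J\<close> is constant, the power is \<open>0 powr (2 / p) = 0\<close>, and \<open>exp L\<close> is the
  constant \<open>cnj (J 0) = 1 / J 0\<close>.\<close>

lemma extremal_factorization:
  assumes p: "1 < p" and J: "inner_function J" and J0: "J 0 \<noteq> 0"
  obtains L B where "L holomorphic_on ball 0 1" "\<And>z. z \<in> ball 0 1 \<Longrightarrow> norm (L z) \<le> B"
    "AE t in circ. \<exists>w. has_boundary_value L t w"
    "\<And>z. z \<in> ball 0 1 \<Longrightarrow> 1 - (1 - cnj (J 0) * J z) powr of_real (2 / p) = J z * exp (L z)"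
proof (cases "norm (J 0) = 1")
  case True
  have JJ: "cnj (J 0) * J 0 = 1" using True by (simp add: complex_norm_square[symmetric] mult.commute)
  show ?thesis
  proof (rule that[of "\<lambda>_. Ln (cnj (J 0))"])
    show "AE t in circ. \<exists>w. has_boundary_value (\<lambda>_. Ln (cnj (J 0))) t w"
      by (auto simp: has_boundary_value_def)
    fix z :: complex assume "z \<in> ball 0 1"
    then have "J z = J 0" by (rule inner_constant[OF J True])
    then show "1 - (1 - cnj (J 0) * J z) powr of_real (2 / p) = J z * exp (Ln (cnj (J 0)))"
      using JJ J0 by (simp add: mult.commute)
  qed auto
next
  case False
  then have a: "norm (J 0) < 1" using inner_norm_le_1[OF J, of 0] by simp
  have hJ: "J holomorphic_on ball 0 1" using J by (simp add: inner_function_def)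
  obtain l where l: "l holomorphic_on ball 0 1"
    "\<And>w. w \<in> ball 0 1 \<Longrightarrow> 1 - (1 - w) powr of_real (2 / p) = w * exp (l w)"
    using power_quotient_log[of "2 / p"] p by (auto simp: field_simps)
  define K where "K = (\<lambda>z. cnj (J 0) * J z)"
  have K: "norm (K z) \<le> norm (J 0)" if "z \<in> ball 0 1" for z
    unfolding K_def using inner_norm_le_1[OF J that] by (simp add: norm_mult mult_left_le)
  have "continuous_on (cball 0 (norm (J 0))) l"
    using holomorphic_on_imp_continuous_on[OF l(1)] by (rule continuous_on_subset) (use a in auto)
  then have "compact (l ` cball 0 (norm (J 0)))" by (intro compact_continuous_image) auto
  then obtain B where B: "\<And>w. w \<in> cball 0 (norm (J 0)) \<Longrightarrow> norm (l w) \<le> B"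
    by (metis (no_types) compact_imp_bounded bounded_iff imageI)
  show ?thesis
  proof (rule that[of "\<lambda>z. l (K z) + Ln (cnj (J 0))" "B + norm (Ln (cnj (J 0)))"])
    have "K holomorphic_on ball 0 1" unfolding K_def by (intro holomorphic_intros hJ)
    moreover have "K ` ball 0 1 \<subseteq> ball 0 1" using K a by fastforce
    ultimately have "(\<lambda>z. l (K z)) holomorphic_on ball 0 1"
      using holomorphic_on_compose_gen[OF _ l(1)] unfolding o_def by blast
    then show "(\<lambda>z. l (K z) + Ln (cnj (J 0))) holomorphic_on ball 0 1"
      by (intro holomorphic_intros)
    show "norm (l (K z) + Ln (cnj (J 0))) \<le> B + norm (Ln (cnj (J 0)))" if "z \<in> ball 0 1" for z
      using K[OF that] by (intro norm_triangle_mono B) auto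
    have "AE t in circ. \<exists>w. has_boundary_value J t w \<and> norm w = 1"
      unfolding AE_circ using J unfolding inner_function_def by blast
    then show "AE t in circ. \<exists>w. has_boundary_value (\<lambda>z. l (K z) + Ln (cnj (J 0))) t w"
    proof eventually_elim
      case (elim t)
      then obtain w where w: "has_boundary_value J t w" "norm w = 1" by blast
      have "cnj (J 0) * w \<in> ball 0 1" using w(2) a by (simp add: norm_mult)
      then have c: "isCont l (cnj (J 0) * w)"
        using holomorphic_on_imp_continuous_on[OF l(1)] continuous_on_eq_continuous_at[OF open_ball] by blast
      have "((\<lambda>r. K (of_real r * cis t)) \<longlongrightarrow> cnj (J 0) * w) (at_left (1::real))"
        using w(1) unfolding has_boundary_value_def K_def by (intro tendsto_intros)
      then have "((\<lambda>r. l (K (of_real r * cis t))) \<longlongrightarrow> l (cnj (J 0) * w)) (at_left (1::real))"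
        by (rule isCont_tendsto_compose[OF c])
      then have "has_boundary_value (\<lambda>z. l (K z) + Ln (cnj (J 0))) t (l (cnj (J 0) * w) + Ln (cnj (J 0)))"
        unfolding has_boundary_value_def by (intro tendsto_intros)
      then show ?case by blast
    qed
    fix z :: complex assume z: "z \<in> ball 0 1"
    have "K z \<in> ball 0 1" using K[OF z] a by simp
    from l(2)[OF this] show "1 - (1 - cnj (J 0) * J z) powr of_real (2 / p) = J z * exp (l (K z) + Ln (cnj (J 0)))"
      using J0 by (simp add: K_def exp_add mult_ac)
  qed
qed

section \<open>Hardy spaces and cyclicity of outer functions\<close>

lemma circle_integrable:
  fixes f :: "complex \<Rightarrow> 'a::{banach, second_countable_topology}"
  assumes "continuous_on (ball 0 1) f" "0 < r" "r < 1"
  shows "integrable circ (\<lambda>t. f (of_real r * cis t))"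
proof (rule integrable_circ_continuous, rule continuous_on_compose2[OF assms(1)])
  show "continuous_on UNIV (\<lambda>t. of_real r * cis t)" by (intro continuous_intros)
qed (use assms(2,3) in \<open>auto simp: norm_mult\<close>)

lemma continuous_on_norm_powr:
  assumes "0 < p" "continuous_on A f"
  shows "continuous_on A (\<lambda>x. norm (f x) powr p)"
  using assms by (intro continuous_on_powr' continuous_intros) auto

lemma hardy_spaceI:
  assumes "f holomorphic_on ball 0 1"
    "\<And>r. 0 < r \<Longrightarrow> r < 1 \<Longrightarrow> (LINT t|circ. norm (f (of_real r * cis t)) powr p) \<le> K"
  shows "f \<in> hardy_space p"
  unfolding hardy_space_def using assms circle_mean_eq[OF holomorphic_on_imp_continuous_on[OF assms(1)]]
  by (auto intro!: bdd_aboveI2[where M=K])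

text \<open>Membership in the Hardy space is what makes the supremum in the norm a genuine upper bound.\<close>

lemma hardy_mean_le:
  assumes f: "f \<in> hardy_space p" and p: "0 < p" and r: "0 < r" "r < 1"
  shows "(LINT t|circ. norm (f (of_real r * cis t)) powr p) \<le> hardy_norm p f powr p"
proof -
  have hol: "continuous_on (ball 0 1) f" and bdd: "bdd_above (circle_mean p f ` {0<..<1})"
    using f by (auto simp: hardy_space_def intro: holomorphic_on_imp_continuous_on)
  define S where "S = (SUP r\<in>{0<..<1}. circle_mean p f r)"
  have le: "circle_mean p f r \<le> S" unfolding S_def using r by (intro cSUP_upper bdd) auto
  have eq: "circle_mean p f r = (LINT t|circ. norm (f (of_real r * cis t)) powr p)"
    using r by (intro circle_mean_eq hol) auto
  have "0 \<le> circle_mean p f r" unfolding eq by (rule Bochner_Integration.integral_nonneg) simp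
  then have "hardy_norm p f powr p = S"
    using le p by (simp add: hardy_norm_def S_def[symmetric] powr_powr)
  then show ?thesis using le eq by simp
qed

lemma hardy_norm_le:
  assumes hol: "f holomorphic_on ball 0 1" and p: "0 < p"
    and M: "\<And>r. 0 < r \<Longrightarrow> r < 1 \<Longrightarrow> (LINT t|circ. norm (f (of_real r * cis t)) powr p) \<le> M"
  shows "hardy_norm p f \<le> M powr (1 / p)"
proof -
  note eq = circle_mean_eq[OF holomorphic_on_imp_continuous_on[OF hol]]
  have bdd: "bdd_above (circle_mean p f ` {0<..<1})"
    using eq M by (auto intro!: bdd_aboveI2[where M=M])
  have "0 \<le> circle_mean p f (1/2)" by (subst eq) (auto intro: Bochner_Integration.integral_nonneg)
  also have "\<dots> \<le> (SUP r\<in>{0<..<1}. circle_mean p f r)" by (intro cSUP_upper bdd) auto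
  finally have "0 \<le> (SUP r\<in>{0<..<1}. circle_mean p f r)" .
  moreover have "(SUP r\<in>{0<..<1}. circle_mean p f r) \<le> M"
    using eq M by (intro cSUP_least) auto
  ultimately show ?thesis unfolding hardy_norm_def using p by (intro powr_mono2) auto
qed

lemma hardy_norm_nonneg: "0 \<le> hardy_norm p f"
  by (simp add: hardy_norm_def)

lemma hardy_space_add:
  assumes f: "f \<in> hardy_space p" and g: "g \<in> hardy_space p" and p: "0 < p"
  shows "(\<lambda>z. f z + g z) \<in> hardy_space p"
proof (rule hardy_spaceI)
  have hf: "f holomorphic_on ball 0 1" and hg: "g holomorphic_on ball 0 1"
    using f g by (auto simp: hardy_space_def)
  then show "(\<lambda>z. f z + g z) holomorphic_on ball 0 1" by (intro holomorphic_intros)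
  fix r :: real assume r: "0 < r" "r < 1"
  let ?Z = "\<lambda>t. of_real r * cis t"
  note c = hf[THEN holomorphic_on_imp_continuous_on] hg[THEN holomorphic_on_imp_continuous_on]
  have i: "integrable circ (\<lambda>t. norm (f (?Z t) + g (?Z t)) powr p)"
    "integrable circ (\<lambda>t. norm (f (?Z t)) powr p)" "integrable circ (\<lambda>t. norm (g (?Z t)) powr p)"
    using r p by (auto intro!: circle_integrable[of "\<lambda>z. norm (f z + g z) powr p"]
        circle_integrable[of "\<lambda>z. norm (f z) powr p"] circle_integrable[of "\<lambda>z. norm (g z) powr p"]
        continuous_on_norm_powr continuous_intros c)
  have "(LINT t|circ. norm (f (?Z t) + g (?Z t)) powr p)
      \<le> (LINT t|circ. 2 powr p * (norm (f (?Z t)) powr p + norm (g (?Z t)) powr p))"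
    using i by (intro integral_mono norm_add_powr_le p) auto
  also have "\<dots> = 2 powr p * ((LINT t|circ. norm (f (?Z t)) powr p) + (LINT t|circ. norm (g (?Z t)) powr p))"
    using i by simp
  also have "\<dots> \<le> 2 powr p * (hardy_norm p f powr p + hardy_norm p g powr p)"
    using hardy_mean_le[OF f p r] hardy_mean_le[OF g p r] by (intro mult_left_mono add_mono) auto
  finally show "(LINT t|circ. norm (f (?Z t) + g (?Z t)) powr p)
      \<le> 2 powr p * (hardy_norm p f powr p + hardy_norm p g powr p)" .
qed

lemma hardy_space_bounded_mult:
  assumes f: "f \<in> hardy_space p" and p: "0 < p" and b: "b holomorphic_on ball 0 1"
    and B: "\<And>z. z \<in> ball 0 1 \<Longrightarrow> norm (b z) \<le> B"
  shows "(\<lambda>z. b z * f z) \<in> hardy_space p"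
proof (rule hardy_spaceI)
  have hf: "f holomorphic_on ball 0 1" using f by (auto simp: hardy_space_def)
  then show "(\<lambda>z. b z * f z) holomorphic_on ball 0 1" using b by (intro holomorphic_intros)
  fix r :: real assume r: "0 < r" "r < 1"
  let ?Z = "\<lambda>t. of_real r * cis t"
  note c = hf[THEN holomorphic_on_imp_continuous_on] b[THEN holomorphic_on_imp_continuous_on]
  have i: "integrable circ (\<lambda>t. norm (b (?Z t) * f (?Z t)) powr p)"
    "integrable circ (\<lambda>t. norm (f (?Z t)) powr p)"
    using r p by (auto intro!: circle_integrable[of "\<lambda>z. norm (b z * f z) powr p"]
        circle_integrable[of "\<lambda>z. norm (f z) powr p"] continuous_on_norm_powr continuous_intros c)
  have "(LINT t|circ. norm (b (?Z t) * f (?Z t)) powr p) \<le> (LINT t|circ. B powr p * norm (f (?Z t)) powr p)"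
  proof (rule integral_mono[OF i(1)])
    fix t
    have "norm (b (?Z t)) powr p \<le> B powr p"
      using r p by (intro powr_mono2 B circle_in_ball) auto
    then show "norm (b (?Z t) * f (?Z t)) powr p \<le> B powr p * norm (f (?Z t)) powr p"
      unfolding norm_mult by (simp add: powr_mult mult_right_mono)
  qed (use i in simp)
  also have "\<dots> \<le> B powr p * hardy_norm p f powr p"
    using hardy_mean_le[OF f p r] by (simp add: mult_left_mono)
  finally show "(LINT t|circ. norm (b (?Z t) * f (?Z t)) powr p) \<le> B powr p * hardy_norm p f powr p" .
qed

lemma hardy_space_one: "(\<lambda>z. 1) \<in> hardy_space p"
  by (rule hardy_spaceI[where K=1]) auto

lemma hardy_space_bounded:
  assumes "0 < p" "b holomorphic_on ball 0 1" "\<And>z. z \<in> ball 0 1 \<Longrightarrow> norm (b z) \<le> B"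
  shows "b \<in> hardy_space p"
  using hardy_space_bounded_mult[OF hardy_space_one assms] by simp

lemma hardy_space_diff:
  assumes f: "f \<in> hardy_space p" and g: "g \<in> hardy_space p" and p: "0 < p"
  shows "(\<lambda>z. f z - g z) \<in> hardy_space p"
  using hardy_space_add[OF f hardy_space_bounded_mult[OF g p, of "\<lambda>_. -1" 1] p] by simp

lemma poly_bounded_disk:
  fixes P :: "complex poly"
  obtains B where "B \<ge> 0" "\<And>z. z \<in> cball 0 1 \<Longrightarrow> norm (poly P z) \<le> B"
proof -
  have "compact (poly P ` cball 0 1)"
    by (intro compact_continuous_image continuous_intros) auto
  then have "bounded (poly P ` cball 0 1)" by (rule compact_imp_bounded)
  then obtain B where "\<forall>y\<in>poly P ` cball 0 1. norm y \<le> B" unfolding bounded_iff ..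
  then have B: "norm (poly P z) \<le> B" if "z \<in> cball 0 1" for z using that by simp
  have "norm (poly P 0) \<le> B" by (rule B) simp
  then have "B \<ge> 0" by (rule order_trans[OF norm_ge_zero])
  then show ?thesis using that B by blast
qed

lemma hardy_space_poly_mult:
  assumes "f \<in> hardy_space p" "0 < p"
  shows "(\<lambda>z. poly P z * f z) \<in> hardy_space p"
proof -
  obtain B where "\<And>z. z \<in> cball 0 1 \<Longrightarrow> norm (poly P z) \<le> B"
    using poly_bounded_disk by blast
  then show ?thesis
    by (intro hardy_space_bounded_mult[OF assms, of _ B] holomorphic_intros) auto
qed

lemma shift_span_eq: "shift_span f = {\<lambda>z. poly P z * f z | P. True}"
proof (intro equalityI subsetI)
  fix h assume "h \<in> shift_span f"
  then obtain n c where h: "h = (\<lambda>z. \<Sum>k<n. c k * (z ^ k * f z))" by (auto simp: shift_span_def)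
  have "h = (\<lambda>z. poly (\<Sum>k<n. monom (c k) k) z * f z)"
    by (simp add: h poly_sum poly_monom sum_distrib_left mult_ac)
  then show "h \<in> {\<lambda>z. poly P z * f z | P. True}" by blast
next
  fix h assume "h \<in> {\<lambda>z. poly P z * f z | P. True}"
  then obtain P where h: "h = (\<lambda>z. poly P z * f z)" by blast
  have "h = (\<lambda>z. \<Sum>k<Suc (degree P). coeff P k * (z ^ k * f z))"
    by (simp add: h poly_altdef sum_distrib_left mult_ac lessThan_Suc_atMost)
  then show "h \<in> shift_span f" unfolding shift_span_def by blast
qed

text \<open>With \<open>P0\<close> close to \<open>h\<close>, \<open>\<phi> * F\<close> close to \<open>1\<close> and \<open>P1\<close> uniformly close to \<open>\<phi>\<close>, the
  product \<open>P0 * P1 * F\<close> is close to \<open>h\<close>, because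
  \<open>h - P0 * P1 * F = (h - P0) + P0 * (1 - \<phi> * F) + P0 * (\<phi> - P1) * F\<close>.\<close>

lemma outer_approx_poly:
  assumes p: "1 < p" and F: "outer_function p F" and h: "h holomorphic_on ball 0 1"
    and hB: "\<And>z. z \<in> ball 0 1 \<Longrightarrow> norm (h z) \<le> B"
    and ae: "AE t in circ. \<exists>w. has_boundary_value h t w" and e: "0 < e"
  obtains P where "\<And>r. 0 < r \<Longrightarrow> r < 1 \<Longrightarrow>
      (LINT t|circ. norm (h (of_real r * cis t) - poly P (of_real r * cis t) * F (of_real r * cis t)) powr p) \<le> e"
proof -
  have p0: "0 < p" using p by simp
  define M where "M = (2::real) powr p"
  have M: "M > 0" by (simp add: M_def)
  have hF: "F holomorphic_on ball 0 1" by (rule outer_function_hardy[OF p0 F])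
  obtain K0 where K0: "\<And>r. r \<in> {0<..<1} \<Longrightarrow> (LINT t|circ. norm (F (of_real r * cis t)) powr p) \<le> K0"
    using outer_function_hardy(2)[OF p0 F] by blast
  define K where "K = max K0 1"
  have K: "K > 0" "\<And>r. 0 < r \<Longrightarrow> r < 1 \<Longrightarrow> (LINT t|circ. norm (F (of_real r * cis t)) powr p) \<le> K"
    using K0 by (auto simp: K_def max_def) (meson greaterThanLessThan_iff order_trans)
  obtain P0 where P0: "\<And>r. 0 < r \<Longrightarrow> r < 1 \<Longrightarrow>
      (LINT t|circ. norm (h (of_real r * cis t) - poly P0 (of_real r * cis t)) powr p) \<le> e / (3 * M)"
    using bounded_radial_approx_poly[OF p0 h hB ae, of "e / (3 * M)"] e M by auto
  obtain B0 where B0: "B0 \<ge> 0" "\<And>z. z \<in> cball 0 1 \<Longrightarrow> norm (poly P0 z) \<le> B0"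
    using poly_bounded_disk[of P0] by blast
  define N where "N = B0 powr p + 1"
  have N: "N > 0" by (simp add: N_def add_nonneg_pos)
  obtain \<phi> where \<phi>: "\<phi> holomorphic_on UNIV" "\<And>r. 0 < r \<Longrightarrow> r < 1 \<Longrightarrow>
       (LINT t|circ. norm (\<phi> (of_real r * cis t) * F (of_real r * cis t) - 1) powr p) \<le> e / (3 * M * M * N)"
    using outer_function_almost_invertible[OF p F, of "e / (3 * M * M * N)"] e M N by auto
  define d where "d = e / (3 * M * M * N * K)"
  have d: "d > 0" using e M N K by (simp add: d_def)
  obtain P1 where P1: "\<And>z. z \<in> cball 0 1 \<Longrightarrow> norm (\<phi> z - poly P1 z) < d powr (1 / p)"
    using holomorphic_approx_poly[of \<phi> 2 "d powr (1 / p)"] holomorphic_on_subset[OF \<phi>(1)] d by auto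
  show ?thesis
  proof (rule that[of "P0 * P1"])
    fix r :: real assume r: "0 < r" "r < 1"
    let ?Z = "\<lambda>t. of_real r * cis t"
    have Z: "?Z t \<in> cball 0 1" for t using circle_in_ball[of r t] r by auto
    let ?T1 = "\<lambda>z. norm (h z - poly P0 z) powr p"
    let ?T2 = "\<lambda>z. norm (\<phi> z * F z - 1) powr p"
    let ?T3 = "\<lambda>z. norm (F z) powr p"
    let ?T = "\<lambda>z. norm (h z - poly (P0 * P1) z * F z) powr p"
    have c\<phi>: "continuous_on (ball 0 1) \<phi>"
      using holomorphic_on_imp_continuous_on[OF \<phi>(1)] by (rule continuous_on_subset) simp
    note c = holomorphic_on_imp_continuous_on[OF h] holomorphic_on_imp_continuous_on[OF hF] c\<phi>
    have i: "integrable circ (\<lambda>t. ?T1 (?Z t))" "integrable circ (\<lambda>t. ?T2 (?Z t))"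
      "integrable circ (\<lambda>t. ?T3 (?Z t))" "integrable circ (\<lambda>t. ?T (?Z t))"
      by (rule circle_integrable[OF _ r]; intro continuous_on_norm_powr p0 continuous_intros c)+
    have pt: "?T z \<le> M * (?T1 z + M * (N * ?T2 z + N * d * ?T3 z))" if z: "z \<in> cball 0 1" for z
    proof -
      have b0: "norm (poly P0 z) powr p \<le> N"
        using powr_mono2[of p "norm (poly P0 z)" B0] B0(2)[OF z] p0 by (simp add: N_def)
      have "norm (poly P0 z * (\<phi> z * F z - 1)) powr p \<le> N * ?T2 z"
        unfolding norm_mult[of "poly P0 z"] using b0 by (simp add: powr_mult mult_right_mono)
      then have 1: "norm (poly P0 z * (1 - \<phi> z * F z)) powr p \<le> N * ?T2 z"
        by (simp add: norm_mult norm_minus_commute)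
      have "norm (\<phi> z - poly P1 z) powr p \<le> (d powr (1 / p)) powr p"
        using P1[OF z] p0 by (intro powr_mono2) auto
      then have "norm (\<phi> z - poly P1 z) powr p \<le> d" using d p0 by (simp add: powr_powr)
      then have "norm (poly P0 z) powr p * norm (\<phi> z - poly P1 z) powr p \<le> N * d"
        using b0 N by (intro mult_mono) auto
      then have 2: "norm (poly P0 z * (\<phi> z - poly P1 z) * F z) powr p \<le> N * d * ?T3 z"
        by (simp add: norm_mult powr_mult mult_right_mono)
      have "h z - poly (P0 * P1) z * F z = (h z - poly P0 z) +
          (poly P0 z * (1 - \<phi> z * F z) + poly P0 z * (\<phi> z - poly P1 z) * F z)"
        by (simp add: algebra_simps)
      then have "?T z \<le> M * (?T1 z + norm (poly P0 z * (1 - \<phi> z * F z) + poly P0 z * (\<phi> z - poly P1 z) * F z) powr p)"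
        unfolding M_def by (simp only: norm_add_powr_le[OF p0])
      also have "norm (poly P0 z * (1 - \<phi> z * F z) + poly P0 z * (\<phi> z - poly P1 z) * F z) powr p
          \<le> M * (norm (poly P0 z * (1 - \<phi> z * F z)) powr p + norm (poly P0 z * (\<phi> z - poly P1 z) * F z) powr p)"
        unfolding M_def by (rule norm_add_powr_le[OF p0])
      also have "\<dots> \<le> M * (N * ?T2 z + N * d * ?T3 z)"
        using 1 2 M by (intro mult_left_mono add_mono) auto
      finally show ?thesis using M by simp
    qed
    have "(LINT t|circ. ?T (?Z t)) \<le> (LINT t|circ. M * (?T1 (?Z t) + M * (N * ?T2 (?Z t) + N * d * ?T3 (?Z t))))"
      using i by (intro integral_mono pt Z) auto
    also have "\<dots> = M * ((LINT t|circ. ?T1 (?Z t)) + M * (N * (LINT t|circ. ?T2 (?Z t)) + N * d * (LINT t|circ. ?T3 (?Z t))))"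
      using i by simp
    also have "\<dots> \<le> M * (e / (3 * M) + M * (N * (e / (3 * M * M * N)) + N * d * K))"
      using P0[OF r] \<phi>(2)[OF r] K(2)[OF r] M N d by (intro mult_left_mono add_mono) auto
    also have "\<dots> = e" using M N K by (simp add: d_def field_simps)
    finally show "(LINT t|circ. ?T (?Z t)) \<le> e" .
  qed
qed

text \<open>Cauchy's formula bounds \<open>\<bar>b z\<bar>\<close> by means of \<open>\<bar>b\<bar>\<close>, which are controlled by the \<open>p\<close>-means.\<close>

lemma vanishing_mean_imp_zero:
  assumes p: "1 < p" and b: "b holomorphic_on ball 0 1"
    and lim: "(\<lambda>n. LINT t|circ. norm (b (of_real (radius n) * cis t)) powr p) \<longlonglongrightarrow> 0"
    and z: "z \<in> ball 0 1"
  shows "b z = 0"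
proof -
  let ?m = "\<lambda>n. LINT t|circ. norm (b (of_real (radius n) * cis t)) powr p"
  have z1: "norm z < 1" using z by simp
  have bc: "continuous_on (ball 0 1) b" using b by (rule holomorphic_on_imp_continuous_on)
  have "norm (b z) \<le> \<eta> * (1 / (1 - norm z))" if \<eta>: "0 < \<eta>" for \<eta>
  proof -
    obtain C where C: "C \<ge> 0" "\<And>x. x \<ge> 0 \<Longrightarrow> x \<le> \<eta> + C * x powr p"
      using le_powr_plus[OF p \<eta>] by blast
    show ?thesis
    proof (rule LIMSEQ_le_const)
      show "(\<lambda>n. (\<eta> + C * ?m n) * (radius n / (radius n - norm z))) \<longlonglongrightarrow> \<eta> * (1 / (1 - norm z))"
        using z1 by (auto intro!: tendsto_eq_intros lim radius_tendsto)
      have "eventually (\<lambda>n. norm z < radius n) sequentially"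
        by (rule order_tendstoD(1)[OF radius_tendsto z1])
      then obtain N where N: "\<And>n. n \<ge> N \<Longrightarrow> norm z < radius n" by (auto simp: eventually_sequentially)
      show "\<exists>N. \<forall>n\<ge>N. norm (b z) \<le> (\<eta> + C * ?m n) * (radius n / (radius n - norm z))"
      proof (intro exI[of _ N] allI impI)
        fix n assume "n \<ge> N"
        define r where "r = radius n"
        have r: "norm z < r" "0 < r" "r < 1" using N[OF \<open>n \<ge> N\<close>] radius_bounds[of n] by (auto simp: r_def)
        have i: "integrable circ (\<lambda>t. norm (b (of_real r * cis t)) powr p)"
          using p by (intro circle_integrable r continuous_on_norm_powr bc) auto
        have "norm (b z) = norm (LINT t|circ. b (of_real r * cis t) * (of_real r * cis t) / (of_real r * cis t - z))"
          using r by (subst cauchy_mean[OF holomorphic_on_subset[OF b] r(2,1)]) auto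
        also have "\<dots> \<le> (LINT t|circ. (\<eta> + C * norm (b (of_real r * cis t)) powr p) * (r / (r - norm z)))"
        proof (rule Bochner_Integration.integral_norm_bound_integral)
          have nz: "r - norm z \<le> norm (of_real r * cis t - z)" for t
            using norm_triangle_ineq2[of "of_real r * cis t" z] r by (simp add: norm_mult)
          then have nz': "of_real r * cis t - z \<noteq> 0" for t
            using r by (metis diff_gt_0_iff_gt norm_zero not_le)
          have "continuous_on UNIV (\<lambda>t. b (of_real r * cis t))"
            using r by (intro circle_continuous bc) auto
          then show "integrable circ (\<lambda>t. b (of_real r * cis t) * (of_real r * cis t) / (of_real r * cis t - z))"
            using nz' by (intro integrable_circ_continuous continuous_intros) auto
          show "integrable circ (\<lambda>t. (\<eta> + C * norm (b (of_real r * cis t)) powr p) * (r / (r - norm z)))"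
            using i by simp
          fix t
          have "r / norm (of_real r * cis t - z) \<le> r / (r - norm z)"
            using nz[of t] r by (intro divide_left_mono mult_pos_pos) auto
          then have "norm (b (of_real r * cis t)) * (r / norm (of_real r * cis t - z))
              \<le> (\<eta> + C * norm (b (of_real r * cis t)) powr p) * (r / (r - norm z))"
            using C(2)[of "norm (b (of_real r * cis t))"] r \<eta> C(1)
            by (intro mult_mono) auto
          then show "norm (b (of_real r * cis t) * (of_real r * cis t) / (of_real r * cis t - z))
              \<le> (\<eta> + C * norm (b (of_real r * cis t)) powr p) * (r / (r - norm z))"
            using r by (simp add: norm_mult norm_divide)
        qed
        also have "\<dots> = (\<eta> + C * ?m n) * (radius n / (radius n - norm z))"
          using i unfolding r_def by simp
        finally show "norm (b z) \<le> (\<eta> + C * ?m n) * (radius n / (radius n - norm z))" .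
      qed
    qed
  qed
  note le = this
  show ?thesis
  proof (rule ccontr)
    assume "b z \<noteq> 0"
    define q where "q = 1 - norm z"
    have q: "q > 0" using z1 by (simp add: q_def)
    with \<open>b z \<noteq> 0\<close> have "0 < norm (b z) * q / 2" by simp
    from le[OF this] have "norm (b z) \<le> norm (b z) / 2" using q by (simp add: q_def[symmetric])
    with \<open>b z \<noteq> 0\<close> show False by simp
  qed
qed

section \<open>Duality and the metric projection\<close>

lemma norm_powr_of_real:
  fixes w :: complex
  shows "norm (w powr of_real s) = norm w powr s"
  by (cases "w = 0") (auto simp: powr_def norm_exp_eq_Re)

text \<open>On the circle \<open>J * cnj (1 - cnj (J 0) * J) = J - J 0\<close>, and \<open>(J - J 0) * h * W\<close> vanishes at \<open>0\<close>.
  On a smaller circle this leaves the error \<open>J 0 * h * W * (1 - \<bar>J\<bar>\<^sup>2)\<close>, whose mean tends to \<open>0\<close>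
  since \<open>\<bar>J\<bar>\<^sup>2\<close> tends to \<open>1\<close> in mean and \<open>h\<close> has bounded \<open>p\<close>-means.\<close>

lemma inner_conj_mean:
  assumes p: "1 < p" and J: "inner_function J" and h: "h \<in> hardy_space p"
    and W: "W holomorphic_on ball 0 1" and B: "\<And>z. z \<in> ball 0 1 \<Longrightarrow> norm (W z) \<le> B"
  shows "(\<lambda>n. LINT t|circ. (\<lambda>z. J z * h z * (cnj (1 - cnj (J 0) * J z) * W z)) (of_real (radius n) * cis t)) \<longlonglongrightarrow> 0"
    (is "(\<lambda>n. LINT t|circ. ?k (of_real (radius n) * cis t)) \<longlonglongrightarrow> 0")
proof (rule LIMSEQ_I)
  fix e :: real assume e: "0 < e"
  have hJ: "J holomorphic_on ball 0 1" using J by (simp add: inner_function_def)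
  have hh: "h holomorphic_on ball 0 1" using h by (simp add: hardy_space_def)
  note c = hJ[THEN holomorphic_on_imp_continuous_on] hh[THEN holomorphic_on_imp_continuous_on]
    W[THEN holomorphic_on_imp_continuous_on]
  define B' where "B' = max B 1"
  have B': "B' > 0" "\<And>z. z \<in> ball 0 1 \<Longrightarrow> norm (W z) \<le> B'"
    using B by (auto simp: B'_def le_max_iff_disj)
  define H where "H = hardy_norm p h powr p + 1"
  have H: "H > 0" by (simp add: H_def add_nonneg_pos)
  obtain C where C: "C \<ge> 0"
    "\<And>x s. x \<ge> 0 \<Longrightarrow> 0 \<le> s \<Longrightarrow> s \<le> 1 \<Longrightarrow> x * s \<le> e / (2 * B' * H) * x powr p + C * s"
    using mult_le_powr_plus[OF p, of "e / (2 * B' * H)"] e B' H by auto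
  let ?q = "\<lambda>n. 1 - (LINT t|circ. (norm (J (of_real (radius n) * cis t)))\<^sup>2)"
  have "(\<lambda>n. B' * (C * ?q n)) \<longlonglongrightarrow> B' * (C * (1 - 1))"
    by (intro tendsto_intros inner_mean_power J)
  then have "(\<lambda>n. B' * (C * ?q n)) \<longlonglongrightarrow> 0" by simp
  from order_tendstoD(2)[OF this, of "e / 2"] e
  obtain N where N: "\<And>n. n \<ge> N \<Longrightarrow> B' * (C * ?q n) < e / 2" by (auto simp: eventually_sequentially)
  show "\<exists>N. \<forall>n\<ge>N. norm ((LINT t|circ. ?k (of_real (radius n) * cis t)) - 0) < e"
  proof (intro exI[of _ N] allI impI)
    fix n assume n: "n \<ge> N"
    define r where "r = radius n"
    have r: "0 < r" "r < 1" using radius_bounds[of n] by (auto simp: r_def)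
    let ?Z = "\<lambda>t. of_real r * cis t"
    have Z: "?Z t \<in> ball 0 1" for t using circle_in_ball[of r t] r by auto
    let ?s = "\<lambda>z. 1 - (norm (J z))\<^sup>2"
    have i: "integrable circ (\<lambda>t. (\<lambda>z. J z * h z * W z) (?Z t))"
      "integrable circ (\<lambda>t. (\<lambda>z. h z * W z) (?Z t))"
      "integrable circ (\<lambda>t. (\<lambda>z. h z * W z * of_real (?s z)) (?Z t))"
      "integrable circ (\<lambda>t. (\<lambda>z. (norm (J z))\<^sup>2) (?Z t))"
      "integrable circ (\<lambda>t. (\<lambda>z. norm (h z) powr p) (?Z t))"
      using p by (rule_tac circle_integrable[OF _ r]; intro continuous_intros continuous_on_norm_powr c; simp)+
    have k_eq: "?k z = J z * h z * W z - J 0 * (h z * W z) + J 0 * (h z * W z * of_real (?s z))" for z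
    proof -
      have "J z * cnj (J z) = of_real ((norm (J z))\<^sup>2)" by (rule complex_norm_square[symmetric])
      then have "J z * h z * (cnj (1 - cnj (J 0) * J z) * W z) = J z * h z * W z - J 0 * (h z * W z) * of_real ((norm (J z))\<^sup>2)"
        by (simp add: algebra_simps)
      then show ?thesis by (simp add: algebra_simps)
    qed
    have "(LINT t|circ. ?k (?Z t)) = (LINT t|circ. J (?Z t) * h (?Z t) * W (?Z t))
        - J 0 * (LINT t|circ. h (?Z t) * W (?Z t)) + J 0 * (LINT t|circ. h (?Z t) * W (?Z t) * of_real (?s (?Z t)))"
      unfolding k_eq using i(1-3) by simp
    also have "(LINT t|circ. J (?Z t) * h (?Z t) * W (?Z t)) = J 0 * h 0 * W 0"
      by (rule mean_value_disk[OF _ r]) (intro holomorphic_intros hJ hh W)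
    also have "(LINT t|circ. h (?Z t) * W (?Z t)) = h 0 * W 0"
      by (rule mean_value_disk[OF _ r]) (intro holomorphic_intros hh W)
    finally have eq: "(LINT t|circ. ?k (?Z t)) = J 0 * (LINT t|circ. h (?Z t) * W (?Z t) * of_real (?s (?Z t)))"
      by simp
    have "norm (LINT t|circ. ?k (?Z t)) \<le> 1 * norm (LINT t|circ. h (?Z t) * W (?Z t) * of_real (?s (?Z t)))"
      unfolding eq norm_mult using inner_norm_le_1[OF J, of 0] by (intro mult_right_mono) auto
    also have "norm (LINT t|circ. h (?Z t) * W (?Z t) * of_real (?s (?Z t)))
        \<le> (LINT t|circ. B' * (e / (2 * B' * H) * norm (h (?Z t)) powr p + C * ?s (?Z t)))"
    proof (rule Bochner_Integration.integral_norm_bound_integral[OF i(3)])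
      show "integrable circ (\<lambda>t. B' * (e / (2 * B' * H) * norm (h (?Z t)) powr p + C * ?s (?Z t)))"
        using i(4,5) by simp
      fix t
      have s: "0 \<le> ?s (?Z t)" "?s (?Z t) \<le> 1"
        using inner_norm_le_1[OF J Z[of t]] by (auto simp: power_le_one)
      have "norm (h (?Z t) * W (?Z t) * of_real (?s (?Z t))) = norm (W (?Z t)) * (norm (h (?Z t)) * ?s (?Z t))"
        using s by (simp only: norm_mult norm_of_real) (simp add: abs_of_nonneg mult_ac)
      also have "\<dots> \<le> B' * (e / (2 * B' * H) * norm (h (?Z t)) powr p + C * ?s (?Z t))"
        using B'(2)[OF Z[of t]] C(2)[OF _ s, of "norm (h (?Z t))"] B' s by (intro mult_mono) auto
      finally show "norm (h (?Z t) * W (?Z t) * of_real (?s (?Z t)))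
          \<le> B' * (e / (2 * B' * H) * norm (h (?Z t)) powr p + C * ?s (?Z t))" .
    qed
    also have "\<dots> = B' * (e / (2 * B' * H) * (LINT t|circ. norm (h (?Z t)) powr p) + C * ?q n)"
      using i(4,5) by (simp add: r_def)
    also have "\<dots> \<le> B' * (e / (2 * B' * H) * H + C * ?q n)"
    proof -
      have "(LINT t|circ. norm (h (?Z t)) powr p) \<le> H"
        using hardy_mean_le[OF h _ r] p by (simp add: H_def)
      then show ?thesis using B' e H by (intro mult_left_mono add_right_mono) auto
    qed
    also have "\<dots> = e / 2 + B' * (C * ?q n)"
      using B' H by (simp add: distrib_left)
    also have "\<dots> < e" using N[OF n] by simp
    finally show "norm ((LINT t|circ. ?k (of_real (radius n) * cis t)) - 0) < e" by (simp add: r_def)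
  qed
qed

text \<open>Since \<open>k\<close> is bounded, replacing \<open>b\<close> by a nearby \<open>g\<close> changes the means against \<open>k\<close> by at most
  a multiple of the mean of \<open>\<bar>b - g\<bar>\<close>, uniformly in the radius.\<close>

lemma closure_orthogonal:
  assumes p: "1 < p" and b: "b \<in> hardy_space p"
    and k: "continuous_on (ball 0 1) k" and K: "\<And>z. z \<in> ball 0 1 \<Longrightarrow> norm (k z) \<le> K"
    and approx: "\<And>e. 0 < e \<Longrightarrow> \<exists>g\<in>hardy_space p. hardy_norm p (\<lambda>z. b z - g z) < e \<and>
        (\<lambda>n. LINT t|circ. (\<lambda>z. g z * k z) (of_real (radius n) * cis t)) \<longlonglongrightarrow> 0"
  shows "(\<lambda>n. LINT t|circ. (\<lambda>z. b z * k z) (of_real (radius n) * cis t)) \<longlonglongrightarrow> 0"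
proof (rule LIMSEQ_I)
  fix e :: real assume e: "0 < e"
  have hb: "b holomorphic_on ball 0 1" using b by (simp add: hardy_space_def)
  define K' where "K' = max K 1"
  have K': "K' > 0" "\<And>z. z \<in> ball 0 1 \<Longrightarrow> norm (k z) \<le> K'"
    using K by (auto simp: K'_def le_max_iff_disj)
  define \<eta> where "\<eta> = e / (4 * K')"
  have \<eta>: "0 < \<eta>" using e K' by (simp add: \<eta>_def)
  obtain C where C: "C \<ge> 0" "\<And>x. x \<ge> 0 \<Longrightarrow> x \<le> \<eta> + C * x powr p"
    using le_powr_plus[OF p \<eta>] by blast
  define d where "d = (\<eta> / (C + 1)) powr (1 / p)"
  have d: "0 < d" "d powr p = \<eta> / (C + 1)" using \<eta> C p by (auto simp: d_def powr_powr)
  obtain g where g: "g \<in> hardy_space p" "hardy_norm p (\<lambda>z. b z - g z) < d"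
    and lim: "(\<lambda>n. LINT t|circ. (\<lambda>z. g z * k z) (of_real (radius n) * cis t)) \<longlonglongrightarrow> 0"
    using approx[OF d(1)] by blast
  have hg: "g holomorphic_on ball 0 1" using g by (simp add: hardy_space_def)
  note c = hb[THEN holomorphic_on_imp_continuous_on] hg[THEN holomorphic_on_imp_continuous_on] k
  from LIMSEQ_D[OF lim, of "e / 2"] e
  obtain N where N: "\<And>n. n \<ge> N \<Longrightarrow> norm (LINT t|circ. (\<lambda>z. g z * k z) (of_real (radius n) * cis t)) < e / 2" by auto
  show "\<exists>N. \<forall>n\<ge>N. norm ((LINT t|circ. (\<lambda>z. b z * k z) (of_real (radius n) * cis t)) - 0) < e"
  proof (intro exI[of _ N] allI impI)
    fix n assume n: "n \<ge> N"
    define r where "r = radius n"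
    have r: "0 < r" "r < 1" using radius_bounds[of n] by (auto simp: r_def)
    let ?Z = "\<lambda>t. of_real r * cis t"
    have Z: "?Z t \<in> ball 0 1" for t using circle_in_ball[of r t] r by auto
    have i: "integrable circ (\<lambda>t. (\<lambda>z. g z * k z) (?Z t))"
      "integrable circ (\<lambda>t. (\<lambda>z. (b z - g z) * k z) (?Z t))"
      "integrable circ (\<lambda>t. (\<lambda>z. norm (b z - g z) powr p) (?Z t))"
      using p by (rule_tac circle_integrable[OF _ r]; intro continuous_intros continuous_on_norm_powr c; simp)+
    have mean: "(LINT t|circ. norm (b (?Z t) - g (?Z t)) powr p) \<le> \<eta> / (C + 1)"
    proof -
      have "(LINT t|circ. norm (b (?Z t) - g (?Z t)) powr p) \<le> hardy_norm p (\<lambda>z. b z - g z) powr p"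
        using hardy_mean_le[OF hardy_space_diff[OF b g(1)] _ r] p by simp
      also have "\<dots> \<le> d powr p" using g(2) p hardy_norm_nonneg by (intro powr_mono2) auto
      finally show ?thesis using d by simp
    qed
    have "norm (LINT t|circ. (b (?Z t) - g (?Z t)) * k (?Z t))
        \<le> (LINT t|circ. (\<eta> + C * norm (b (?Z t) - g (?Z t)) powr p) * K')"
    proof (rule Bochner_Integration.integral_norm_bound_integral[OF i(2)])
      show "integrable circ (\<lambda>t. (\<eta> + C * norm (b (?Z t) - g (?Z t)) powr p) * K')" using i(3) by simp
      show "norm ((b (?Z t) - g (?Z t)) * k (?Z t)) \<le> (\<eta> + C * norm (b (?Z t) - g (?Z t)) powr p) * K'" for t
        unfolding norm_mult using C \<eta> K'(2)[OF Z[of t]] by (intro mult_mono) auto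
    qed
    also have "\<dots> = (\<eta> + C * (LINT t|circ. norm (b (?Z t) - g (?Z t)) powr p)) * K'"
      using i(3) by simp
    also have "\<dots> \<le> (\<eta> + \<eta>) * K'"
    proof (intro mult_right_mono add_left_mono)
      have "C * (LINT t|circ. norm (b (?Z t) - g (?Z t)) powr p) \<le> C * (\<eta> / (C + 1))"
        using mean C by (intro mult_left_mono) auto
      also have "\<dots> \<le> \<eta>" using C \<eta> by (simp add: field_simps)
      finally show "C * (LINT t|circ. norm (b (?Z t) - g (?Z t)) powr p) \<le> \<eta>" .
    qed (use K' in simp)
    also have "\<dots> = e / 2" using K' by (simp add: \<eta>_def)
    finally have 1: "norm (LINT t|circ. (b (?Z t) - g (?Z t)) * k (?Z t)) \<le> e / 2" .
    have "(LINT t|circ. b (?Z t) * k (?Z t)) = (LINT t|circ. g (?Z t) * k (?Z t) + (b (?Z t) - g (?Z t)) * k (?Z t))"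
      by (simp add: algebra_simps)
    also have "\<dots> = (LINT t|circ. g (?Z t) * k (?Z t)) + (LINT t|circ. (b (?Z t) - g (?Z t)) * k (?Z t))"
      using i(1,2) by simp
    finally have split: "(LINT t|circ. b (?Z t) * k (?Z t))
        = (LINT t|circ. g (?Z t) * k (?Z t)) + (LINT t|circ. (b (?Z t) - g (?Z t)) * k (?Z t))" .
    have "norm (LINT t|circ. b (?Z t) * k (?Z t)) \<le> norm (LINT t|circ. g (?Z t) * k (?Z t)) + e / 2"
      unfolding split by (rule order_trans[OF norm_triangle_ineq add_left_mono[OF 1]])
    also have "\<dots> < e" using N[OF n] by (simp add: r_def)
    finally show "norm ((LINT t|circ. (\<lambda>z. b z * k z) (of_real (radius n) * cis t)) - 0) < e" by (simp add: r_def)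
  qed
qed

text \<open>Integrating the supporting line inequality over the circles gives \<open>m \<le> M\<close>, since the linear term
  disappears in the limit. If \<open>M \<le> m\<close>, the mean gap tends to \<open>0\<close>, and by uniform convexity so do the
  \<open>p\<close>-means of \<open>b\<close>.\<close>

lemma convexity_duality:
  assumes p: "1 < p" and a: "continuous_on (ball 0 1) a" and k: "continuous_on (ball 0 1) k"
    and dual: "\<And>z. z \<in> ball 0 1 \<Longrightarrow> k z * a z = of_real (norm (a z) powr p)"
    and dual0: "\<And>z. z \<in> ball 0 1 \<Longrightarrow> a z = 0 \<Longrightarrow> k z = 0"
    and mean: "(\<lambda>n. LINT t|circ. (\<lambda>z. norm (a z) powr p) (of_real (radius n) * cis t)) \<longlonglongrightarrow> m"
    and b: "b holomorphic_on ball 0 1"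
    and orth: "(\<lambda>n. LINT t|circ. (\<lambda>z. b z * k z) (of_real (radius n) * cis t)) \<longlonglongrightarrow> 0"
    and M: "\<And>r. 0 < r \<Longrightarrow> r < 1 \<Longrightarrow> (LINT t|circ. norm (a (of_real r * cis t) + b (of_real r * cis t)) powr p) \<le> M"
  shows "m \<le> M" and "\<And>z. M \<le> m \<Longrightarrow> z \<in> ball 0 1 \<Longrightarrow> b z = 0"
proof -
  let ?Z = "\<lambda>n t. of_real (radius n) * cis t"
  let ?a = "\<lambda>n. LINT t|circ. norm (a (?Z n t)) powr p"
  let ?b = "\<lambda>n. LINT t|circ. norm (b (?Z n t)) powr p"
  let ?s = "\<lambda>n. LINT t|circ. norm (a (?Z n t) + b (?Z n t)) powr p"
  let ?o = "\<lambda>n. LINT t|circ. b (?Z n t) * k (?Z n t)"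
  have Z: "?Z n t \<in> ball 0 1" for n t using circle_in_ball radius_bounds[of n] by (auto simp: less_imp_le)
  note c = a k holomorphic_on_imp_continuous_on[OF b]
  have i: "integrable circ (\<lambda>t. (\<lambda>z. norm (a z) powr p) (?Z n t))"
    "integrable circ (\<lambda>t. (\<lambda>z. norm (b z) powr p) (?Z n t))"
    "integrable circ (\<lambda>t. (\<lambda>z. norm (a z + b z) powr p) (?Z n t))"
    "integrable circ (\<lambda>t. (\<lambda>z. b z * k z) (?Z n t))" for n
    using p by (rule_tac circle_integrable[OF _ radius_bounds]; intro continuous_intros continuous_on_norm_powr c; simp)+
  have iR: "integrable circ (\<lambda>t. Re (b (?Z n t) * k (?Z n t)))"
    "(LINT t|circ. Re (b (?Z n t) * k (?Z n t))) = Re (?o n)" for n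
    using integrable_Re[OF i(4)] integral_Re[OF i(4)] by blast+
  have sM: "?s n \<le> M" for n using M radius_bounds by blast
  have Re0: "(\<lambda>n. Re (?o n)) \<longlonglongrightarrow> 0" using tendsto_Re[OF orth] by simp
  have "0 \<le> M - ?a n - p * Re (?o n)" for n
  proof -
    have "0 \<le> (LINT t|circ. norm (a (?Z n t) + b (?Z n t)) powr p - norm (a (?Z n t)) powr p - p * Re (b (?Z n t) * k (?Z n t)))"
      by (intro Bochner_Integration.integral_nonneg powr_supporting_line p dual dual0 Z)
    also have "\<dots> = ?s n - ?a n - p * Re (?o n)"
      using i iR by simp
    finally show ?thesis using sM[of n] by simp
  qed
  moreover have "(\<lambda>n. M - ?a n - p * Re (?o n)) \<longlonglongrightarrow> M - m - p * 0"
    by (intro tendsto_intros mean Re0)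
  ultimately have "0 \<le> M - m - p * 0" by (intro LIMSEQ_le_const) auto
  then show "m \<le> M" by simp
  fix z :: complex assume Mm: "M \<le> m" and z: "z \<in> ball 0 1"
  have "?b \<longlonglongrightarrow> 0"
  proof (rule LIMSEQ_I)
    fix e :: real assume e: "0 < e"
    define d where "d = e / (2 * (\<bar>m\<bar> + 1))"
    have d: "0 < d" "d * m < e"
    proof -
      show "0 < d" using e by (simp add: d_def)
      have "d * m \<le> d * (\<bar>m\<bar> + 1)" using \<open>0 < d\<close> by (intro mult_left_mono) auto
      also have "\<dots> = e / 2"
      proof -
        have "0 < \<bar>m\<bar> + 1" by (rule add_nonneg_pos) simp_all
        then have "0 < 2 * (\<bar>m\<bar> + 1)" by (rule mult_pos_pos[OF zero_less_numeral])
        then have q: "2 * (\<bar>m\<bar> + 1) \<noteq> 0" by (rule less_imp_neq[THEN not_sym])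
        have "d * (2 * (\<bar>m\<bar> + 1)) = e"
          unfolding d_def by (rule iffD1[OF nonzero_eq_divide_eq[OF q] refl])
        then show ?thesis by (simp add: algebra_simps)
      qed
      finally show "d * m < e" using e by simp
    qed
    obtain C where C: "C \<ge> 1"
      "\<And>a b k::complex. k * a = of_real (norm a powr p) \<Longrightarrow> (a = 0 \<Longrightarrow> k = 0) \<Longrightarrow>
       norm b powr p \<le> d * norm a powr p + C * (norm (a + b) powr p - norm a powr p - p * Re (b * k))"
      using uniform_convexity[OF p d(1)] by blast
    have le: "?b n \<le> d * ?a n + C * (m - ?a n - p * Re (?o n))" for n
    proof -
      have "?b n \<le> (LINT t|circ. d * norm (a (?Z n t)) powr p + C * (norm (a (?Z n t) + b (?Z n t)) powr p
          - norm (a (?Z n t)) powr p - p * Re (b (?Z n t) * k (?Z n t))))"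
        using i iR by (intro integral_mono C(2) dual dual0 Z) auto
      also have "\<dots> = d * ?a n + C * (?s n - ?a n - p * Re (?o n))"
        using i iR by simp
      also have "\<dots> \<le> d * ?a n + C * (m - ?a n - p * Re (?o n))"
        using sM[of n] Mm C(1) by (intro add_left_mono mult_left_mono) auto
      finally show ?thesis .
    qed
    have "(\<lambda>n. d * ?a n + C * (m - ?a n - p * Re (?o n))) \<longlonglongrightarrow> d * m + C * (m - m - p * 0)"
      by (intro tendsto_intros mean Re0)
    then have "(\<lambda>n. d * ?a n + C * (m - ?a n - p * Re (?o n))) \<longlonglongrightarrow> d * m" by simp
    from order_tendstoD(2)[OF this d(2)]
    obtain N where "\<And>n. n \<ge> N \<Longrightarrow> d * ?a n + C * (m - ?a n - p * Re (?o n)) < e"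
      by (auto simp: eventually_sequentially)
    then have "?b n < e" if "n \<ge> N" for n using le[of n] that by fastforce
    moreover have "0 \<le> ?b n" for n by (rule Bochner_Integration.integral_nonneg) simp
    ultimately show "\<exists>N. \<forall>n\<ge>N. norm (?b n - 0) < e" by auto
  qed
  then show "b z = 0" by (rule vanishing_mean_imp_zero[OF p b _ z])
qed

text \<open>The exponent may be negative, so a bound needs \<open>1 - cnj (J 0) * J\<close> to be bounded away from \<open>0\<close>.
  This is the case if \<open>\<bar>J 0\<bar> < 1\<close>; otherwise \<open>J\<close> is constant and the power is identically
  \<open>0\<close>.\<close>

lemma extremal_dual_factor:
  assumes J: "inner_function J"
  obtains B where "(\<lambda>z. (1 - cnj (J 0) * J z) powr of_real s) holomorphic_on ball 0 1"
    "\<And>z. z \<in> ball 0 1 \<Longrightarrow> norm ((1 - cnj (J 0) * J z) powr of_real s) \<le> B"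
proof (cases "norm (J 0) = 1")
  case True
  have JJ: "cnj (J 0) * J 0 = 1" using True by (simp add: complex_norm_square[symmetric] mult.commute)
  have eq: "(1 - cnj (J 0) * J z) powr of_real s = 0" if "z \<in> ball 0 1" for z
    using inner_constant[OF J True that] JJ by simp
  show ?thesis
  proof (rule that[of 0])
    show "(\<lambda>z. (1 - cnj (J 0) * J z) powr of_real s) holomorphic_on ball 0 1"
      by (rule holomorphic_transform[of "\<lambda>_. 0"]) (auto simp: eq)
  qed (auto simp: eq)
next
  case False
  then have a: "norm (J 0) < 1" using inner_norm_le_1[OF J, of 0] by simp
  have hJ: "J holomorphic_on ball 0 1" using J by (simp add: inner_function_def)
  have K: "norm (cnj (J 0) * J z) \<le> norm (J 0)" if "z \<in> ball 0 1" for z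
    using inner_norm_le_1[OF J that] by (simp add: norm_mult mult_left_le)
  show ?thesis
  proof (rule that[of "2 powr s + (1 - norm (J 0)) powr s"])
    show "(\<lambda>z. (1 - cnj (J 0) * J z) powr of_real s) holomorphic_on ball 0 1"
    proof (intro holomorphic_on_powr holomorphic_intros hJ)
      fix z :: complex assume "z \<in> ball 0 1"
      then show "1 - cnj (J 0) * J z \<notin> \<real>\<^sub>\<le>\<^sub>0" using K a by (intro one_minus_notin_nonpos) fastforce
    qed
    fix z :: complex assume z: "z \<in> ball 0 1"
    define v where "v = 1 - cnj (J 0) * J z"
    have v1: "1 - norm (J 0) \<le> norm v"
      using norm_triangle_ineq2[of 1 "cnj (J 0) * J z"] K[OF z] by (simp add: v_def)
    have v2: "norm v \<le> 2"
      using norm_triangle_ineq4[of 1 "cnj (J 0) * J z"] K[OF z] a by (simp add: v_def)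
    have "norm v powr s \<le> 2 powr s + (1 - norm (J 0)) powr s"
    proof (cases "s \<ge> 0")
      case True
      then have "norm v powr s \<le> 2 powr s" using v2 by (intro powr_mono2) auto
      then show ?thesis by (simp add: add_increasing2)
    next
      case False
      then have "norm v powr s \<le> (1 - norm (J 0)) powr s" using v1 a by (intro powr_mono2') auto
      then show ?thesis by (simp add: add_increasing)
    qed
    then show "norm ((1 - cnj (J 0) * J z) powr of_real s) \<le> 2 powr s + (1 - norm (J 0)) powr s"
      by (simp add: norm_powr_of_real v_def)
  qed
qed


theorem theorem3p4:
  fixes p :: real and f J F :: "complex \<Rightarrow> complex"
  assumes "1 < p"
    and "f \<in> hardy_space p"
    and "f 0 \<noteq> 0"
    and "inner_function J"
    and "outer_function p F"
    and "\<forall>z\<in>ball 0 1. f z = J z * F z"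
  shows "(\<exists>g. is_metric_projection p (\<lambda>z. 1) (shift_invariant_hull p f) g \<and>
           (\<forall>z\<in>ball 0 1. g z = 1 - (1 - cnj (J 0) * J z) powr of_real (2 / p)) \<and>
           (\<exists>G. outer_function p G \<and> (\<forall>z\<in>ball 0 1. g z = J z * G z))) \<and>
         hardy_dist p (\<lambda>z. 1) (shift_invariant_hull p f) = (1 - (norm (J 0))\<^sup>2) powr (1 / p)"
proof -
  note p = \<open>1 < p\<close> and f = \<open>f \<in> hardy_space p\<close> and J = \<open>inner_function J\<close> and F = \<open>outer_function p F\<close>
  have p0: "0 < p" using p by simp
  have fJF: "f z = J z * F z" if "z \<in> ball 0 1" for z using assms(6) that by blast
  have J0: "J 0 \<noteq> 0" using fJF[of 0] assms(3) by auto
  have hJ: "J holomorphic_on ball 0 1" using J by (simp add: inner_function_def)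
  have J1: "norm (J z) \<le> 1" if "z \<in> ball 0 1" for z by (rule inner_norm_le_1[OF J that])
  have hf: "f holomorphic_on ball 0 1" using f by (simp add: hardy_space_def)
  have hF: "F holomorphic_on ball 0 1" by (rule outer_function_hardy[OF p0 F])
  have F_hardy: "F \<in> hardy_space p"
  proof -
    obtain K where "\<forall>r\<in>{0<..<1}. (LINT t|circ. norm (F (of_real r * cis t)) powr p) \<le> K"
      using outer_function_hardy(2)[OF p0 F] by blast
    then show ?thesis by (intro hardy_spaceI[OF hF, of p K]) auto
  qed
  obtain L B where L: "L holomorphic_on ball 0 1" and LB: "\<And>z. z \<in> ball 0 1 \<Longrightarrow> norm (L z) \<le> B"
    and Lae: "AE t in circ. \<exists>w. has_boundary_value L t w"
    and ext: "\<And>z. z \<in> ball 0 1 \<Longrightarrow> 1 - (1 - cnj (J 0) * J z) powr of_real (2 / p) = J z * exp (L z)"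
    using extremal_factorization[OF p J J0] by blast
  define E where "E = (\<lambda>z. exp (L z))"
  define g where "g = (\<lambda>z. J z * E z)"
  have hE: "E holomorphic_on ball 0 1" unfolding E_def by (intro holomorphic_intros L)
  have EB: "norm (E z) \<le> exp B" if "z \<in> ball 0 1" for z
    using LB[OF that] complex_Re_le_cmod[of "L z"] by (simp add: E_def norm_exp_eq_Re)
  have Eae: "AE t in circ. \<exists>w. has_boundary_value E t w"
    using Lae
  proof eventually_elim
    case (elim t)
    then obtain w where "has_boundary_value L t w" by blast
    then have "has_boundary_value E t (exp w)"
      unfolding has_boundary_value_def E_def by (intro tendsto_intros)
    then show ?case by blast
  qed
  have E_hardy: "E \<in> hardy_space p" by (rule hardy_space_bounded[OF p0 hE EB])
  have hg: "g holomorphic_on ball 0 1" unfolding g_def by (intro holomorphic_intros hJ hE)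
  have g_hardy: "g \<in> hardy_space p"
    unfolding g_def by (rule hardy_space_bounded_mult[OF E_hardy p0 hJ J1])
  define H where "H = shift_invariant_hull p f"
  have H_iff: "x \<in> H \<longleftrightarrow> x \<in> hardy_space p \<and>
      (\<forall>e>0. \<exists>P. hardy_norm p (\<lambda>z. x z - poly P z * f z) < e)" for x
    unfolding H_def shift_invariant_hull_def hardy_closure_def shift_span_eq by auto
  \<comment> \<open>Multiplication by \<open>J\<close> does not increase means, so approximating \<open>E\<close> by multiples of \<open>F\<close> is
    enough.\<close>
  have g_H: "g \<in> H"
    unfolding H_iff
  proof (intro conjI allI impI g_hardy)
    fix e :: real assume e: "0 < e"
    define d where "d = (e / 2) powr p"
    have d: "0 < d" using e by (simp add: d_def)
    obtain P where P: "\<And>r. 0 < r \<Longrightarrow> r < 1 \<Longrightarrow>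
      (LINT t|circ. norm (E (of_real r * cis t) - poly P (of_real r * cis t) * F (of_real r * cis t)) powr p) \<le> d"
      using outer_approx_poly[OF p F hE EB Eae d] by blast
    have "hardy_norm p (\<lambda>z. g z - poly P z * f z) \<le> d powr (1 / p)"
    proof (rule hardy_norm_le[OF _ p0])
      show hol: "(\<lambda>z. g z - poly P z * f z) holomorphic_on ball 0 1" by (intro holomorphic_intros hg hf)
      fix r :: real assume r: "0 < r" "r < 1"
      let ?Z = "\<lambda>t. of_real r * cis t"
      have Z: "?Z t \<in> ball 0 1" for t using circle_in_ball[of r t] r by auto
      note c = hol[THEN holomorphic_on_imp_continuous_on] hE[THEN holomorphic_on_imp_continuous_on]
        hF[THEN holomorphic_on_imp_continuous_on]
      have "(LINT t|circ. norm (g (?Z t) - poly P (?Z t) * f (?Z t)) powr p)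
          \<le> (LINT t|circ. norm (E (?Z t) - poly P (?Z t) * F (?Z t)) powr p)"
      proof (rule integral_mono)
        show "integrable circ (\<lambda>t. norm (g (?Z t) - poly P (?Z t) * f (?Z t)) powr p)"
          by (rule circle_integrable[OF continuous_on_norm_powr[OF p0 c(1)] r])
        show "integrable circ (\<lambda>t. norm (E (?Z t) - poly P (?Z t) * F (?Z t)) powr p)"
          by (rule circle_integrable[OF _ r, of "\<lambda>z. norm (E z - poly P z * F z) powr p"])
             (intro continuous_on_norm_powr p0 continuous_intros c)
        fix t
        have "g (?Z t) - poly P (?Z t) * f (?Z t) = J (?Z t) * (E (?Z t) - poly P (?Z t) * F (?Z t))"
          using fJF[OF Z[of t]] by (simp add: g_def algebra_simps)
        then have "norm (g (?Z t) - poly P (?Z t) * f (?Z t)) \<le> 1 * norm (E (?Z t) - poly P (?Z t) * F (?Z t))"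
          using J1[OF Z[of t]] by (simp only: norm_mult) (intro mult_right_mono, auto)
        then show "norm (g (?Z t) - poly P (?Z t) * f (?Z t)) powr p \<le> norm (E (?Z t) - poly P (?Z t) * F (?Z t)) powr p"
          using p0 by (intro powr_mono2) auto
      qed
      also have "\<dots> \<le> d" by (rule P[OF r])
      finally show "(LINT t|circ. norm (g (?Z t) - poly P (?Z t) * f (?Z t)) powr p) \<le> d" .
    qed
    also have "\<dots> = e / 2" using e p0 by (simp add: d_def powr_powr)
    finally show "\<exists>P. hardy_norm p (\<lambda>z. g z - poly P z * f z) < e" using e by (intro exI[of _ P]) simp
  qed
  \<comment> \<open>The dual extremal function: \<open>k * (1 - g) = \<bar>1 - g\<bar>\<^sup>p = \<bar>v\<bar>\<^sup>2\<close>.\<close>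
  define v where "v = (\<lambda>z. 1 - cnj (J 0) * J z)"
  define W where "W = (\<lambda>z. v z powr of_real (1 - 2 / p))"
  define k where "k = (\<lambda>z. cnj (v z) * W z)"
  obtain BW where W: "W holomorphic_on ball 0 1" and WB: "\<And>z. z \<in> ball 0 1 \<Longrightarrow> norm (W z) \<le> BW"
    using extremal_dual_factor[OF J, of "1 - 2 / p"] unfolding W_def v_def by blast
  have cv: "continuous_on (ball 0 1) v"
    unfolding v_def by (intro continuous_intros holomorphic_on_imp_continuous_on hJ)
  have ck: "continuous_on (ball 0 1) k"
    unfolding k_def by (intro continuous_intros cv holomorphic_on_imp_continuous_on W)
  have kB: "norm (k z) \<le> 2 * BW" if z: "z \<in> ball 0 1" for z
  proof -
    have "norm (cnj (J 0) * J z) \<le> 1"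
      using J1[OF z] J1[of 0] by (simp add: norm_mult mult_le_one)
    then have "norm (v z) \<le> 2"
      using norm_triangle_ineq4[of 1 "cnj (J 0) * J z"] by (simp add: v_def)
    then show ?thesis using WB[OF z] by (simp add: k_def norm_mult mult_mono)
  qed
  have a_eq: "1 - g z = v z powr of_real (2 / p)" if "z \<in> ball 0 1" for z
    using ext[OF that] by (simp add: g_def E_def v_def algebra_simps)
  have a_norm: "norm (1 - g z) powr p = (norm (v z))\<^sup>2" if "z \<in> ball 0 1" for z
    unfolding a_eq[OF that] norm_powr_of_real using p0 by (simp add: powr_powr)
  have dual: "k z * (1 - g z) = of_real (norm (1 - g z) powr p)" if z: "z \<in> ball 0 1" for z
  proof (cases "v z = 0")
    case True
    then show ?thesis unfolding a_norm[OF z] by (simp add: k_def)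
  next
    case False
    have "k z * (1 - g z) = cnj (v z) * (v z powr of_real (1 - 2 / p) * v z powr of_real (2 / p))"
      unfolding a_eq[OF z] k_def W_def by (simp only: mult.assoc)
    also have "v z powr of_real (1 - 2 / p) * v z powr of_real (2 / p) = v z"
      using False by (simp flip: powr_add)
    also have "cnj (v z) * v z = of_real ((norm (v z))\<^sup>2)"
      using complex_norm_square[of "v z"] by (simp only: mult.commute)
    finally show ?thesis unfolding a_norm[OF z] .
  qed
  have dual0: "k z = 0" if "z \<in> ball 0 1" "1 - g z = 0" for z
    using a_norm[OF that(1)] that(2) p0 by (simp add: k_def)
  define m where "m = 1 - (norm (J 0))\<^sup>2"
  have m0: "0 \<le> m" using J1[of 0] by (simp add: m_def power_le_one)
  have mean_eq: "(LINT t|circ. norm (1 - g (of_real r * cis t)) powr p)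
      = 1 - 2 * (norm (J 0))\<^sup>2 + (norm (J 0))\<^sup>2 * (LINT t|circ. (norm (J (of_real r * cis t)))\<^sup>2)"
    if r: "0 < r" "r < 1" for r
  proof -
    let ?Z = "\<lambda>t. of_real r * cis t"
    have Z: "?Z t \<in> ball 0 1" for t using circle_in_ball[of r t] r by auto
    have i: "integrable circ (\<lambda>t. J (?Z t))" "integrable circ (\<lambda>t. (norm (J (?Z t)))\<^sup>2)"
      by (rule circle_integrable[OF _ r], rule holomorphic_on_imp_continuous_on[OF hJ])
        (rule circle_integrable[OF _ r, of "\<lambda>z. (norm (J z))\<^sup>2"],
         intro continuous_intros holomorphic_on_imp_continuous_on hJ)
    define X where "X = (\<lambda>t. Re (cnj (J 0) * J (?Z t)))"
    have iR: "integrable circ X" unfolding X_def using i(1) by (intro integrable_Re) simp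
    have "norm (1 - g (?Z t)) powr p = 1 - 2 * X t + (norm (J 0))\<^sup>2 * (norm (J (?Z t)))\<^sup>2" for t
    proof -
      define x where "x = cnj (J 0) * J (?Z t)"
      have "(norm (1 - x))\<^sup>2 = 1 - 2 * Re x + (norm x)\<^sup>2"
        unfolding cmod_power2 by (simp add: power2_eq_square algebra_simps)
      then show ?thesis unfolding a_norm[OF Z] v_def X_def x_def[symmetric] by (simp add: x_def norm_mult power_mult_distrib)
    qed
    then have "(LINT t|circ. norm (1 - g (?Z t)) powr p)
        = 1 - 2 * (LINT t|circ. X t) + (norm (J 0))\<^sup>2 * (LINT t|circ. (norm (J (?Z t)))\<^sup>2)"
      using i(2) iR by simp
    also have "(LINT t|circ. X t) = Re (cnj (J 0) * (LINT t|circ. J (?Z t)))"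
      unfolding X_def using i(1) by (subst integral_Re) auto
    also have "(LINT t|circ. J (?Z t)) = J 0" by (rule mean_value_disk[OF hJ r])
    also have "Re (cnj (J 0) * J 0) = (norm (J 0))\<^sup>2"
      unfolding cmod_power2 by (simp add: power2_eq_square)
    finally show ?thesis .
  qed
  have mean_le: "(LINT t|circ. norm (1 - g (of_real r * cis t)) powr p) \<le> m" if r: "0 < r" "r < 1" for r
  proof -
    have "(LINT t|circ. (norm (J (of_real r * cis t)))\<^sup>2) \<le> (LINT t|circ. 1)"
    proof (rule integral_mono)
      show "integrable circ (\<lambda>t. (norm (J (of_real r * cis t)))\<^sup>2)"
        by (rule circle_integrable[OF _ r, of "\<lambda>z. (norm (J z))\<^sup>2"])
          (intro continuous_intros holomorphic_on_imp_continuous_on hJ)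
      show "(norm (J (of_real r * cis t)))\<^sup>2 \<le> 1" for t
        using J1[OF circle_in_ball[of r t]] r by (simp add: power_le_one)
    qed auto
    then have "(norm (J 0))\<^sup>2 * (LINT t|circ. (norm (J (of_real r * cis t)))\<^sup>2) \<le> (norm (J 0))\<^sup>2 * 1"
      by (intro mult_left_mono) auto
    then show ?thesis unfolding mean_eq[OF r] m_def by simp
  qed
  have mean_lim: "(\<lambda>n. LINT t|circ. norm (1 - g (of_real (radius n) * cis t)) powr p) \<longlonglongrightarrow> m"
  proof -
    have "(\<lambda>n. 1 - 2 * (norm (J 0))\<^sup>2 + (norm (J 0))\<^sup>2 * (LINT t|circ. (norm (J (of_real (radius n) * cis t)))\<^sup>2))
        \<longlonglongrightarrow> 1 - 2 * (norm (J 0))\<^sup>2 + (norm (J 0))\<^sup>2 * 1"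
      by (intro tendsto_intros inner_mean_power J)
    then show ?thesis using mean_eq radius_bounds by (simp add: m_def)
  qed
  have ca: "continuous_on (ball 0 1) (\<lambda>z. 1 - g z)"
    by (intro continuous_intros holomorphic_on_imp_continuous_on hg)
  have key: "m \<le> hardy_norm p (\<lambda>z. 1 - x z) powr p"
    and key_eq: "\<And>z. hardy_norm p (\<lambda>z. 1 - x z) powr p \<le> m \<Longrightarrow> z \<in> ball 0 1 \<Longrightarrow> x z = g z"
    if x: "x \<in> H" for x
  proof -
    have x_hardy: "x \<in> hardy_space p" using x H_iff by blast
    have b_hardy: "(\<lambda>z. g z - x z) \<in> hardy_space p" by (rule hardy_space_diff[OF g_hardy x_hardy p0])
    then have hb: "(\<lambda>z. g z - x z) holomorphic_on ball 0 1" by (simp add: hardy_space_def)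
    have "\<exists>y\<in>hardy_space p. hardy_norm p (\<lambda>z. g z - x z - y z) < e \<and>
        (\<lambda>n. LINT t|circ. (\<lambda>z. y z * k z) (of_real (radius n) * cis t)) \<longlonglongrightarrow> 0" if e: "0 < e" for e
    proof -
      obtain P where P: "hardy_norm p (\<lambda>z. x z - poly P z * f z) < e" using x e H_iff by blast
      \<comment> \<open>\<open>g - P * f = J * h\<close> is a multiple of \<open>J\<close>, and it differs from \<open>g - x\<close> by \<open>x - P * f\<close>.\<close>
      define h where "h = (\<lambda>z. E z - poly P z * F z)"
      have h: "h \<in> hardy_space p"
        unfolding h_def by (intro hardy_space_diff E_hardy hardy_space_poly_mult F_hardy p0)
      have Jh: "(\<lambda>z. J z * h z) \<in> hardy_space p" by (rule hardy_space_bounded_mult[OF h p0 hJ J1])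
      have "circle_mean p (\<lambda>z. g z - x z - J z * h z) r = circle_mean p (\<lambda>z. x z - poly P z * f z) r" if "r \<in> {0<..<1}" for r
      proof -
        have "norm (g z - x z - J z * h z) = norm (x z - poly P z * f z)" if "z \<in> ball 0 1" for z
        proof -
          have "g z - x z - J z * h z = - (x z - poly P z * f z)"
            using fJF[OF that] by (simp add: g_def h_def algebra_simps)
          then show ?thesis by (simp only: norm_minus_cancel)
        qed
        then show ?thesis using circle_in_ball[of r] that unfolding circle_mean_def by simp
      qed
      then have "circle_mean p (\<lambda>z. g z - x z - J z * h z) ` {0<..<1} = circle_mean p (\<lambda>z. x z - poly P z * f z) ` {0<..<1}"
        by (intro image_cong) auto
      then have "hardy_norm p (\<lambda>z. g z - x z - J z * h z) = hardy_norm p (\<lambda>z. x z - poly P z * f z)"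
        unfolding hardy_norm_def by (rule arg_cong)
      moreover have "(\<lambda>n. LINT t|circ. (\<lambda>z. J z * h z * k z) (of_real (radius n) * cis t)) \<longlonglongrightarrow> 0"
        using inner_conj_mean[OF p J h W WB] unfolding k_def v_def .
      ultimately show ?thesis using P Jh by (intro bexI[of _ "\<lambda>z. J z * h z"]) auto
    qed
    then have orth: "(\<lambda>n. LINT t|circ. (\<lambda>z. (g z - x z) * k z) (of_real (radius n) * cis t)) \<longlonglongrightarrow> 0"
      by (intro closure_orthogonal[OF p b_hardy ck kB])
    have Mb: "(LINT t|circ. norm ((1 - g (of_real r * cis t)) + (g (of_real r * cis t) - x (of_real r * cis t))) powr p)
        \<le> hardy_norm p (\<lambda>z. 1 - x z) powr p" if "0 < r" "r < 1" for r
      using hardy_mean_le[OF hardy_space_diff[OF hardy_space_one x_hardy p0] p0 that] by simp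
    note cd = convexity_duality[OF p ca ck dual dual0 mean_lim hb orth Mb]
    show "m \<le> hardy_norm p (\<lambda>z. 1 - x z) powr p" by (rule cd(1))
    show "x z = g z" if "hardy_norm p (\<lambda>z. 1 - x z) powr p \<le> m" "z \<in> ball 0 1" for z
    proof -
      have "g z - x z = 0" by (rule cd(2)) (use that in auto)
      then show ?thesis by simp
    qed
  qed
  define d where "d = m powr (1 / p)"
  have dp: "d powr p = m" using m0 p0 by (simp add: d_def powr_powr)
  have lower: "d \<le> hardy_norm p (\<lambda>z. 1 - x z)" if "x \<in> H" for x
  proof -
    have "d \<le> (hardy_norm p (\<lambda>z. 1 - x z) powr p) powr (1 / p)"
      unfolding d_def using key[OF that] m0 p0 by (intro powr_mono2) auto
    also have "\<dots> = hardy_norm p (\<lambda>z. 1 - x z)" using p0 hardy_norm_nonneg by (simp add: powr_powr)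
    finally show ?thesis .
  qed
  have "hardy_norm p (\<lambda>z. 1 - g z) \<le> d"
    unfolding d_def by (rule hardy_norm_le[OF _ p0 mean_le]) (intro holomorphic_intros hg)
  then have norm_g: "hardy_norm p (\<lambda>z. 1 - g z) = d" using lower[OF g_H] by simp
  have dist: "hardy_dist p (\<lambda>z. 1) H = d"
    unfolding hardy_dist_def using g_H norm_g lower by (intro cInf_eq_minimum) auto
  have "is_metric_projection p (\<lambda>z. 1) H g"
    unfolding is_metric_projection_def
  proof (intro conjI allI impI ballI)
    show "is_best_approx p (\<lambda>z. 1) H g"
      unfolding is_best_approx_def dist norm_g using g_H by simp
    fix x and z :: complex assume "is_best_approx p (\<lambda>z. 1) H x" and z: "z \<in> ball 0 1"
    then have x: "x \<in> H" "hardy_norm p (\<lambda>z. 1 - x z) powr p \<le> m"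
      unfolding is_best_approx_def dist by (simp_all add: dp)
    show "x z = g z" by (rule key_eq[OF x z])
  qed
  moreover have "\<forall>z\<in>ball 0 1. g z = 1 - (1 - cnj (J 0) * J z) powr of_real (2 / p)"
    using ext by (simp add: g_def E_def)
  moreover have "outer_function p E"
    unfolding E_def by (rule exp_bounded_outer[OF L LB Lae])
  moreover have "\<forall>z\<in>ball 0 1. g z = J z * E z" by (simp add: g_def)
  ultimately show ?thesis using dist unfolding H_def d_def m_def by blast
qed

end
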